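(* Let $\Lambda$ be a lattice in $\mathbb{R}^d\times\widehat{\mathbb{R}}^d$ with adjoint lattice $\Lambda^0$, and let $g,\gamma\in S_0(\mathbb{R}^d)$. The following conditions are equivalent: (1) $S_{g,\gamma}=I$ on $L^2(\mathbb{R}^d)$, i.e. $\sum_{\lambda\in\Lambda}\langle f,\pi(\lambda)\gamma\rangle\pi(\lambda)g=f$ for all $f\in L^2(\mathbb{R}^d)$. (2) $|\Lambda|^{-1}\langle\gamma,\pi(\lambda^0)g\rangle=\delta_{\lambda^0,0}$ for all $\lambda^0\in\Lambda^0$.
   Context: The inner product of $L^2(\mathbb{R}^d)$ is linear in the first argument. Time-frequency shifts: $T_xf(t)=f(t-x)$, $M_\omega f(t)=e^{2\pi i\omega\cdot t}f(t)$, $\pi(x,\omega)=M_\omega T_x$. A lattice is a discrete cocompact subgroup of $\mathbb{R}^d\times\widehat{\mathbb{R}}^d$; $|\Lambda|$ is the Lebesgue measure of a fundamental domain. The adjoint lattice is $\Lambda^0=\{Y:\pi(\lambda)\pi(Y)=\pi(Y)\pi(\lambda)\ \text{for all }\lambda\in\Lambda\}$. Feichtinger's algebra is $S_0(\mathbb{R}^d)=\{f\in L^2(\mathbb{R}^d):\iint|\langle f,\pi(x,\omega)\varphi\rangle|\,dx\,d\omega<\infty\}$ with $\varphi(x)=2^{-d/4}e^{-\pi x\cdot x}$. The Gabor frame operator with analysis window $\gamma$, synthesis window $g$ and lattice $\Lambda$ is $S_{g,\gamma}f=S_{g,\gamma,\Lambda}f=\sum_{\lambda\in\Lambda}\langle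 f,\pi(\lambda)\gamma\rangle\pi(\lambda)g$. $\delta$ is the Kronecker delta. *)

theory Defs
  imports "HOL-Analysis.Analysis"
begin

text \<open>
  Elements of \<open>L\<^sup>2(\<real>\<^sup>d)\<close> are represented by square-integrable Borel functions on \<open>real ^ 'd\<close>
  (every class contains a Borel representative); equality in \<open>L\<^sup>2\<close> is equality almost everywhere.
  The dual group of \<open>\<real>\<^sup>d\<close> is identified with \<open>\<real>\<^sup>d\<close> through the characters
  \<open>t \<mapsto> exp (2 \<pi> \<i> (\<omega> \<bullet> t))\<close>, so phase space is \<open>(real ^ 'd) \<times> (real ^ 'd)\<close>.
\<close>

definition L2 :: "(real ^ 'd \<Rightarrow> complex) set" where
  "L2 = {f. f \<in> borel_measurable lborel \<and> integrable lborel (\<lambda>t. (cmod (f t))\<^sup>2)}"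

definition l2_inner :: "(real ^ 'd \<Rightarrow> complex) \<Rightarrow> (real ^ 'd \<Rightarrow> complex) \<Rightarrow> complex" where
  "l2_inner f g = (LINT t|lborel. f t * cnj (g t))"

definition l2_norm :: "(real ^ 'd \<Rightarrow> complex) \<Rightarrow> real" where
  "l2_norm f = sqrt (LINT t|lborel. (cmod (f t))\<^sup>2)"

definition l2_eq :: "(real ^ 'd \<Rightarrow> complex) \<Rightarrow> (real ^ 'd \<Rightarrow> complex) \<Rightarrow> bool" where
  "l2_eq f g \<longleftrightarrow> (AE t in lborel. f t = g t)"

text \<open>Unconditional convergence of a series in \<open>L\<^sup>2\<close>, in the manner of \<^const>\<open>has_sum\<close>.
  The sum is determined only up to \<^const>\<open>l2_eq\<close>.\<close>

definition l2_has_sum ::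
    "('i \<Rightarrow> real ^ 'd \<Rightarrow> complex) \<Rightarrow> 'i set \<Rightarrow> (real ^ 'd \<Rightarrow> complex) \<Rightarrow> bool" where
  "l2_has_sum u I h \<longleftrightarrow> (\<forall>i\<in>I. u i \<in> L2) \<and> h \<in> L2 \<and>
     ((\<lambda>F. l2_norm (\<lambda>t. (\<Sum>i\<in>F. u i t) - h t)) \<longlongrightarrow> 0) (finite_subsets_at_top I)"

definition translation_op :: "real ^ 'd \<Rightarrow> (real ^ 'd \<Rightarrow> complex) \<Rightarrow> real ^ 'd \<Rightarrow> complex" where
  "translation_op x f = (\<lambda>t. f (t - x))"

definition modulation_op :: "real ^ 'd \<Rightarrow> (real ^ 'd \<Rightarrow> complex) \<Rightarrow> real ^ 'd \<Rightarrow> complex" where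
  "modulation_op \<omega> f = (\<lambda>t. exp (2 * pi * \<i> * complex_of_real (\<omega> \<bullet> t)) * f t)"

definition tf_shift ::
    "(real ^ 'd) \<times> (real ^ 'd) \<Rightarrow> (real ^ 'd \<Rightarrow> complex) \<Rightarrow> real ^ 'd \<Rightarrow> complex" where
  "tf_shift z f = modulation_op (snd z) (translation_op (fst z) f)"

definition gauss :: "real ^ 'd \<Rightarrow> complex" where
  "gauss x = complex_of_real (2 powr (- real CARD('d) / 4) * exp (- pi * (x \<bullet> x)))"

definition S0 :: "(real ^ 'd \<Rightarrow> complex) set" where
  "S0 = {f \<in> L2. (\<integral>\<^sup>+ \<omega>. \<integral>\<^sup>+ x. ennreal (cmod (l2_inner f (tf_shift (x, \<omega>) gauss)))
                      \<partial>lborel \<partial>lborel) < \<infinity>}"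

text \<open>Cocompactness is compactness of the quotient group: the quotient topology on the set of
  cosets is the unique topology that makes the projection a quotient map.\<close>

definition lattice_subgroup :: "((real ^ 'd) \<times> (real ^ 'd)) set \<Rightarrow> bool" where
  "lattice_subgroup \<Lambda> \<longleftrightarrow>
     0 \<in> \<Lambda> \<and> (\<forall>x\<in>\<Lambda>. \<forall>y\<in>\<Lambda>. x + y \<in> \<Lambda>) \<and> (\<forall>x\<in>\<Lambda>. - x \<in> \<Lambda>) \<and>
     discrete \<Lambda> \<and>
     (\<exists>T. quotient_map euclidean T (\<lambda>z. (+) z ` \<Lambda>) \<and> compact_space T)"

definition fundamental_domain ::
    "((real ^ 'd) \<times> (real ^ 'd)) set \<Rightarrow> ((real ^ 'd) \<times> (real ^ 'd)) set \<Rightarrow> bool" where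
  "fundamental_domain \<Lambda> D \<longleftrightarrow> D \<in> sets borel \<and> (\<forall>z. \<exists>!l. l \<in> \<Lambda> \<and> z - l \<in> D)"

text \<open>Every lattice has a fundamental domain in this strict sense, and any two of them have the same
  Lebesgue measure, so the choice below is immaterial.\<close>

definition covolume :: "((real ^ 'd) \<times> (real ^ 'd)) set \<Rightarrow> real" where
  "covolume \<Lambda> = measure lborel (SOME D. fundamental_domain \<Lambda> D)"

text \<open>The commutation relation is an identity of operators on \<open>L\<^sup>2(\<real>\<^sup>d)\<close>.\<close>

definition adjoint_lattice ::
    "((real ^ 'd) \<times> (real ^ 'd)) set \<Rightarrow> ((real ^ 'd) \<times> (real ^ 'd)) set" where
  "adjoint_lattice \<Lambda> = {Y. \<forall>l\<in>\<Lambda>. \<forall>f\<in>L2.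
     l2_eq (tf_shift l (tf_shift Y f)) (tf_shift Y (tf_shift l f))}"

text \<open>\<open>gabor_frame_op g \<gamma> \<Lambda> f h\<close> reads: \<open>S\<^sub>g\<^sub>,\<^sub>\<gamma> f\<close> exists in \<open>L\<^sup>2\<close> and equals \<open>h\<close>,
  with synthesis window \<open>g\<close> and analysis window \<open>\<gamma>\<close>.\<close>

definition gabor_frame_op ::
    "(real ^ 'd \<Rightarrow> complex) \<Rightarrow> (real ^ 'd \<Rightarrow> complex) \<Rightarrow> ((real ^ 'd) \<times> (real ^ 'd)) set \<Rightarrow>
     (real ^ 'd \<Rightarrow> complex) \<Rightarrow> (real ^ 'd \<Rightarrow> complex) \<Rightarrow> bool" where
  "gabor_frame_op g \<gamma> \<Lambda> f h \<longleftrightarrow>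
     l2_has_sum (\<lambda>l t. l2_inner f (tf_shift l \<gamma>) * tf_shift l g t) \<Lambda> h"

end

theory Submission
  imports Defs "HOL-Probability.Characteristic_Functions"
begin

text \<open>
  Write \<open>F z = \<langle>f, \<pi> z \<gamma>\<rangle> \<langle>\<pi> z g, h\<rangle>\<close> for \<open>f\<close>, \<open>h\<close> in \<open>L\<^sup>2\<close> and let \<open>\<Phi> z = (\<Sum>l\<in>\<Lambda>. F (z + l))\<close>.  Up to
  unimodular factors that cancel, \<open>\<pi> (z + l)\<close> is \<open>\<pi> z \<pi> l\<close>, so \<open>\<Phi> z\<close> is the sesquilinear form of the
  frame operator evaluated at \<open>\<pi> (- z) f\<close> and \<open>\<pi> (- z) h\<close>.  If the frame operator is the identity,
  \<open>\<Phi>\<close> is therefore constantly \<open>\<langle>f, h\<rangle>\<close>; conversely, \<open>\<Phi> 0 = \<langle>f, h\<rangle>\<close> for all \<open>f\<close> and \<open>h\<close> says that the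
  operator is weakly the identity.  The theorem follows by comparing \<open>\<Phi>\<close> with a constant through
  Fourier coefficients on the torus \<open>(\<real>\<^sup>d \<times> \<real>\<^sup>d) / \<Lambda>\<close>, whose characters are exactly the phases
  by which \<open>\<pi> Y\<close>, for \<open>Y\<close> in the adjoint lattice, fails to commute with \<open>\<pi> z\<close>.

  The coefficient of \<open>\<Phi>\<close> at \<open>Y\<close> unfolds to the integral of \<open>F\<close> times a character over all of phase
  space.  The character turns \<open>\<pi> z g\<close> into a shift of \<open>\<pi> Y g\<close>, and the orthogonality relations
  (\<open>moyal\<close>) evaluate the integral as \<open>\<langle>f, \<pi> Y h\<rangle> \<langle>\<pi> Y g, \<gamma>\<rangle>\<close> (\<open>fourier_coefficient\<close>).  A constant
  has a coefficient only at \<open>Y = 0\<close>, where it is multiplied by the covolume.  If \<open>\<Phi>\<close> is constant, the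
  choice \<open>f = \<pi> Y h\<close> with \<open>h\<close> the Gaussian isolates \<open>\<langle>\<pi> Y g, \<gamma>\<rangle>\<close>.  If biorthogonality holds, \<open>\<Phi>\<close> and
  the constant have the same coefficients, and since \<open>\<Phi>\<close> is continuous, \<open>fourier_uniqueness\<close> makes
  them equal.

  Four facts carry this.  \<open>moyal\<close> is proved for all of \<open>L\<^sup>2\<close> by damping high frequencies with a
  Gaussian, which turns both sides into averages over small translations; strong continuity of
  translations removes the damping.  \<open>bessel_S0\<close> gives square-summable coefficients for windows in
  Feichtinger's algebra; it makes the form bounded, hence \<open>\<Phi>\<close> continuous, and upgrades weak
  convergence of the frame series to unconditional convergence in norm.  \<open>lattice_coordinates_exist\<close>
  supplies a basis of the lattice, hence a bounded fundamental domain.  \<open>fourier_uniqueness\<close> is the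
  Stone-Weierstrass theorem for polynomials in the cosines and sines of the dual coordinates.
\<close>

section \<open>Square-integrable functions\<close>

definition ephase :: "real \<Rightarrow> complex" where
  "ephase r = exp (2 * pi * \<i> * complex_of_real r)"

lemma ephase_cis: "ephase r = cis (2 * pi * r)"
  by (simp add: ephase_def cis_conv_exp mult_ac)

lemma ephase_add: "ephase (a + b) = ephase a * ephase b"
  by (simp add: ephase_cis cis_mult distrib_left)

lemma ephase_0 [simp]: "ephase 0 = 1"
  by (simp add: ephase_cis)

lemma norm_ephase [simp]: "cmod (ephase r) = 1"
  by (simp add: ephase_cis)

lemma cnj_ephase: "cnj (ephase r) = ephase (- r)"
  by (simp add: ephase_cis cis_cnj)

lemma ephase_mult_minus [simp]: "ephase r * ephase (- r) = 1" "ephase (- r) * ephase r = 1"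
  by (simp_all flip: ephase_add)

lemma ephase_neq_0 [simp]: "ephase r \<noteq> 0"
  by (simp add: ephase_cis)

lemma ephase_eq_1_iff: "ephase r = 1 \<longleftrightarrow> r \<in> \<int>"
proof
  assume "ephase r = 1"
  then have "cos (2 * pi * r) = 1"
    by (simp add: ephase_cis complex_eq_iff)
  then obtain n :: int where "2 * pi * r = of_int n * 2 * pi"
    by (auto simp: cos_one_2pi_int)
  then have "r = of_int n" by simp
  then show "r \<in> \<int>" by simp
next
  assume "r \<in> \<int>"
  then show "ephase r = 1"
    by (auto simp: ephase_cis elim!: Ints_cases)
qed

lemma continuous_on_ephase [continuous_intros]:
  "continuous_on S f \<Longrightarrow> continuous_on S (\<lambda>x. ephase (f x))"
  unfolding ephase_def by (intro continuous_intros)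

lemma tendsto_ephase [tendsto_intros]:
  "(f \<longlongrightarrow> a) F \<Longrightarrow> ((\<lambda>x. ephase (f x)) \<longlongrightarrow> ephase a) F"
  unfolding ephase_def by (intro tendsto_intros)

lemma measurable_ephase [measurable]: "ephase \<in> borel_measurable borel"
  by (intro borel_measurable_continuous_onI continuous_on_ephase continuous_on_id)

lemma L2D [measurable_dest]: "f \<in> L2 \<Longrightarrow> f \<in> borel_measurable borel"
  by (simp add: L2_def)

lemma L2_integrable: "f \<in> L2 \<Longrightarrow> integrable lborel (\<lambda>t. (cmod (f t))\<^sup>2)"
  by (simp add: L2_def)

lemma L2I:
  "f \<in> borel_measurable borel \<Longrightarrow> integrable lborel (\<lambda>t. (cmod (f t))\<^sup>2) \<Longrightarrow> f \<in> L2"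
  by (simp add: L2_def)

lemma integrable_mult_of_square_integrable:
  fixes f g :: "'a \<Rightarrow> complex"
  assumes [measurable]: "f \<in> borel_measurable M" "g \<in> borel_measurable M"
    and "integrable M (\<lambda>t. (cmod (f t))\<^sup>2)" "integrable M (\<lambda>t. (cmod (g t))\<^sup>2)"
  shows "integrable M (\<lambda>t. f t * g t)"
proof (rule Bochner_Integration.integrable_bound)
  show "integrable M (\<lambda>t. (cmod (f t))\<^sup>2 + (cmod (g t))\<^sup>2)"
    using assms by simp
  have "a * b \<le> a\<^sup>2 + b\<^sup>2" if "0 \<le> a" "0 \<le> b" for a b :: real
    using sum_squares_bound[of a b] mult_nonneg_nonneg[OF that] by linarith
  then show "AE t in M. norm (f t * g t) \<le> norm ((cmod (f t))\<^sup>2 + (cmod (g t))\<^sup>2)"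
    by (simp add: norm_mult)
qed simp

lemma L2_mult_integrable:
  assumes "f \<in> L2" "g \<in> L2"
  shows "integrable lborel (\<lambda>t. f t * g t)"
  using assms by (intro integrable_mult_of_square_integrable) (auto simp: L2_def)

lemma measurable_cnj [measurable]: "cnj \<in> borel_measurable borel"
  by (intro borel_measurable_continuous_onI continuous_intros)

lemma L2_cnj: "f \<in> L2 \<Longrightarrow> (\<lambda>t. cnj (f t)) \<in> L2"
  by (auto simp: L2_def intro: measurable_compose[OF _ measurable_cnj])

lemma L2_inner_integrable:
  "f \<in> L2 \<Longrightarrow> g \<in> L2 \<Longrightarrow> integrable lborel (\<lambda>t. f t * cnj (g t))"
  using L2_mult_integrable[OF _ L2_cnj] by blast

lemma L2_scale: "f \<in> L2 \<Longrightarrow> (\<lambda>t. c * f t) \<in> L2"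
  by (auto simp: L2_def norm_mult power_mult_distrib)

lemma L2_add:
  assumes "f \<in> L2" "g \<in> L2"
  shows "(\<lambda>t. f t + g t) \<in> L2"
proof (rule L2I)
  show "integrable lborel (\<lambda>t. (cmod (f t + g t))\<^sup>2)"
  proof (rule Bochner_Integration.integrable_bound)
    show "integrable lborel (\<lambda>t. 2 * (cmod (f t))\<^sup>2 + 2 * (cmod (g t))\<^sup>2)"
      using assms by (simp add: L2_integrable)
    have "(cmod (a + b))\<^sup>2 \<le> 2 * (cmod a)\<^sup>2 + 2 * (cmod b)\<^sup>2" for a b
    proof -
      have "(cmod (a + b))\<^sup>2 \<le> (cmod a + cmod b)\<^sup>2"
        by (intro power_mono norm_triangle_ineq) simp
      also have "\<dots> \<le> 2 * (cmod a)\<^sup>2 + 2 * (cmod b)\<^sup>2"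
        using sum_squares_bound[of "cmod a" "cmod b"] by (simp add: power2_sum)
      finally show ?thesis .
    qed
    then show "AE t in lborel. norm ((cmod (f t + g t))\<^sup>2)
        \<le> norm (2 * (cmod (f t))\<^sup>2 + 2 * (cmod (g t))\<^sup>2)"
      by simp
    show "(\<lambda>t. (cmod (f t + g t))\<^sup>2) \<in> borel_measurable lborel"
      using assms by measurable
  qed
  show "(\<lambda>t. f t + g t) \<in> borel_measurable borel" using assms by measurable
qed

lemma L2_diff: "f \<in> L2 \<Longrightarrow> g \<in> L2 \<Longrightarrow> (\<lambda>t. f t - g t) \<in> L2"
  using L2_add[of f "\<lambda>t. (-1) * g t"] L2_scale[of g "-1"] by simp

lemma L2_zero: "(\<lambda>t. 0) \<in> L2"
  by (simp add: L2_def)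

lemma L2_sum: "(\<And>i. i \<in> F \<Longrightarrow> u i \<in> L2) \<Longrightarrow> (\<lambda>t. \<Sum>i\<in>F. u i t) \<in> L2"
  by (induction F rule: infinite_finite_induct) (auto intro: L2_add L2_zero)

lemma l2_inner_cnj: "cnj (l2_inner f g) = l2_inner g f"
  unfolding l2_inner_def by (subst Bochner_Integration.integral_cnj[symmetric]) (simp add: mult_ac)

lemma l2_inner_add_left:
  "f \<in> L2 \<Longrightarrow> g \<in> L2 \<Longrightarrow> h \<in> L2 \<Longrightarrow>
   l2_inner (\<lambda>t. f t + g t) h = l2_inner f h + l2_inner g h"
  by (simp add: l2_inner_def distrib_right L2_inner_integrable)

lemma l2_inner_diff_left:
  "f \<in> L2 \<Longrightarrow> g \<in> L2 \<Longrightarrow> h \<in> L2 \<Longrightarrow>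
   l2_inner (\<lambda>t. f t - g t) h = l2_inner f h - l2_inner g h"
  by (simp add: l2_inner_def left_diff_distrib L2_inner_integrable)

lemma l2_inner_add_right:
  "f \<in> L2 \<Longrightarrow> g \<in> L2 \<Longrightarrow> h \<in> L2 \<Longrightarrow>
   l2_inner f (\<lambda>t. g t + h t) = l2_inner f g + l2_inner f h"
  by (simp add: l2_inner_def distrib_left L2_inner_integrable)

lemma l2_inner_diff_right:
  "f \<in> L2 \<Longrightarrow> g \<in> L2 \<Longrightarrow> h \<in> L2 \<Longrightarrow>
   l2_inner f (\<lambda>t. g t - h t) = l2_inner f g - l2_inner f h"
  by (simp add: l2_inner_def right_diff_distrib L2_inner_integrable)

lemma l2_inner_scale_left: "l2_inner (\<lambda>t. c * f t) g = c * l2_inner f g"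
  by (simp add: l2_inner_def mult.assoc)

lemma l2_inner_scale_right: "l2_inner f (\<lambda>t. c * g t) = cnj c * l2_inner f g"
  by (metis (no_types) l2_inner_cnj l2_inner_scale_left complex_cnj_mult)

lemma l2_inner_sum_left:
  "(\<And>i. i \<in> F \<Longrightarrow> u i \<in> L2) \<Longrightarrow> h \<in> L2 \<Longrightarrow>
   l2_inner (\<lambda>t. \<Sum>i\<in>F. u i t) h = (\<Sum>i\<in>F. l2_inner (u i) h)"
  by (induction F rule: infinite_finite_induct)
     (simp_all add: l2_inner_add_left L2_sum, simp_all add: l2_inner_def)

lemma l2_inner_sum_right:
  assumes "\<And>i. i \<in> F \<Longrightarrow> u i \<in> L2" "h \<in> L2"
  shows "l2_inner h (\<lambda>t. \<Sum>i\<in>F. u i t) = (\<Sum>i\<in>F. l2_inner h (u i))"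
proof -
  have "l2_inner h (\<lambda>t. \<Sum>i\<in>F. u i t) = cnj (\<Sum>i\<in>F. l2_inner (u i) h)"
    by (simp add: l2_inner_sum_left[OF assms, symmetric] l2_inner_cnj)
  then show ?thesis by (simp add: l2_inner_cnj)
qed

lemma l2_norm_nonneg [simp]: "0 \<le> l2_norm f"
  by (simp add: l2_norm_def)

lemma l2_norm_power2: "(l2_norm f)\<^sup>2 = (LINT t|lborel. (cmod (f t))\<^sup>2)"
  by (simp add: l2_norm_def)

lemma l2_inner_self: "l2_inner f f = complex_of_real ((l2_norm f)\<^sup>2)"
  by (simp add: l2_norm_power2 l2_inner_def complex_norm_square[symmetric] del: of_real_power)

lemma l2_cauchy_schwarz_abs:
  assumes [measurable]: "f \<in> L2" "g \<in> L2"
  shows "(LINT t|lborel. cmod (f t) * cmod (g t)) \<le> l2_norm f * l2_norm g"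
proof -
  define I where "I = (LINT t|lborel. cmod (f t) * cmod (g t))"
  have "integrable lborel (\<lambda>t. cmod (f t) * cmod (g t))"
    using integrable_norm[OF L2_mult_integrable[OF assms]] by (simp add: norm_mult)
  then have 1: "(\<integral>\<^sup>+t. ennreal (cmod (f t)) * ennreal (cmod (g t)) \<partial>lborel) = ennreal I"
    by (simp add: I_def ennreal_mult[symmetric] nn_integral_eq_integral)
  have 2: "(\<integral>\<^sup>+t. (ennreal (cmod (u t)))\<^sup>2 \<partial>lborel) = ennreal ((l2_norm u)\<^sup>2)" if "u \<in> L2" for u
    using that by (simp add: l2_norm_power2 ennreal_power nn_integral_eq_integral L2_integrable)
  have "(ennreal I)\<^sup>2 \<le> ennreal ((l2_norm f)\<^sup>2) * ennreal ((l2_norm g)\<^sup>2)"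
    unfolding 1[symmetric] 2[OF assms(1), symmetric] 2[OF assms(2), symmetric]
    by (rule Cauchy_Schwarz_nn_integral) measurable
  then have "ennreal (I\<^sup>2) \<le> ennreal ((l2_norm f * l2_norm g)\<^sup>2)"
    by (simp add: ennreal_power ennreal_mult[symmetric] power_mult_distrib I_def)
  then have "I\<^sup>2 \<le> (l2_norm f * l2_norm g)\<^sup>2"
    by (simp add: ennreal_le_iff)
  then show ?thesis
    unfolding I_def by (rule power2_le_imp_le) simp
qed

lemma l2_cauchy_schwarz:
  assumes "f \<in> L2" "g \<in> L2"
  shows "cmod (l2_inner f g) \<le> l2_norm f * l2_norm g"
proof -
  have "cmod (l2_inner f g) \<le> (LINT t|lborel. cmod (f t * cnj (g t)))"
    unfolding l2_inner_def by (rule integral_norm_bound)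
  also have "\<dots> \<le> l2_norm f * l2_norm g"
    using l2_cauchy_schwarz_abs[OF assms] by (simp add: norm_mult)
  finally show ?thesis .
qed

lemma l2_norm_scale: "l2_norm (\<lambda>t. c * f t) = cmod c * l2_norm f"
  by (simp add: l2_norm_def norm_mult power_mult_distrib real_sqrt_mult)

lemma l2_norm_triangle:
  assumes "f \<in> L2" "g \<in> L2"
  shows "l2_norm (\<lambda>t. f t + g t) \<le> l2_norm f + l2_norm g"
proof (rule power2_le_imp_le)
  have "complex_of_real ((l2_norm (\<lambda>t. f t + g t))\<^sup>2) =
      l2_inner f f + l2_inner g g + (l2_inner f g + cnj (l2_inner f g))"
    unfolding l2_inner_self[symmetric]
    using assms by (simp add: l2_inner_add_left l2_inner_add_right L2_add l2_inner_cnj)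
  also have "\<dots> = complex_of_real ((l2_norm f)\<^sup>2 + (l2_norm g)\<^sup>2 + 2 * Re (l2_inner f g))"
    by (simp add: l2_inner_self complex_add_cnj)
  finally have "(l2_norm (\<lambda>t. f t + g t))\<^sup>2 = (l2_norm f)\<^sup>2 + (l2_norm g)\<^sup>2 + 2 * Re (l2_inner f g)"
    using of_real_eq_iff by blast
  also have "\<dots> \<le> (l2_norm f)\<^sup>2 + (l2_norm g)\<^sup>2 + 2 * (l2_norm f * l2_norm g)"
    using l2_cauchy_schwarz[OF assms] complex_Re_le_cmod[of "l2_inner f g"] by simp
  finally show "(l2_norm (\<lambda>t. f t + g t))\<^sup>2 \<le> (l2_norm f + l2_norm g)\<^sup>2"
    by (simp add: power2_sum)
qed simp

lemma l2_norm_minus_commute: "l2_norm (\<lambda>t. f t - g t) = l2_norm (\<lambda>t. g t - f t)"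
  by (simp add: l2_norm_def norm_minus_commute)

section \<open>Time-frequency shifts\<close>

lemma nn_integral_lborel_translate:
  fixes f :: "'a::euclidean_space \<Rightarrow> ennreal"
  assumes [measurable]: "f \<in> borel_measurable borel"
  shows "(\<integral>\<^sup>+t. f (t + c) \<partial>lborel) = (\<integral>\<^sup>+t. f t \<partial>lborel)"
proof -
  have "(\<integral>\<^sup>+t. f t \<partial>lborel) = (\<integral>\<^sup>+t. f t \<partial>distr lborel borel ((+) c))"
    by (simp add: lborel_distr_plus)
  also have "\<dots> = (\<integral>\<^sup>+t. f (c + t) \<partial>lborel)"
    by (subst nn_integral_distr) auto
  finally show ?thesis by (simp add: add.commute)
qed

lemma lborel_integrable_translate:
  fixes f :: "'a::euclidean_space \<Rightarrow> 'b::{banach, second_countable_topology}"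
  shows "integrable lborel (\<lambda>t. f (t + c)) \<longleftrightarrow> integrable lborel f"
proof -
  have *: "integrable lborel (\<lambda>t. f (t + c))" if "integrable lborel f" for f :: "'a \<Rightarrow> 'b" and c
  proof -
    have "integrable (distr lborel borel ((+) c)) f" using that by (simp add: lborel_distr_plus)
    then have "integrable lborel (\<lambda>t. f (c + t))"
      by (subst (asm) integrable_distr_eq) (use that in auto)
    then show ?thesis by (simp add: add.commute)
  qed
  show ?thesis using *[of f c] *[of "\<lambda>t. f (t + c)" "- c"] by auto
qed

lemma lborel_integral_translate:
  fixes f :: "'a::euclidean_space \<Rightarrow> 'b::{banach, second_countable_topology}"
  shows "(LINT t|lborel. f (t + c)) = (LINT t|lborel. f t)"
proof (cases "integrable lborel f")
  case True
  have "(LINT t|lborel. f t) = (LINT t|distr lborel borel ((+) c). f t)"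
    by (simp add: lborel_distr_plus)
  also have "\<dots> = (LINT t|lborel. f (c + t))"
    using True by (subst integral_distr) auto
  finally show ?thesis by (simp add: add.commute)
next
  case False
  then show ?thesis
    using lborel_integrable_translate[of f c] by (simp add: not_integrable_integral_eq)
qed

lemma tf_shift_eq: "tf_shift z f t = ephase (snd z \<bullet> t) * f (t - fst z)"
  by (simp add: tf_shift_def modulation_op_def translation_op_def ephase_def)

lemma tf_shift_L2:
  assumes "f \<in> L2"
  shows "tf_shift z f \<in> L2"
proof (rule L2I)
  have [measurable]: "f \<in> borel_measurable borel" using assms by (rule L2D)
  show "tf_shift z f \<in> borel_measurable borel"
    unfolding tf_shift_eq[abs_def] by measurable
  show "integrable lborel (\<lambda>t. (cmod (tf_shift z f t))\<^sup>2)"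
    using lborel_integrable_translate[of "\<lambda>t. (cmod (f t))\<^sup>2" "- fst z"] L2_integrable[OF assms]
    by (simp add: tf_shift_eq norm_mult)
qed

lemma l2_inner_tf_shift: "l2_inner (tf_shift z f) (tf_shift z g) = l2_inner f g"
proof -
  have "tf_shift z f t * cnj (tf_shift z g t) = f (t + - fst z) * cnj (g (t + - fst z))" for t
  proof -
    have "tf_shift z f t * cnj (tf_shift z g t) =
        (ephase (snd z \<bullet> t) * ephase (- (snd z \<bullet> t))) * (f (t - fst z) * cnj (g (t - fst z)))"
      by (simp only: tf_shift_eq cnj_ephase complex_cnj_mult mult_ac)
    then show ?thesis by simp
  qed
  then show ?thesis
    unfolding l2_inner_def by (simp only: lborel_integral_translate[where f="\<lambda>t. f t * cnj (g t)"])
qed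

lemma l2_norm_tf_shift: "l2_norm (tf_shift z f) = l2_norm f"
  using l2_inner_tf_shift[of z f f] by (simp add: l2_inner_self power2_eq_iff_nonneg del: of_real_power)

lemma tf_shift_0 [simp]: "tf_shift 0 f = f"
  by (rule ext) (simp add: tf_shift_eq)

lemma tf_shift_diff: "tf_shift z (\<lambda>t. f t - g t) = (\<lambda>t. tf_shift z f t - tf_shift z g t)"
  by (rule ext) (simp add: tf_shift_eq right_diff_distrib)

lemma tf_shift_compose:
  "tf_shift z (tf_shift w f) = (\<lambda>t. ephase (- (snd w \<bullet> fst z)) * tf_shift (z + w) f t)"
proof (rule ext)
  fix t
  have "snd z \<bullet> t + snd w \<bullet> (t - fst z) = - (snd w \<bullet> fst z) + snd (z + w) \<bullet> t"
    by (simp add: inner_diff_right inner_add_left)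
  then have "ephase (snd z \<bullet> t) * ephase (snd w \<bullet> (t - fst z)) =
      ephase (- (snd w \<bullet> fst z)) * ephase (snd (z + w) \<bullet> t)"
    by (metis ephase_add)
  then show "tf_shift z (tf_shift w f) t = ephase (- (snd w \<bullet> fst z)) * tf_shift (z + w) f t"
    by (simp add: tf_shift_eq diff_diff_eq flip: mult.assoc)
qed

lemma l2_inner_tf_shift_adjoint:
  "l2_inner f (tf_shift z g) = ephase (- (fst z \<bullet> snd z)) * l2_inner (tf_shift (- z) f) g"
proof -
  have "l2_inner f (tf_shift z g) = l2_inner (tf_shift (- z) f) (tf_shift (- z) (tf_shift z g))"
    by (simp add: l2_inner_tf_shift)
  also have "\<dots> = ephase (- (fst z \<bullet> snd z)) * l2_inner (tf_shift (- z) f) g"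
    by (simp add: tf_shift_compose l2_inner_scale_right cnj_ephase inner_commute)
  finally show ?thesis .
qed

section \<open>Strong continuity of time-frequency shifts\<close>

lemma l2_norm_tendsto_0_dominated:
  fixes u :: "nat \<Rightarrow> real ^ 'd \<Rightarrow> complex"
  assumes [measurable]: "\<And>n. u n \<in> borel_measurable borel" and w: "integrable lborel w"
    and lim: "AE t in lborel. (\<lambda>n. u n t) \<longlonglongrightarrow> 0"
    and bound: "\<And>n. AE t in lborel. (cmod (u n t))\<^sup>2 \<le> w t"
  shows "(\<lambda>n. l2_norm (u n)) \<longlonglongrightarrow> 0"
proof -
  have "(\<lambda>n. LINT t|lborel. (cmod (u n t))\<^sup>2) \<longlonglongrightarrow> (LINT t|(lborel :: (real ^ 'd) measure). (0::real))"
  proof (rule integral_dominated_convergence[OF _ _ w])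
    show "AE t in lborel. (\<lambda>n. (cmod (u n t))\<^sup>2) \<longlonglongrightarrow> 0"
      using lim
    proof eventually_elim
      case (elim t)
      show ?case using tendsto_power[OF tendsto_norm[OF elim], of 2] by simp
    qed
  qed (use bound in auto)
  then show ?thesis
    unfolding l2_norm_def using tendsto_real_sqrt by fastforce
qed

lemma integrable_indicator_cball:
  "integrable lborel (\<lambda>t::'a::euclidean_space. c * indicator (cball 0 r) t :: real)"
  by (intro integrable_mult_right integrable_real_indicator)
     (use emeasure_lborel_cball_finite[of "0::'a" r] in \<open>auto simp: less_top\<close>)

lemma L2_bounded_support:
  fixes g :: "real ^ 'd \<Rightarrow> complex"
  assumes [measurable]: "g \<in> borel_measurable borel"
    and "\<And>t. cmod (g t) \<le> B" "\<And>t. R < norm t \<Longrightarrow> g t = 0"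
  shows "g \<in> L2"
proof (rule L2I)
  show "integrable lborel (\<lambda>t. (cmod (g t))\<^sup>2)"
  proof (rule Bochner_Integration.integrable_bound[OF integrable_indicator_cball[of "B\<^sup>2" R]])
    have "(cmod (g t))\<^sup>2 \<le> B\<^sup>2 * indicator (cball 0 R) t" for t
      using assms(2)[of t] assms(3)[of t]
      by (cases "R < norm t") (auto intro: power_mono simp: indicator_def)
    then show "AE t in lborel. norm ((cmod (g t))\<^sup>2) \<le> norm (B\<^sup>2 * indicator (cball 0 R) t)"
      by (auto intro!: AE_I2 order_trans[OF _ abs_ge_self])
  qed simp
qed simp

lemma L2_dense_bounded_support:
  fixes f :: "real ^ 'd \<Rightarrow> complex"
  assumes f: "f \<in> L2" and e: "0 < e"
  obtains g R where "g \<in> borel_measurable borel" "\<And>t. cmod (g t) \<le> R"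
    "\<And>t. R < norm t \<Longrightarrow> g t = 0" "l2_norm (\<lambda>t. f t - g t) < e" "0 < R"
proof -
  have [measurable]: "f \<in> borel_measurable borel" using f by (rule L2D)
  define h where "h n t = (if norm t \<le> real (Suc n) \<and> cmod (f t) \<le> real (Suc n) then f t else 0)" for n t
  have [measurable]: "h n \<in> borel_measurable borel" for n
    unfolding h_def by measurable
  have "(\<lambda>n. l2_norm (\<lambda>t. f t - h n t)) \<longlonglongrightarrow> 0"
  proof (rule l2_norm_tendsto_0_dominated[OF _ L2_integrable[OF f]])
    have "(\<lambda>n. f t - h n t) \<longlonglongrightarrow> 0" for t
    proof (rule tendsto_eventually)
      obtain N where N: "max (norm t) (cmod (f t)) \<le> real N" using real_arch_simple by blast
      show "\<forall>\<^sub>F n in sequentially. f t - h n t = 0"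
        using eventually_ge_at_top[of N]
      proof eventually_elim
        case (elim n)
        then have "real N \<le> real (Suc n)" by simp
        then show ?case using N by (simp add: h_def)
      qed
    qed
    then show "AE t in lborel. (\<lambda>n. f t - h n t) \<longlonglongrightarrow> 0" by simp
    show "AE t in lborel. (cmod (f t - h n t))\<^sup>2 \<le> (cmod (f t))\<^sup>2" for n
      by (simp add: h_def)
  qed measurable
  from order_tendstoD(2)[OF this e] obtain n where n: "l2_norm (\<lambda>t. f t - h n t) < e"
    by (auto simp: eventually_sequentially)
  show ?thesis
  proof (rule that[of "h n" "real (Suc n)"])
    show "cmod (h n t) \<le> real (Suc n)" for t by (auto simp: h_def)
    show "real (Suc n) < norm t \<Longrightarrow> h n t = 0" for t by (auto simp: h_def)
  qed (use n in auto)
qed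

text \<open>Truncation reduces to a bounded function of bounded support.  Such a function is almost everywhere
  a limit of continuous functions, which a clipping of the values and a cutoff of the argument
  dominate by one square-integrable function.\<close>

lemma L2_dense_continuous_bounded_support:
  fixes f :: "real ^ 'd \<Rightarrow> complex"
  assumes f: "f \<in> L2" and e: "0 < e"
  obtains g B R where "continuous_on UNIV g" "\<And>t. cmod (g t) \<le> B"
    "\<And>t. R < norm t \<Longrightarrow> g t = 0" "l2_norm (\<lambda>t. f t - g t) < e"
proof -
  obtain h R where [measurable]: "h \<in> borel_measurable borel" and hR: "\<And>t. cmod (h t) \<le> R"
    and h0: "\<And>t. R < norm t \<Longrightarrow> h t = 0" and fh: "l2_norm (\<lambda>t. f t - h t) < e / 2" and R: "0 < R"
    using L2_dense_bounded_support[OF f, of "e / 2"] e by auto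
  have "h measurable_on UNIV"
    by (simp add: measurable_on_iff_borel_measurable lebesgue_on_UNIV_eq measurable_completion)
  then obtain N G where N: "negligible N" and G: "\<And>n. continuous_on UNIV (G n)"
    and lim: "\<And>t. t \<notin> N \<Longrightarrow> (\<lambda>n. G n t) \<longlonglongrightarrow> h t"
    by (auto simp: measurable_on_def)
  \<comment> \<open>Radial retraction onto the disc of radius \<open>R\<close>: continuous, and the identity on the values of \<open>h\<close>.\<close>
  define clip where "clip z = (R / max R (cmod z)) *\<^sub>R z" for z :: complex
  have clip_cont: "continuous_on UNIV clip"
    unfolding clip_def using R by (intro continuous_intros) (auto simp: max_def)
  have clip_le: "cmod (clip z) \<le> R" for z
    using R by (auto simp: clip_def max_def field_simps)
  have clip_id: "clip z = z" if "cmod z \<le> R" for z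
    using R that by (simp add: clip_def max_def)
  define cut where "cut t = max 0 (min 1 (R + 1 - norm t))" for t :: "real ^ 'd"
  have cut: "0 \<le> cut t" "cut t \<le> 1" "R + 1 < norm t \<Longrightarrow> cut t = 0" "norm t \<le> R \<Longrightarrow> cut t = 1" for t
    by (auto simp: cut_def)
  define g where "g n t = cut t *\<^sub>R clip (G n t)" for n t
  have gcont: "continuous_on UNIV (g n)" for n
    unfolding g_def cut_def
    by (intro continuous_intros continuous_on_compose2[OF clip_cont G]) auto
  have [measurable]: "g n \<in> borel_measurable borel" for n
    using gcont by (rule borel_measurable_continuous_onI)
  have gR: "cmod (g n t) \<le> R" for n t
    using mult_mono[OF cut(2)[of t] clip_le[of "G n t"]] cut(1)[of t] by (simp add: g_def)
  have g0: "g n t = 0" if "R + 1 < norm t" for n t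
    using that by (simp add: g_def cut)
  have "(\<lambda>n. l2_norm (\<lambda>t. h t - g n t)) \<longlonglongrightarrow> 0"
  proof (rule l2_norm_tendsto_0_dominated[OF _ integrable_indicator_cball[of "(2 * R)\<^sup>2" "R + 1"]])
    have ae: "AE t in lborel. t \<notin> N"
      using N AE_not_in[of N lebesgue] by (simp add: negligible_iff_null_sets AE_completion_iff)
    show "AE t in lborel. (\<lambda>n. h t - g n t) \<longlonglongrightarrow> 0"
      using ae
    proof eventually_elim
      case (elim t)
      have "(\<lambda>n. clip (G n t)) \<longlonglongrightarrow> clip (h t)"
        using continuous_on_tendsto_compose[OF clip_cont lim[OF elim]] by simp
      then have "(\<lambda>n. g n t) \<longlonglongrightarrow> cut t *\<^sub>R h t"
        unfolding g_def using clip_id[OF hR] by (auto intro: tendsto_intros)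
      moreover have "cut t *\<^sub>R h t = h t"
        using cut(4)[of t] h0[of t] by (cases "norm t \<le> R") auto
      ultimately have "(\<lambda>n. g n t) \<longlonglongrightarrow> h t" by simp
      from tendsto_diff[OF tendsto_const[of "h t"] this] show ?case by simp
    qed
    have "(cmod (h t - g n t))\<^sup>2 \<le> (2 * R)\<^sup>2 * indicator (cball 0 (R + 1)) t" for n t
    proof (cases "R + 1 < norm t")
      case True
      then show ?thesis using h0[of t] g0[of t n] by simp
    next
      case False
      have "cmod (h t - g n t) \<le> 2 * R"
        using norm_triangle_ineq4[of "h t" "g n t"] hR[of t] gR[of n t] by simp
      from power_mono[OF this norm_ge_zero, of 2] show ?thesis using False by simp
    qed
    then show "AE t in lborel. (cmod (h t - g n t))\<^sup>2 \<le> (2 * R)\<^sup>2 * indicator (cball 0 (R + 1)) t" for n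
      by simp
  qed measurable
  from order_tendstoD(2)[OF this, of "e / 2"] e obtain n where n: "l2_norm (\<lambda>t. h t - g n t) < e / 2"
    by (auto simp: eventually_sequentially)
  have "h \<in> L2" "g n \<in> L2"
    using L2_bounded_support[of h R R] L2_bounded_support[of "g n" R "R + 1"] hR h0 gR g0 by auto
  then have "l2_norm (\<lambda>t. (f t - h t) + (h t - g n t)) \<le> l2_norm (\<lambda>t. f t - h t) + l2_norm (\<lambda>t. h t - g n t)"
    by (intro l2_norm_triangle L2_diff f)
  then have "l2_norm (\<lambda>t. f t - g n t) < e"
    using n fh by simp
  then show ?thesis
    using that[of "g n" R "R + 1"] gcont gR g0 by blast
qed

text \<open>For a continuous function of bounded support this is dominated convergence; density and
  unitarity of the shifts carry it over to \<open>L\<^sup>2\<close>.\<close>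

lemma tf_shift_strongly_continuous:
  fixes f :: "real ^ 'd \<Rightarrow> complex"
  assumes f: "f \<in> L2" and Z: "Z \<longlonglongrightarrow> z"
  shows "(\<lambda>n. l2_norm (\<lambda>t. tf_shift (Z n) f t - tf_shift z f t)) \<longlonglongrightarrow> 0"
proof (rule LIMSEQ_I)
  fix e :: real assume e: "0 < e"
  then obtain g B R where gc: "continuous_on UNIV g" and gB: "\<And>t. cmod (g t) \<le> B"
    and g0: "\<And>t. R < norm t \<Longrightarrow> g t = 0" and fg: "l2_norm (\<lambda>t. f t - g t) < e / 3"
    using L2_dense_continuous_bounded_support[OF f, of "e / 3"] by auto
  have gm [measurable]: "g \<in> borel_measurable borel"
    using gc by (rule borel_measurable_continuous_onI)
  have g: "g \<in> L2" using L2_bounded_support[OF gm gB g0] .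
  have "bounded (range Z)" using Z by (rule convergent_imp_bounded)
  then obtain M where M: "\<And>n. norm (Z n) \<le> M" by (auto simp: bounded_iff)
  have zM: "norm z \<le> M" using M Z by (intro LIMSEQ_le_const2[OF tendsto_norm[OF Z]]) auto
  have "(\<lambda>n. l2_norm (\<lambda>t. tf_shift (Z n) g t - tf_shift z g t)) \<longlonglongrightarrow> 0"
  proof (rule l2_norm_tendsto_0_dominated[OF _ integrable_indicator_cball[of "(2 * B)\<^sup>2" "R + M"]])
    have "(\<lambda>n. tf_shift (Z n) g t - tf_shift z g t) \<longlonglongrightarrow> 0" for t
    proof -
      have "(\<lambda>n. g (t - fst (Z n))) \<longlonglongrightarrow> g (t - fst z)"
        by (intro continuous_on_tendsto_compose[OF gc] tendsto_intros Z)
           (auto intro: Z)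
      moreover have "(\<lambda>n. ephase (snd (Z n) \<bullet> t)) \<longlonglongrightarrow> ephase (snd z \<bullet> t)"
        by (intro tendsto_intros Z)
      ultimately have "(\<lambda>n. tf_shift (Z n) g t - tf_shift z g t) \<longlonglongrightarrow> tf_shift z g t - tf_shift z g t"
        unfolding tf_shift_eq by (intro tendsto_diff tendsto_mult tendsto_const)
      then show ?thesis by simp
    qed
    then show "AE t in lborel. (\<lambda>n. tf_shift (Z n) g t - tf_shift z g t) \<longlonglongrightarrow> 0" by simp
    have gz: "tf_shift w g t = 0" if "R + M < norm t" "norm w \<le> M" for w t
    proof -
      have "norm (fst w) \<le> norm w" by (metis norm_fst_le prod.collapse)
      then have "R < norm (t - fst w)"
        using that norm_triangle_ineq2[of t "fst w"] by simp
      then show ?thesis by (simp add: tf_shift_eq g0)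
    qed
    have "(cmod (tf_shift (Z n) g t - tf_shift z g t))\<^sup>2 \<le> (2 * B)\<^sup>2 * indicator (cball 0 (R + M)) t" for n t
    proof (cases "R + M < norm t")
      case True
      then show ?thesis using gz[OF True M] gz[OF True zM] by simp
    next
      case False
      have "cmod (tf_shift w g t) \<le> B" for w using gB by (simp add: tf_shift_eq norm_mult)
      from norm_triangle_ineq4[of "tf_shift (Z n) g t" "tf_shift z g t"] this[of "Z n"] this[of z]
      have "cmod (tf_shift (Z n) g t - tf_shift z g t) \<le> 2 * B" by simp
      from power_mono[OF this norm_ge_zero, of 2] show ?thesis using False by simp
    qed
    then show "AE t in lborel. (cmod (tf_shift (Z n) g t - tf_shift z g t))\<^sup>2
        \<le> (2 * B)\<^sup>2 * indicator (cball 0 (R + M)) t" for n by simp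
    show "(\<lambda>t. tf_shift (Z n) g t - tf_shift z g t) \<in> borel_measurable borel" for n
      using tf_shift_L2[OF g] by (intro borel_measurable_diff L2D)
  qed
  from LIMSEQ_D[OF this, of "e / 3"] e obtain N
    where N: "\<And>n. N \<le> n \<Longrightarrow> l2_norm (\<lambda>t. tf_shift (Z n) g t - tf_shift z g t) < e / 3"
    by auto
  show "\<exists>N. \<forall>n\<ge>N. norm (l2_norm (\<lambda>t. tf_shift (Z n) f t - tf_shift z f t) - 0) < e"
  proof (intro exI[of _ N] allI impI)
    fix n assume n: "N \<le> n"
    let ?d = "\<lambda>t. f t - g t"
    have d: "?d \<in> L2" using f g by (rule L2_diff)
    have "l2_norm (\<lambda>t. tf_shift (Z n) f t - tf_shift z f t) =
      l2_norm (\<lambda>t. tf_shift (Z n) ?d t + ((tf_shift (Z n) g t - tf_shift z g t) + (-1) * tf_shift z ?d t))"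
      by (simp add: tf_shift_diff algebra_simps)
    also have "\<dots> \<le> l2_norm (tf_shift (Z n) ?d) + l2_norm (\<lambda>t. (tf_shift (Z n) g t - tf_shift z g t) + (-1) * tf_shift z ?d t)"
      by (intro l2_norm_triangle L2_add L2_diff L2_scale tf_shift_L2 d g)
    also have "\<dots> \<le> l2_norm (tf_shift (Z n) ?d) + (l2_norm (\<lambda>t. tf_shift (Z n) g t - tf_shift z g t) + l2_norm (\<lambda>t. (-1) * tf_shift z ?d t))"
      by (intro add_left_mono l2_norm_triangle L2_add L2_diff L2_scale tf_shift_L2 d g)
    also have "\<dots> < e / 3 + (e / 3 + e / 3)"
      unfolding l2_norm_scale l2_norm_tf_shift using fg N[OF n] by simp
    finally show "norm (l2_norm (\<lambda>t. tf_shift (Z n) f t - tf_shift z f t) - 0) < e" by simp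
  qed
qed

lemma l2_inner_tendsto:
  assumes L2: "\<And>n. F n \<in> L2" "\<And>n. G n \<in> L2" "f \<in> L2" "g \<in> L2"
    and F: "(\<lambda>n. l2_norm (\<lambda>t. F n t - f t)) \<longlonglongrightarrow> 0"
    and G: "(\<lambda>n. l2_norm (\<lambda>t. G n t - g t)) \<longlonglongrightarrow> 0"
  shows "(\<lambda>n. l2_inner (F n) (G n)) \<longlonglongrightarrow> l2_inner f g"
proof -
  have "(\<lambda>n. l2_inner (F n) (G n) - l2_inner f g) \<longlonglongrightarrow> 0"
  proof (rule Lim_null_comparison)
    have "l2_inner (F n) (G n) - l2_inner f g =
        l2_inner (\<lambda>t. F n t - f t) (\<lambda>t. G n t - g t) + l2_inner f (\<lambda>t. G n t - g t)
        + l2_inner (\<lambda>t. F n t - f t) g" for n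
      using L2 by (simp add: l2_inner_diff_left l2_inner_diff_right L2_diff)
    then show "\<forall>\<^sub>F n in sequentially. cmod (l2_inner (F n) (G n) - l2_inner f g) \<le>
        l2_norm (\<lambda>t. F n t - f t) * l2_norm (\<lambda>t. G n t - g t) + l2_norm f * l2_norm (\<lambda>t. G n t - g t)
        + l2_norm (\<lambda>t. F n t - f t) * l2_norm g"
      using L2 by (auto intro!: always_eventually order_trans[OF norm_triangle_ineq] add_mono
          l2_cauchy_schwarz L2_diff)
    have "(\<lambda>n. l2_norm (\<lambda>t. F n t - f t) * l2_norm (\<lambda>t. G n t - g t) + l2_norm f * l2_norm (\<lambda>t. G n t - g t)
        + l2_norm (\<lambda>t. F n t - f t) * l2_norm g) \<longlonglongrightarrow> 0 * 0 + l2_norm f * 0 + 0 * l2_norm g"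
      by (intro tendsto_intros F G)
    then show "(\<lambda>n. l2_norm (\<lambda>t. F n t - f t) * l2_norm (\<lambda>t. G n t - g t) + l2_norm f * l2_norm (\<lambda>t. G n t - g t)
        + l2_norm (\<lambda>t. F n t - f t) * l2_norm g) \<longlonglongrightarrow> 0" by simp
  qed
  then show ?thesis by (rule LIM_zero_cancel)
qed

lemma continuous_on_l2_inner_tf_shift:
  assumes "f \<in> L2" "g \<in> L2"
  shows "continuous_on UNIV (\<lambda>z. l2_inner f (tf_shift z g))"
proof -
  have "(\<lambda>n. l2_inner f (tf_shift (Z n) g)) \<longlonglongrightarrow> l2_inner f (tf_shift z g)" if "Z \<longlonglongrightarrow> z" for Z z
    using assms tf_shift_strongly_continuous[OF assms(2) that]
    by (intro l2_inner_tendsto) (auto intro: tf_shift_L2 simp: l2_norm_def)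
  then show ?thesis
    by (auto simp: continuous_on_sequentially comp_def)
qed

lemma measurable_l2_inner_tf_shift [measurable]:
  assumes "f \<in> L2" "g \<in> L2"
  shows "(\<lambda>z. l2_inner f (tf_shift z g)) \<in> borel_measurable borel"
  using continuous_on_l2_inner_tf_shift[OF assms] by (rule borel_measurable_continuous_onI)

section \<open>Gaussian integrals\<close>

lemma product_sigma_finite_lborel: "product_sigma_finite (\<lambda>_::'a. lborel :: real measure)"
  unfolding product_sigma_finite_def by (simp add: lborel.sigma_finite_measure_axioms)

lemma inner_sum_Basis: "b \<in> Basis \<Longrightarrow> (\<Sum>c\<in>Basis. f c *\<^sub>R c) \<bullet> b = f b"
  by (simp add: inner_sum_left inner_Basis if_distrib sum.delta cong: if_cong)

lemma
  fixes f :: "'a::euclidean_space \<Rightarrow> real \<Rightarrow> 'b::{real_normed_field, banach, second_countable_topology}"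
  assumes int: "\<And>b. b \<in> Basis \<Longrightarrow> integrable lborel (f b)"
  shows integral_lborel_prod:
      "(LINT x|lborel. (\<Prod>b\<in>Basis. f b (x \<bullet> b))) = (\<Prod>b\<in>Basis. LINT x|lborel. f b x)"
    and integrable_lborel_prod:
      "integrable lborel (\<lambda>x. \<Prod>b\<in>Basis. f b (x \<bullet> b))"
proof -
  interpret product_sigma_finite "\<lambda>_::'a. lborel :: real measure"
    by (rule product_sigma_finite_lborel)
  have [measurable]: "f b \<in> borel_measurable borel" if "b \<in> Basis" for b
    using borel_measurable_integrable[OF int[OF that]] by simp
  have eq: "(\<Prod>b\<in>Basis. f b ((\<Sum>b\<in>Basis. y b *\<^sub>R b) \<bullet> b)) = (\<Prod>b\<in>Basis. f b (y b))" for y :: "'a \<Rightarrow> real"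
    by (intro prod.cong refl) (simp add: inner_sum_Basis)
  have m: "(\<lambda>x. \<Prod>b\<in>Basis. f b (x \<bullet> b)) \<in> borel_measurable borel"
    by measurable
  have d: "(\<lambda>y. \<Sum>b\<in>Basis. y b *\<^sub>R b) \<in> (\<Pi>\<^sub>M b\<in>(Basis::'a set). lborel) \<rightarrow>\<^sub>M borel"
    by measurable
  show "(LINT x|lborel. (\<Prod>b\<in>Basis. f b (x \<bullet> b))) = (\<Prod>b\<in>Basis. LINT x|lborel. f b x)"
    unfolding lborel_eq[where 'a='a]
    by (subst integral_distr[OF d m]) (simp add: eq product_integral_prod int)
  show "integrable lborel (\<lambda>x. \<Prod>b\<in>Basis. f b (x \<bullet> b))"
    unfolding lborel_eq[where 'a='a]
    by (subst integrable_distr_eq[OF d m]) (simp add: eq product_integrable_prod int)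
qed

text \<open>The characteristic function of the standard normal distribution, rescaled to the variance and
  frequency normalisation used here.\<close>

lemma gaussian_fourier_real:
  fixes a w :: real
  assumes a: "0 < a"
  shows "integrable lborel (\<lambda>t. complex_of_real (exp (- (pi * a * t\<^sup>2))) * ephase (- (w * t)))"
    and "(LINT t|lborel. complex_of_real (exp (- (pi * a * t\<^sup>2))) * ephase (- (w * t)))
      = complex_of_real (1 / sqrt a * exp (- (pi * w\<^sup>2 / a)))"
proof -
  define c where "c = sqrt (2 * pi * a)"
  have c: "0 < c" "c\<^sup>2 = 2 * pi * a" using a by (simp_all add: c_def)
  define s where "s = - (2 * pi * w / c)"
  let ?f = "\<lambda>x. std_normal_density x *\<^sub>R iexp (s * x)"
  let ?g = "\<lambda>t. complex_of_real (exp (- (pi * a * t\<^sup>2))) * ephase (- (w * t))"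
  have fint: "integrable lborel ?f"
  proof (rule Bochner_Integration.integrable_bound)
    show "integrable lborel std_normal_density" using integrable_std_normal_moment[of 0] by simp
  qed (auto simp: std_normal_density_def)
  have f: "(LINT x|lborel. ?f x) = complex_of_real (exp (- (s\<^sup>2) / 2))"
    using fun_cong[OF char_std_normal_distribution, of s]
    by (simp add: char_def integral_density)
  have *: "?f (0 + c * t) = complex_of_real (1 / sqrt (2 * pi)) * ?g t" for t
  proof -
    have "(c * t)\<^sup>2 / 2 = pi * a * t\<^sup>2" using c by (simp add: power_mult_distrib)
    moreover have "iexp (s * (c * t)) = ephase (- (w * t))"
      using c(1) by (simp add: s_def ephase_def mult_ac)
    ultimately show ?thesis by (simp add: std_normal_density_def scaleR_conv_of_real mult_ac)
  qed
  have "integrable lborel (\<lambda>t. ?f (0 + c * t))"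
    using lborel_integrable_real_affine[OF fint, of c 0] c(1) by simp
  moreover have cancel: "complex_of_real (sqrt (2 * pi)) * (complex_of_real (1 / sqrt (2 * pi)) * v) = v" for v
    by simp
  ultimately show int: "integrable lborel ?g"
    unfolding * using integrable_mult_right[of "complex_of_real (sqrt (2 * pi))" lborel
        "\<lambda>t. complex_of_real (1 / sqrt (2 * pi)) * ?g t"] by (simp only: cancel)
  have s2: "s\<^sup>2 / 2 = pi * w\<^sup>2 / a"
    using a c by (simp add: s_def power_divide power_mult_distrib power2_eq_square[of pi])
  have "complex_of_real (exp (- (s\<^sup>2) / 2)) = \<bar>c\<bar> *\<^sub>R (LINT t|lborel. ?f (0 + c * t))"
    unfolding f[symmetric] using c(1) by (intro lborel_integral_real_affine) simp
  also have "\<dots> = complex_of_real (c / sqrt (2 * pi)) * (LINT t|lborel. ?g t)"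
    unfolding * using c(1) by (simp add: scaleR_conv_of_real)
  also have "c / sqrt (2 * pi) = sqrt a"
    by (simp add: c_def real_sqrt_mult)
  finally have "complex_of_real (exp (- (pi * w\<^sup>2 / a))) = complex_of_real (sqrt a) * (LINT t|lborel. ?g t)"
    using s2 by simp
  then show "(LINT t|lborel. ?g t) = complex_of_real (1 / sqrt a * exp (- (pi * w\<^sup>2 / a)))"
    using a by (simp add: field_simps)
qed

lemma ephase_sum: "finite A \<Longrightarrow> ephase (\<Sum>i\<in>A. f i) = (\<Prod>i\<in>A. ephase (f i))"
  by (induction A rule: finite_induct) (simp_all add: ephase_add)

lemma
  fixes w :: "'a::euclidean_space"
  assumes a: "0 < a"
  shows gaussian_fourier_integrable:
      "integrable lborel (\<lambda>t. complex_of_real (exp (- (pi * a * (t \<bullet> t)))) * ephase (- (w \<bullet> t)))"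
    and gaussian_fourier:
      "(LINT t|lborel. complex_of_real (exp (- (pi * a * (t \<bullet> t)))) * ephase (- (w \<bullet> t)))
        = complex_of_real ((1 / sqrt a) ^ DIM('a) * exp (- (pi * (w \<bullet> w) / a)))"
proof -
  let ?g = "\<lambda>b::'a. \<lambda>t. complex_of_real (exp (- (pi * a * t\<^sup>2))) * ephase (- ((w \<bullet> b) * t))"
  have eq: "complex_of_real (exp (- (pi * a * (t \<bullet> t)))) * ephase (- (w \<bullet> t))
      = (\<Prod>b\<in>Basis. ?g b (t \<bullet> b))" for t
  proof -
    have "- (pi * a * (t \<bullet> t)) = (\<Sum>b\<in>Basis. - (pi * a * (t \<bullet> b)\<^sup>2))"
      by (subst euclidean_inner) (simp add: sum_distrib_left sum_negf power2_eq_square)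
    moreover have "- (w \<bullet> t) = (\<Sum>b\<in>Basis. - ((w \<bullet> b) * (t \<bullet> b)))"
      by (subst euclidean_inner) (simp add: sum_negf)
    ultimately show ?thesis
      by (simp add: exp_sum ephase_sum prod.distrib)
  qed
  show "integrable lborel (\<lambda>t. complex_of_real (exp (- (pi * a * (t \<bullet> t)))) * ephase (- (w \<bullet> t)))"
    unfolding eq by (intro integrable_lborel_prod gaussian_fourier_real a)
  have "exp (- (pi * (w \<bullet> w) / a)) = (\<Prod>b\<in>Basis. exp (- (pi * (w \<bullet> b)\<^sup>2 / a)))"
    by (subst euclidean_inner, subst exp_sum[symmetric])
       (simp_all add: sum_negf sum_distrib_left sum_divide_distrib power2_eq_square)
  then show "(LINT t|lborel. complex_of_real (exp (- (pi * a * (t \<bullet> t)))) * ephase (- (w \<bullet> t)))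
        = complex_of_real ((1 / sqrt a) ^ DIM('a) * exp (- (pi * (w \<bullet> w) / a)))"
    unfolding eq
    by (subst integral_lborel_prod) (simp_all add: gaussian_fourier_real a prod.distrib prod_dividef power_divide)
qed

lemma integrable_gaussian:
  "0 < a \<Longrightarrow> integrable lborel (\<lambda>t::'a::euclidean_space. exp (- (pi * a * (t \<bullet> t))))"
  using integrable_norm[OF gaussian_fourier_integrable[of a "0::'a"]] by (simp add: norm_mult)

lemma integral_gaussian: "(LINT t|lborel. exp (- (pi * (t \<bullet> t)))) = (1::real)"
  using gaussian_fourier[of 1 "0::'a::euclidean_space"]
  by (simp add: integral_complex_of_real del: of_real_exp)

lemma gauss_L2: "gauss \<in> L2"
proof (rule L2I)
  show "gauss \<in> borel_measurable borel"
    unfolding gauss_def[abs_def] by measurable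
  have "(cmod (gauss t))\<^sup>2 = (2 powr (- real CARD('a) / 4))\<^sup>2 * exp (- (pi * 2 * (t \<bullet> t)))" for t :: "real ^ 'a"
    by (simp add: gauss_def norm_mult power_mult_distrib exp_double[symmetric] del: of_real_exp)
  then show "integrable lborel (\<lambda>t::real ^ 'a. (cmod (gauss t))\<^sup>2)"
    using integrable_gaussian[of 2, where 'a="real ^ 'a"] by simp
qed

lemma parallelogram_law:
  fixes t y :: "'a::real_inner"
  shows "(t + y) \<bullet> (t + y) + (t - y) \<bullet> (t - y) = 2 * (t \<bullet> t) + 2 * (y \<bullet> y)"
  by (simp add: inner_add_left inner_add_right inner_diff_left inner_diff_right inner_commute)

lemma inner_double:
  fixes y :: "'a::real_inner"
  shows "(y + y) \<bullet> (y + y) = 4 * (y \<bullet> y)"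
  by (simp add: inner_add_left inner_add_right)

text \<open>Completing the square around the midpoint of the two Gaussians leaves a Gaussian in the
  translation times the Fourier transform of a Gaussian.\<close>

lemma cmod_inner_gauss_tf_shift:
  obtains c where "0 < c"
    "\<And>z :: (real ^ 'd) \<times> (real ^ 'd). cmod (l2_inner gauss (tf_shift z gauss)) = c * exp (- (pi / 2 * (z \<bullet> z)))"
proof -
  define k :: real where "k = 2 powr (- real CARD('d) / 4)"
  have k: "0 < k" by (simp add: k_def)
  have "cmod (l2_inner gauss (tf_shift z gauss)) =
      k\<^sup>2 * (1 / sqrt 2) ^ DIM(real ^ 'd) * exp (- (pi / 2 * (z \<bullet> z)))" for z :: "(real ^ 'd) \<times> (real ^ 'd)"
  proof -
    obtain x \<omega> where z: "z = (x, \<omega>)" by (cases z)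
    define y where "y = x /\<^sub>R 2"
    have x: "x = y + y" by (simp add: y_def flip: scaleR_2)
    let ?F = "\<lambda>t. gauss t * cnj (tf_shift z gauss t)"
    have "?F (t + y) = complex_of_real (k\<^sup>2 * exp (- (pi / 2 * (x \<bullet> x)))) * ephase (- (\<omega> \<bullet> x / 2)) *
        (complex_of_real (exp (- (pi * 2 * (t \<bullet> t)))) * ephase (- (\<omega> \<bullet> t)))" for t
    proof -
      have e1: "t + y - x = t - y"
        by (simp add: x)
      have e2: "- (pi * ((t + y) \<bullet> (t + y))) + - (pi * ((t - y) \<bullet> (t - y)))
         = - (pi / 2 * (x \<bullet> x)) + - (pi * 2 * (t \<bullet> t))"
        using parallelogram_law[of t y] inner_double[of y] unfolding x
        by (simp only: minus_add_distrib[symmetric] distrib_left[symmetric]) (simp add: field_simps)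
      have e3: "- (\<omega> \<bullet> (t + y)) = - (\<omega> \<bullet> x / 2) + - (\<omega> \<bullet> t)"
        by (simp only: x inner_add_right) simp
      have "?F (t + y) = complex_of_real (k\<^sup>2 * (exp (- (pi * ((t + y) \<bullet> (t + y))))
          * exp (- (pi * ((t - y) \<bullet> (t - y)))))) * ephase (- (\<omega> \<bullet> (t + y)))"
        by (simp add: z gauss_def tf_shift_eq e1 cnj_ephase k_def power2_eq_square del: of_real_exp)
      also have "\<dots> = complex_of_real (k\<^sup>2 * (exp (- (pi / 2 * (x \<bullet> x))) * exp (- (pi * 2 * (t \<bullet> t)))))
          * (ephase (- (\<omega> \<bullet> x / 2)) * ephase (- (\<omega> \<bullet> t)))"
        unfolding exp_add[symmetric] e2 ephase_add[symmetric] e3 ..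
      finally show ?thesis by (simp add: mult_ac)
    qed
    then have "(LINT t|lborel. ?F (t + y)) = complex_of_real (k\<^sup>2 * exp (- (pi / 2 * (x \<bullet> x)))) * ephase (- (\<omega> \<bullet> x / 2)) *
        complex_of_real ((1 / sqrt 2) ^ DIM(real ^ 'd) * exp (- (pi * (\<omega> \<bullet> \<omega>) / 2)))"
      using gaussian_fourier[of 2 \<omega>] by simp
    moreover have "(LINT t|lborel. ?F (t + y)) = l2_inner gauss (tf_shift z gauss)"
      unfolding l2_inner_def by (rule lborel_integral_translate)
    moreover have "exp (- (pi / 2 * (x \<bullet> x))) * exp (- (pi * (\<omega> \<bullet> \<omega>) / 2)) = exp (- (pi / 2 * (z \<bullet> z)))"
      by (simp add: z inner_prod_def exp_add[symmetric] distrib_left)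
    ultimately show ?thesis
      by (simp add: norm_mult norm_power norm_divide mult_ac abs_mult del: of_real_exp)
  qed
  moreover have "0 < k\<^sup>2 * (1 / sqrt 2) ^ DIM(real ^ 'd)" using k by simp
  ultimately show ?thesis using that by blast
qed

lemma l2_norm_gauss_pos: "0 < l2_norm (gauss :: real ^ 'd \<Rightarrow> complex)"
proof -
  obtain c where "0 < c" "\<And>z :: (real ^ 'd) \<times> (real ^ 'd). cmod (l2_inner gauss (tf_shift z gauss)) = c * exp (- (pi / 2 * (z \<bullet> z)))"
    using cmod_inner_gauss_tf_shift[where 'd='d] by blast
  from this(2)[of 0] this(1) have "cmod (l2_inner gauss (gauss :: real ^ 'd \<Rightarrow> complex)) > 0" by simp
  then show ?thesis
    by (simp add: l2_inner_self less_le del: of_real_power zero_less_norm_iff)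
qed

section \<open>The orthogonality relations of the short-time Fourier transform\<close>

lemma lborel_integral_affine:
  fixes F :: "'a::euclidean_space \<Rightarrow> 'b::{banach, second_countable_topology}"
  assumes [measurable]: "F \<in> borel_measurable borel" and c: "c \<noteq> 0"
  shows "(LINT y|lborel. F y) = \<bar>c\<bar> ^ DIM('a) *\<^sub>R (LINT y|lborel. F (t + c *\<^sub>R y))"
proof -
  have "(LINT y|lborel. F y) = (LINT y|density (distr lborel borel (\<lambda>x. t + c *\<^sub>R x)) (\<lambda>_. \<bar>c\<bar> ^ DIM('a)). F y)"
    using lborel_affine[OF c, of t] by simp
  also have "\<dots> = (LINT y|distr lborel borel (\<lambda>x. t + c *\<^sub>R x). \<bar>c\<bar> ^ DIM('a) *\<^sub>R F y)"
    by (subst integral_density) (simp_all add: ennreal_power)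
  also have "\<dots> = (LINT y|lborel. \<bar>c\<bar> ^ DIM('a) *\<^sub>R F (t + c *\<^sub>R y))"
    by (subst integral_distr) auto
  finally show ?thesis by simp
qed

lemma lborel_integral_reflect:
  fixes F :: "'a::euclidean_space \<Rightarrow> 'b::{banach, second_countable_topology}"
  assumes "F \<in> borel_measurable borel"
  shows "(LINT y|lborel. F (t - y)) = (LINT y|lborel. F y)"
  using lborel_integral_affine[OF assms, of "-1" t] by simp

lemma lborel_integrable_reflect:
  fixes F :: "'a::euclidean_space \<Rightarrow> 'b::{banach, second_countable_topology}"
  assumes F: "integrable lborel F"
  shows "integrable lborel (\<lambda>y. F (t - y))"
proof -
  have "lborel = distr lborel borel (\<lambda>x::'a. t - x)"
    using lborel_affine[of "-1" t] by (simp add: density_1)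
  then have "integrable (distr lborel borel (\<lambda>x::'a. t - x)) F"
    using F by simp
  then show ?thesis
    using borel_measurable_integrable[OF F] by (subst (asm) integrable_distr_eq) auto
qed

text \<open>Fubini's theorem is used below on nested products of Euclidean spaces, always for Lebesgue measure
  on the product space itself.\<close>

lemma integrable_lborel_pairI:
  fixes F :: "'a::euclidean_space \<Rightarrow> 'b::euclidean_space \<Rightarrow> complex"
  assumes "(\<lambda>(x, y). F x y) \<in> borel_measurable borel"
    and "\<And>x. integrable lborel (F x)"
    and "integrable lborel (\<lambda>x. LINT y|lborel. cmod (F x y))"
  shows "integrable lborel (\<lambda>(x, y). F x y)"
  using lborel_pair.Fubini_integrable[of "\<lambda>(x, y). F x y"] assms by (simp add: lborel_prod)

lemma integrable_lborel_swap:
  fixes F :: "'a::euclidean_space \<Rightarrow> 'b::euclidean_space \<Rightarrow> complex"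
  assumes "integrable lborel (\<lambda>(x, y). F x y)"
  shows "integrable lborel (\<lambda>(y, x). F x y)"
  using lborel_pair.integrable_product_swap[of "\<lambda>(x, y). F x y"] assms by (simp add: lborel_prod)

lemma
  fixes F :: "'a::euclidean_space \<Rightarrow> 'b::euclidean_space \<Rightarrow> complex"
  assumes "integrable lborel (\<lambda>(x, y). F x y)"
  shows lborel_integral_fst: "(LINT x|lborel. LINT y|lborel. F x y) = (LINT (x, y)|lborel. F x y)"
    and lborel_integral_snd: "(LINT y|lborel. LINT x|lborel. F x y) = (LINT (x, y)|lborel. F x y)"
    and lborel_integrable_fst: "integrable lborel (\<lambda>x. LINT y|lborel. F x y)"
    and lborel_integrable_snd: "integrable lborel (\<lambda>y. LINT x|lborel. F x y)"
  using lborel_pair.integral_fst[of F] lborel_pair.integral_snd[of F]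
    lborel_pair.integrable_fst[of F] lborel_pair.integrable_snd[of F] assms
  by (simp_all add: lborel_prod)

lemma integrable_lborel_product:
  fixes u :: "'a::euclidean_space \<Rightarrow> complex" and v :: "'b::euclidean_space \<Rightarrow> complex"
  assumes u: "integrable lborel u" and v: "integrable lborel v"
  shows "integrable lborel (\<lambda>(x, y). u x * v y)"
proof (rule integrable_lborel_pairI)
  have [measurable]: "u \<in> borel_measurable borel" "v \<in> borel_measurable borel"
    using u v by (auto dest: borel_measurable_integrable)
  show "(\<lambda>(x, y). u x * v y) \<in> borel_measurable borel"
    unfolding borel_prod[symmetric] by measurable
  show "integrable lborel (\<lambda>y. u x * v y)" for x using v by simp
  show "integrable lborel (\<lambda>x. LINT y|lborel. cmod (u x * v y))"
    using u by (simp add: norm_mult)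
qed

lemma integrable_lborel_convolution:
  fixes u v :: "'a::euclidean_space \<Rightarrow> complex"
  assumes u: "integrable lborel u" and v: "integrable lborel v"
  shows "integrable lborel (\<lambda>(s, y). u s * v (s - y))"
proof (rule integrable_lborel_pairI)
  have [measurable]: "u \<in> borel_measurable borel" "v \<in> borel_measurable borel"
    using u v by (auto dest: borel_measurable_integrable)
  show "(\<lambda>(s, y). u s * v (s - y)) \<in> borel_measurable borel"
    unfolding borel_prod[symmetric] by measurable
  show "integrable lborel (\<lambda>y. u s * v (s - y))" for s
    using lborel_integrable_reflect[OF v] by simp
  have "(LINT y|lborel. cmod (u s * v (s - y))) = cmod (u s) * (LINT y|lborel. cmod (v y))" for s
    using lborel_integral_reflect[of "\<lambda>y. cmod (v y)" s] by (simp add: norm_mult)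
  then show "integrable lborel (\<lambda>s. LINT y|lborel. cmod (u s * v (s - y)))"
    using u by simp
qed

text \<open>
  The Gaussian of total mass one that is the Fourier transform of \<open>\<omega> \<mapsto> exp (- \<pi> a \<bar>\<omega>\<bar>\<^sup>2)\<close>; it concentrates
  at the origin as \<open>a\<close> tends to zero.\<close>

definition heat :: "real \<Rightarrow> 'a::euclidean_space \<Rightarrow> real" where
  "heat a y = (1 / sqrt a) ^ DIM('a) * exp (- (pi * (y \<bullet> y) / a))"

lemma heat_nonneg [simp]: "0 < a \<Longrightarrow> 0 \<le> heat a y"
  by (simp add: heat_def)

lemma measurable_heat [measurable]: "heat a \<in> borel_measurable borel"
  unfolding heat_def[abs_def] by measurable

lemma integrable_heat: "0 < a \<Longrightarrow> integrable lborel (heat a :: 'a::euclidean_space \<Rightarrow> real)"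
  using integrable_gaussian[of "1 / a", where 'a='a] unfolding heat_def[abs_def]
  by (intro integrable_mult_right) simp

text \<open>
  The Gaussian weight makes the triple integral over \<open>\<omega>\<close>, \<open>s\<close> and \<open>t\<close> absolutely convergent for merely
  integrable \<open>u\<close> and \<open>v\<close>, so that the frequency integral may be evaluated first.  The right-hand side
  is written in the difference variable \<open>y = s - t\<close>.\<close>

lemma regularised_plancherel:
  fixes u v :: "'a::euclidean_space \<Rightarrow> complex"
  assumes u: "integrable lborel u" and v: "integrable lborel v" and a: "0 < a"
  shows "(LINT \<omega>|lborel. complex_of_real (exp (- (pi * a * (\<omega> \<bullet> \<omega>)))) *
      ((LINT s|lborel. u s * ephase (- (\<omega> \<bullet> s))) * (LINT t|lborel. v t * ephase (\<omega> \<bullet> t))))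
    = (LINT (s, y)|lborel. u s * v (s - y) * complex_of_real (heat a y))"
proof -
  let ?g = "\<lambda>\<omega>::'a. complex_of_real (exp (- (pi * a * (\<omega> \<bullet> \<omega>))))"
  let ?U = "\<lambda>\<omega>. LINT s|lborel. u s * ephase (- (\<omega> \<bullet> s))"
  let ?V = "\<lambda>\<omega>. LINT t|lborel. v t * ephase (\<omega> \<bullet> t)"
  let ?k = "\<lambda>\<omega> s y. (u s * v (s - y)) * ephase (- (y \<bullet> \<omega>))"
  let ?H = "\<lambda>\<omega>. \<lambda>(s, y). ?g \<omega> * (u s * v (s - y)) * ephase (- (y \<bullet> \<omega>))"
  have [measurable]: "u \<in> borel_measurable borel" "v \<in> borel_measurable borel"
    using u v by (auto dest: borel_measurable_integrable)
  have uv: "integrable lborel (\<lambda>(s, y). u s * v (s - y))"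
    by (rule integrable_lborel_convolution[OF u v])
  have "integrable lborel (\<lambda>(\<omega>::'a, p). ?g \<omega> * (case p of (s, y) \<Rightarrow> u s * v (s - y)))"
    using gaussian_fourier_integrable[OF a, of "0::'a"] by (intro integrable_lborel_product uv) simp
  then have H: "integrable lborel (\<lambda>(\<omega>, p). ?H \<omega> p)"
  proof (rule Bochner_Integration.integrable_bound)
    have "(\<lambda>(\<omega>, p). ?H \<omega> p) \<in> borel_measurable (borel \<Otimes>\<^sub>M (borel \<Otimes>\<^sub>M borel))"
      by measurable
    then show "(\<lambda>(\<omega>, p). ?H \<omega> p) \<in> borel_measurable lborel"
      by (simp add: borel_prod)
  qed (auto simp: norm_mult)
  have sH: "(LINT p|lborel. ?H \<omega> p) = ?g \<omega> *
      (?U \<omega> * ?V \<omega>)" for \<omega>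
  proof -
    have "integrable lborel (\<lambda>(s, y). ?k \<omega> s y)"
    proof (rule Bochner_Integration.integrable_bound[OF uv])
      have "(\<lambda>(s, y). ?k \<omega> s y) \<in> borel_measurable (borel \<Otimes>\<^sub>M borel)"
        by measurable
      then show "(\<lambda>(s, y). ?k \<omega> s y) \<in> borel_measurable lborel"
        by (simp add: borel_prod)
    qed (auto simp: norm_mult)
    then have "(LINT (s, y)|lborel. ?k \<omega> s y) =
        (LINT s|lborel. LINT y|lborel. ?k \<omega> s y)"
      by (rule lborel_integral_fst[symmetric])
    also have "\<dots> = (LINT s|lborel. (u s * ephase (- (\<omega> \<bullet> s))) * ?V \<omega>)"
    proof (rule Bochner_Integration.integral_cong[OF refl])
      fix s
      have m: "(\<lambda>y. v y * ephase (\<omega> \<bullet> y)) \<in> borel_measurable borel" by measurable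
      have "u s * v (s - y) * ephase (- (y \<bullet> \<omega>)) =
          (u s * ephase (- (\<omega> \<bullet> s))) * (v (s - y) * ephase (\<omega> \<bullet> (s - y)))" for y
      proof -
        have "ephase (- (y \<bullet> \<omega>)) = ephase (- (\<omega> \<bullet> s)) * ephase (\<omega> \<bullet> (s - y))"
          unfolding ephase_add[symmetric] by (simp add: inner_diff_right inner_commute)
        then show ?thesis by (simp add: mult_ac)
      qed
      then show "(LINT y|lborel. ?k \<omega> s y) =
          (u s * ephase (- (\<omega> \<bullet> s))) * ?V \<omega>"
        by (simp only: integral_mult_right_zero lborel_integral_reflect[of "\<lambda>y. v y * ephase (\<omega> \<bullet> y)" s] m)
    qed
    also have "\<dots> = ?U \<omega> * ?V \<omega>"
      by simp
    finally have *: "(LINT (s, y)|lborel. ?k \<omega> s y) =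
      ?U \<omega> * ?V \<omega>" .
    have "(LINT p|lborel. ?H \<omega> p) = (LINT p|lborel. ?g \<omega> * (case p of (s, y) \<Rightarrow> ?k \<omega> s y))"
      by (intro Bochner_Integration.integral_cong refl) (auto simp: mult_ac)
    then show ?thesis using * by simp
  qed
  have "(LINT \<omega>|lborel. ?H \<omega> (s, y)) = u s * v (s - y) * complex_of_real (heat a y)" for s y
  proof -
    have "(LINT \<omega>|lborel. ?H \<omega> (s, y)) = (LINT \<omega>|lborel. (u s * v (s - y)) * (?g \<omega> * ephase (- (y \<bullet> \<omega>))))"
      by (simp add: mult_ac)
    also have "\<dots> = (u s * v (s - y)) * (LINT \<omega>|lborel. ?g \<omega> * ephase (- (y \<bullet> \<omega>)))"
      by (rule integral_mult_right_zero)
    also have "(LINT \<omega>|lborel. ?g \<omega> * ephase (- (y \<bullet> \<omega>))) = complex_of_real (heat a y)"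
      unfolding heat_def by (rule gaussian_fourier[OF a])
    finally show ?thesis .
  qed
  then have "(LINT p|lborel. LINT \<omega>|lborel. ?H \<omega> p) = (LINT (s, y)|lborel. u s * v (s - y) * complex_of_real (heat a y))"
    by (intro Bochner_Integration.integral_cong refl) auto
  then show ?thesis
    using lborel_integral_fst[OF H] lborel_integral_snd[OF H] by (simp add: sH)
qed


lemma heat_scale:
  fixes u :: "'a::euclidean_space"
  assumes "0 < a"
  shows "sqrt a ^ DIM('a) * heat a (sqrt a *\<^sub>R u) = exp (- (pi * (u \<bullet> u)))"
  using assms by (simp add: heat_def power_divide power2_eq_square[symmetric] field_simps)

lemma measurable_snd_euclidean [measurable]:
  "(snd :: 'a::euclidean_space \<times> 'b::euclidean_space \<Rightarrow> 'b) \<in> borel_measurable borel"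
  by (intro borel_measurable_continuous_onI continuous_intros)

text \<open>Rescaling moves the parameter from the kernel into the argument of \<open>\<Psi>\<close>, where continuity at the
  origin applies.\<close>

lemma heat_approximates_identity:
  fixes \<Psi> :: "'a::euclidean_space \<Rightarrow> complex"
  assumes \<Psi>: "continuous_on UNIV \<Psi>" and bound: "\<And>y. cmod (\<Psi> y) \<le> C"
    and a: "a \<longlonglongrightarrow> 0" "\<And>n. 0 < a n"
  shows "(\<lambda>n. LINT y|lborel. complex_of_real (heat (a n) y) * \<Psi> y) \<longlonglongrightarrow> \<Psi> 0"
proof -
  let ?G = "\<lambda>y::'a. exp (- (pi * (y \<bullet> y)))"
  have [measurable]: "\<Psi> \<in> borel_measurable borel"
    using \<Psi> by (rule borel_measurable_continuous_onI)
  have scale: "(LINT y|lborel. complex_of_real (heat (a n) y) * \<Psi> y) =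
      (LINT u|lborel. complex_of_real (?G u) * \<Psi> (sqrt (a n) *\<^sub>R u))" for n
  proof -
    have an: "0 < sqrt (a n)" using a(2) by simp
    have "(LINT y|lborel. complex_of_real (heat (a n) y) * \<Psi> y) = \<bar>sqrt (a n)\<bar> ^ DIM('a) *\<^sub>R
        (LINT u|lborel. complex_of_real (heat (a n) (0 + sqrt (a n) *\<^sub>R u)) * \<Psi> (0 + sqrt (a n) *\<^sub>R u))"
      by (rule lborel_integral_affine) (use an in auto)
    also have "\<dots> = (LINT u|lborel. complex_of_real (?G u) * \<Psi> (sqrt (a n) *\<^sub>R u))"
    proof -
      have "sqrt (a n) ^ DIM('a) * heat (a n) (sqrt (a n) *\<^sub>R u) = ?G u" for u :: 'a
        by (rule heat_scale[OF a(2)])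
      then have "complex_of_real (sqrt (a n) ^ DIM('a)) * (complex_of_real (heat (a n) (sqrt (a n) *\<^sub>R u)) * w)
          = complex_of_real (?G u) * w" for u :: 'a and w
        by (metis mult.assoc of_real_mult)
      moreover have "\<bar>sqrt (a n)\<bar> ^ DIM('a) *\<^sub>R integral\<^sup>L lborel F =
          (LINT u|lborel. complex_of_real (sqrt (a n) ^ DIM('a)) * F u)" for F :: "'a \<Rightarrow> complex"
        using an by (simp add: scaleR_conv_of_real)
      ultimately show ?thesis by (simp only: add_0_left)
    qed
    finally show ?thesis .
  qed
  have "(\<lambda>n. LINT u|lborel. complex_of_real (?G u) * \<Psi> (sqrt (a n) *\<^sub>R u)) \<longlonglongrightarrow>
      (LINT u|lborel. complex_of_real (?G u) * \<Psi> 0)"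
  proof (rule integral_dominated_convergence[where w = "\<lambda>u. C * ?G u"])
    show "integrable lborel (\<lambda>u. C * ?G u)"
      using integrable_gaussian[of 1, where 'a='a] by simp
    show "AE u in lborel. (\<lambda>n. complex_of_real (?G u) * \<Psi> (sqrt (a n) *\<^sub>R u)) \<longlonglongrightarrow> complex_of_real (?G u) * \<Psi> 0"
    proof (rule AE_I2)
      fix u :: 'a
      have "(\<lambda>n. sqrt (a n) *\<^sub>R u) \<longlonglongrightarrow> sqrt 0 *\<^sub>R u"
        by (intro tendsto_scaleR tendsto_real_sqrt tendsto_const a)
      then have "(\<lambda>n. \<Psi> (sqrt (a n) *\<^sub>R u)) \<longlonglongrightarrow> \<Psi> 0"
        using continuous_on_tendsto_compose[OF \<Psi>, of "\<lambda>n. sqrt (a n) *\<^sub>R u" 0] by simp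
      then show "(\<lambda>n. complex_of_real (?G u) * \<Psi> (sqrt (a n) *\<^sub>R u)) \<longlonglongrightarrow> complex_of_real (?G u) * \<Psi> 0"
        by (rule tendsto_mult_left)
    qed
    show "AE u in lborel. norm (complex_of_real (?G u) * \<Psi> (sqrt (a n) *\<^sub>R u)) \<le> C * ?G u" for n
      using mult_right_mono[OF bound[of "sqrt (a n) *\<^sub>R _"], of "?G _"] by (auto simp: norm_mult mult_ac)
  qed measurable
  also have "(LINT u|lborel. complex_of_real (?G u) * \<Psi> 0) = (LINT u|lborel. complex_of_real (?G u)) * \<Psi> 0"
    by simp
  also have "(LINT u|lborel. complex_of_real (?G u)) = complex_of_real (LINT u|lborel. ?G u)"
    by (rule integral_complex_of_real)
  also have "\<dots> * \<Psi> 0 = \<Psi> 0"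
    by (subst integral_gaussian) simp
  finally show ?thesis unfolding scale .
qed

lemma stft_eq_fourier:
  "l2_inner f (tf_shift (x, \<omega>) \<gamma>) = (LINT s|lborel. (f s * cnj (\<gamma> (s - x))) * ephase (- (\<omega> \<bullet> s)))"
  by (simp add: l2_inner_def tf_shift_eq cnj_ephase mult_ac)

lemma l2_inner_translate:
  "l2_inner f (tf_shift (y, 0) h) = (LINT s|lborel. f s * cnj (h (s - y)))"
  by (simp add: l2_inner_def tf_shift_eq)

lemma L2_translate: "f \<in> L2 \<Longrightarrow> (\<lambda>s. f (s - x)) \<in> L2"
  using tf_shift_L2[of f "(x, 0)"] by (simp add: tf_shift_eq[abs_def])

lemma l2_norm_translate: "l2_norm (\<lambda>s. f (s - x)) = l2_norm f"
  using l2_norm_tf_shift[of "(x, 0)" f] by (simp add: tf_shift_eq[abs_def])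

text \<open>Justifies exchanging the position integral with the integrals from \<open>regularised_plancherel\<close>: integrating first over
  \<open>x\<close>, then over \<open>s\<close>, the Cauchy-Schwarz inequality bounds what is left by a multiple of the
  integrable kernel.\<close>

lemma moyal_kernel_integrable:
  fixes f h g \<gamma> :: "real ^ 'd \<Rightarrow> complex"
  assumes f: "f \<in> L2" and h: "h \<in> L2" and \<gamma>: "\<gamma> \<in> L2" and g: "g \<in> L2" and a: "0 < a"
  shows "integrable lborel (\<lambda>((s, y), x). (f s * cnj (\<gamma> (s - x))) * (cnj (h (s - y)) * g (s - y - x))
      * complex_of_real (heat a y))"
proof -
  have [measurable]: "f \<in> borel_measurable borel" "h \<in> borel_measurable borel"
      "\<gamma> \<in> borel_measurable borel" "g \<in> borel_measurable borel"
    using f h \<gamma> g by (auto dest: L2D)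
  have prod: "integrable lborel (\<lambda>s. p s * q (s - y))" if "p \<in> L2" "q \<in> L2" for p q :: "real ^ 'd \<Rightarrow> complex" and y
    using L2_mult_integrable[OF that(1) L2_translate[OF that(2), of y]] .
  let ?a = "\<lambda>y s. complex_of_real (heat a y) * (f s * h (s - y))"
  define A where "A = (\<lambda>(y, s). ?a y s)"
  have A: "integrable lborel A"
    unfolding A_def
  proof (rule integrable_lborel_pairI)
    have "(\<lambda>(y, s). ?a y s) \<in> borel_measurable (borel \<Otimes>\<^sub>M borel)"
      by measurable
    then show *: "(\<lambda>(y, s). ?a y s) \<in> borel_measurable borel"
      by (simp add: borel_prod)
    show "integrable lborel (\<lambda>s. ?a y s)" for y
      using prod[OF f h] by simp
    show "integrable lborel (\<lambda>y. LINT s|lborel. cmod (?a y s))"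
    proof (rule Bochner_Integration.integrable_bound)
      show "integrable lborel (\<lambda>y. heat a y * (l2_norm f * l2_norm h))"
        by (intro integrable_mult_left integrable_heat a)
      have "(\<lambda>(y, s). cmod (?a y s)) \<in> borel_measurable (borel \<Otimes>\<^sub>M lborel)"
        by measurable
      then have "(\<lambda>y. LINT s|lborel. cmod (?a y s)) \<in> borel_measurable borel"
        by measurable
      then show "(\<lambda>y. LINT s|lborel. cmod (?a y s)) \<in> borel_measurable lborel"
        by simp
      have "(LINT s|lborel. cmod (?a y s)) \<le> heat a y * (l2_norm f * l2_norm h)" for y
      proof -
        have "(LINT s|lborel. cmod (?a y s)) = heat a y * (LINT s|lborel. cmod (f s) * cmod (h (s - y)))"
          using a by (simp add: norm_mult)
        also have "\<dots> \<le> heat a y * (l2_norm f * l2_norm h)"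
          using l2_cauchy_schwarz_abs[OF f L2_translate[OF h, of y]] a
          by (intro mult_left_mono) (simp_all add: l2_norm_translate)
        finally show ?thesis .
      qed
      then show "AE y in lborel. norm (LINT s|lborel. cmod (?a y s))
          \<le> norm (heat a y * (l2_norm f * l2_norm h))"
        using a by (intro AE_I2) (simp add: integral_nonneg_AE)
    qed
  qed
  define B where "B = (\<lambda>p. case p of (s, y) \<Rightarrow> f s * (cnj (h (s - y)) * complex_of_real (heat a y)))"
  have "integrable lborel (\<lambda>(s, y). A (y, s))"
    using integrable_lborel_swap[of "\<lambda>y s. A (y, s)"] A by (simp only: case_prod_eta)
  then have B: "integrable lborel B"
  proof (rule Bochner_Integration.integrable_bound)
    have "B \<in> borel_measurable (borel \<Otimes>\<^sub>M borel)"
      unfolding B_def by measurable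
    then show "B \<in> borel_measurable lborel" by (simp add: borel_prod)
  qed (auto simp: A_def B_def norm_mult)
  let ?Q = "\<lambda>p x. B p * (cnj (\<gamma> (fst p - x)) * g (fst p - snd p - x))"
  have "integrable lborel (\<lambda>(p, x). ?Q p x)"
  proof (rule integrable_lborel_pairI)
    have [measurable]: "B \<in> borel_measurable (borel \<Otimes>\<^sub>M borel)"
      unfolding B_def by measurable
    have Qeq: "(\<lambda>(p, x). ?Q p x) = (\<lambda>q. B (fst q) * (cnj (\<gamma> (fst (fst q) - snd q)) *
        g (fst (fst q) - snd (fst q) - snd q)))"
      by (auto simp: fun_eq_iff)
    have Qneq: "(\<lambda>(p, x). cmod (?Q p x)) = (\<lambda>q. cmod (B (fst q) * (cnj (\<gamma> (fst (fst q) - snd q)) *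
        g (fst (fst q) - snd (fst q) - snd q))))"
      by (auto simp: fun_eq_iff)
    have Qm': "(\<lambda>(p, x). ?Q p x) \<in> borel_measurable ((borel \<Otimes>\<^sub>M borel) \<Otimes>\<^sub>M borel)"
      unfolding Qeq by measurable
    then show Qm: "(\<lambda>(p, x). ?Q p x) \<in> borel_measurable borel" by (simp add: borel_prod)
    have int: "integrable lborel (\<lambda>x. cnj (\<gamma> (s - x)) * g (t - x))"
      and le: "(LINT x|lborel. cmod (cnj (\<gamma> (s - x)) * g (t - x))) \<le> l2_norm \<gamma> * l2_norm g" for s t
    proof -
      let ?R = "\<lambda>r. cnj (\<gamma> r) * g (r - (s - t))"
      have R: "integrable lborel ?R" using prod[OF L2_cnj[OF \<gamma>] g] .
      show "integrable lborel (\<lambda>x. cnj (\<gamma> (s - x)) * g (t - x))"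
        using lborel_integrable_reflect[OF R, of s] by simp
      have "(LINT x|lborel. cmod (cnj (\<gamma> (s - x)) * g (t - x))) = (LINT r|lborel. cmod (?R r))"
        using lborel_integral_reflect[of "\<lambda>r. cmod (?R r)" s] by simp
      also have "\<dots> \<le> l2_norm \<gamma> * l2_norm g"
        using l2_cauchy_schwarz_abs[OF \<gamma> L2_translate[OF g, of "s - t"]]
        by (simp add: l2_norm_translate norm_mult)
      finally show "(LINT x|lborel. cmod (cnj (\<gamma> (s - x)) * g (t - x))) \<le> l2_norm \<gamma> * l2_norm g" .
    qed
    show "integrable lborel (?Q p)" for p using int by simp
    show "integrable lborel (\<lambda>p. LINT x|lborel. cmod (?Q p x))"
    proof (rule Bochner_Integration.integrable_bound)
      show "integrable lborel (\<lambda>p. cmod (B p) * (l2_norm \<gamma> * l2_norm g))"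
        using B by simp
      have "(\<lambda>(p, x). cmod (?Q p x)) \<in> borel_measurable ((borel \<Otimes>\<^sub>M borel) \<Otimes>\<^sub>M lborel)"
        unfolding Qneq by measurable
      then have "(\<lambda>p. LINT x|lborel. cmod (?Q p x)) \<in> borel_measurable (borel \<Otimes>\<^sub>M borel)"
        by measurable
      then show "(\<lambda>p. LINT x|lborel. cmod (?Q p x)) \<in> borel_measurable lborel"
        by (simp add: borel_prod)
      show "AE p in lborel. norm (LINT x|lborel. cmod (?Q p x)) \<le> norm (cmod (B p) * (l2_norm \<gamma> * l2_norm g))"
      proof (rule AE_I2)
        fix p
        have "(LINT x|lborel. cmod (?Q p x)) =
            cmod (B p) * (LINT x|lborel. cmod (cnj (\<gamma> (fst p - x)) * g (fst p - snd p - x)))"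
          by (simp only: norm_mult[of "B p"] integral_mult_right_zero)
        also have "\<dots> \<le> cmod (B p) * (l2_norm \<gamma> * l2_norm g)"
          by (intro mult_left_mono le) simp
        finally show "norm (LINT x|lborel. cmod (?Q p x)) \<le> norm (cmod (B p) * (l2_norm \<gamma> * l2_norm g))"
          by (simp add: integral_nonneg_AE)
      qed
    qed
  qed
  moreover have "(\<lambda>((s, y), x). (f s * cnj (\<gamma> (s - x))) * (cnj (h (s - y)) * g (s - y - x)) * complex_of_real (heat a y))
      = (\<lambda>(p, x). ?Q p x)"
    by (auto simp: B_def fun_eq_iff)
  ultimately show ?thesis by simp
qed


text \<open>
  For fixed \<open>x\<close>, both short-time Fourier transforms are Fourier transforms of integrable functions, to
  which \<open>regularised_plancherel\<close> applies.  For fixed \<open>y\<close>, the remaining integrals over \<open>s\<close> and \<open>x\<close>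
  separate after the substitution \<open>x \<mapsto> s - x\<close>.\<close>

lemma moyal_regularised:
  fixes f h g \<gamma> :: "real ^ 'd \<Rightarrow> complex"
  assumes f: "f \<in> L2" and h: "h \<in> L2" and \<gamma>: "\<gamma> \<in> L2" and g: "g \<in> L2" and a: "0 < a"
  defines "J x \<omega> \<equiv> complex_of_real (exp (- (pi * a * (\<omega> \<bullet> \<omega>)))) *
      (l2_inner f (tf_shift (x, \<omega>) \<gamma>) * l2_inner (tf_shift (x, \<omega>) g) h)"
  shows "integrable lborel (\<lambda>x. LINT \<omega>|lborel. J x \<omega>)"
    and "(LINT x|lborel. LINT \<omega>|lborel. J x \<omega>) = (LINT y|lborel. complex_of_real (heat a y) *
      (l2_inner f (tf_shift (y, 0) h) * l2_inner (tf_shift (y, 0) g) \<gamma>))"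
proof -
  let ?Q = "\<lambda>p x. case p of (s, y) \<Rightarrow> (f s * cnj (\<gamma> (s - x))) * (cnj (h (s - y)) * g (s - y - x))
      * complex_of_real (heat a y)"
  have Q: "integrable lborel (\<lambda>(p, x). ?Q p x)"
    using moyal_kernel_integrable[OF f h \<gamma> g a] by (simp add: split_def)
  have J: "(LINT \<omega>|lborel. J x \<omega>) = (LINT p|lborel. ?Q p x)" for x
  proof -
    have V: "l2_inner f (tf_shift (x, \<omega>) \<gamma>) * l2_inner (tf_shift (x, \<omega>) g) h =
        (LINT s|lborel. (f s * cnj (\<gamma> (s - x))) * ephase (- (\<omega> \<bullet> s))) *
        (LINT t|lborel. (cnj (h t) * g (t - x)) * ephase (\<omega> \<bullet> t))" for \<omega>
      unfolding stft_eq_fourier by (simp add: l2_inner_def tf_shift_eq mult_ac)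
    have "(LINT \<omega>|lborel. J x \<omega>) =
        (LINT (s, y)|lborel. (f s * cnj (\<gamma> (s - x))) * (cnj (h (s - y)) * g (s - y - x)) * complex_of_real (heat a y))"
      unfolding J_def V
      by (rule regularised_plancherel[OF _ _ a, of "\<lambda>s. f s * cnj (\<gamma> (s - x))" "\<lambda>t. cnj (h t) * g (t - x)"])
         (intro L2_mult_integrable L2_cnj L2_translate f h \<gamma> g)+
    then show ?thesis .
  qed
  show "integrable lborel (\<lambda>x. LINT \<omega>|lborel. J x \<omega>)"
    unfolding J by (rule lborel_integrable_snd[OF Q])
  let ?R = "\<lambda>s y. f s * cnj (h (s - y)) * complex_of_real (heat a y) * l2_inner (tf_shift (y, 0) g) \<gamma>"
  have R: "(LINT x|lborel. ?Q p x) = (case p of (s, y) \<Rightarrow> ?R s y)" for p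
  proof (cases p)
    case (Pair s y)
    let ?r = "\<lambda>r. g (r - y) * cnj (\<gamma> r)"
    have "(LINT x|lborel. ?Q p x) = (LINT x|lborel. (f s * cnj (h (s - y)) * complex_of_real (heat a y)) * ?r (s - x))"
      by (simp add: Pair mult_ac diff_diff_eq add.commute)
    also have "\<dots> = (f s * cnj (h (s - y)) * complex_of_real (heat a y)) * (LINT r|lborel. ?r r)"
      unfolding integral_mult_right_zero
      by (subst lborel_integral_reflect[of ?r]) (use L2D[OF g] L2D[OF \<gamma>] in measurable)
    finally show ?thesis by (simp add: Pair l2_inner_def tf_shift_eq)
  qed
  have Rint: "integrable lborel (\<lambda>(s, y). ?R s y)"
    using lborel_integrable_fst[OF Q] unfolding R .
  have "(LINT x|lborel. LINT \<omega>|lborel. J x \<omega>) = (LINT p|lborel. LINT x|lborel. ?Q p x)"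
    unfolding J using lborel_integral_fst[OF Q] lborel_integral_snd[OF Q] by simp
  also have "\<dots> = (LINT (s, y)|lborel. ?R s y)"
    unfolding R ..
  also have "\<dots> = (LINT y|lborel. LINT s|lborel. ?R s y)"
    by (rule lborel_integral_snd[OF Rint, symmetric])
  also have "\<dots> = (LINT y|lborel. complex_of_real (heat a y) *
      (l2_inner f (tf_shift (y, 0) h) * l2_inner (tf_shift (y, 0) g) \<gamma>))"
  proof (rule Bochner_Integration.integral_cong[OF refl])
    fix y
    have "(LINT s|lborel. ?R s y) = (LINT s|lborel. (complex_of_real (heat a y) * l2_inner (tf_shift (y, 0) g) \<gamma>)
        * (f s * cnj (h (s - y))))"
      by (simp only: mult_ac)
    also have "\<dots> = (complex_of_real (heat a y) * l2_inner (tf_shift (y, 0) g) \<gamma>) * l2_inner f (tf_shift (y, 0) h)"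
      unfolding l2_inner_translate by (rule integral_mult_right_zero)
    finally show "(LINT s|lborel. ?R s y) = complex_of_real (heat a y) *
        (l2_inner f (tf_shift (y, 0) h) * l2_inner (tf_shift (y, 0) g) \<gamma>)"
      by (simp only: mult_ac)
  qed
  finally show "(LINT x|lborel. LINT \<omega>|lborel. J x \<omega>) = (LINT y|lborel. complex_of_real (heat a y) *
      (l2_inner f (tf_shift (y, 0) h) * l2_inner (tf_shift (y, 0) g) \<gamma>))" .
qed

lemma integral_heat:
  assumes "0 < a"
  shows "(LINT y|lborel. heat a (y :: 'a::euclidean_space)) = 1"
proof -
  have "(LINT y|lborel. heat a (y :: 'a)) =
      \<bar>sqrt a\<bar> ^ DIM('a) *\<^sub>R (LINT u|lborel. heat a (0 + sqrt a *\<^sub>R u :: 'a))"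
    using assms by (intro lborel_integral_affine) auto
  also have "\<dots> = (LINT u|lborel. sqrt a ^ DIM('a) * heat a (sqrt a *\<^sub>R u :: 'a))"
    using assms by simp
  also have "\<dots> = 1"
    unfolding heat_scale[OF assms] by (rule integral_gaussian)
  finally show ?thesis .
qed

text \<open>The regularised integrals are bounded uniformly in the damping, and Fatou's lemma lets the damping
  tend to zero.\<close>

lemma integrable_square_stft:
  fixes f \<gamma> :: "real ^ 'd \<Rightarrow> complex"
  assumes f: "f \<in> L2" and \<gamma>: "\<gamma> \<in> L2"
  shows "integrable lborel (\<lambda>z. (cmod (l2_inner f (tf_shift z \<gamma>)))\<^sup>2)"
proof -
  let ?V = "\<lambda>z. l2_inner f (tf_shift z \<gamma>)"
  have Vm [measurable]: "?V \<in> borel_measurable borel"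
    by (rule measurable_l2_inner_tf_shift[OF f \<gamma>])
  let ?M = "(l2_norm f)\<^sup>2 * (l2_norm \<gamma>)\<^sup>2"
  define a where "a n = 1 / real (Suc n)" for n
  have a: "0 < a n" for n by (simp add: a_def)
  have alim: "a \<longlonglongrightarrow> 0" unfolding a_def by (rule LIMSEQ_Suc[OF lim_1_over_n])
  define E where "E n z = ennreal (exp (- (pi * a n * (snd z \<bullet> snd z))) * (cmod (?V z))\<^sup>2)"
    for n and z :: "(real ^ 'd) \<times> (real ^ 'd)"
  have [measurable]: "E n \<in> borel_measurable borel" for n
    unfolding E_def by measurable
  have bound: "(\<integral>\<^sup>+z. E n z \<partial>lborel) \<le> ennreal ?M" for n
  proof -
    let ?J = "\<lambda>x \<omega>. complex_of_real (exp (- (pi * a n * (\<omega> \<bullet> \<omega>)))) *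
      (l2_inner f (tf_shift (x, \<omega>) \<gamma>) * l2_inner (tf_shift (x, \<omega>) \<gamma>) f)"
    have J: "?J x \<omega> = complex_of_real (exp (- (pi * a n * (\<omega> \<bullet> \<omega>))) * (cmod (?V (x, \<omega>)))\<^sup>2)" for x \<omega>
      unfolding l2_inner_cnj[of f "tf_shift (x, \<omega>) \<gamma>", symmetric] complex_norm_square[symmetric]
      by simp
    let ?j = "\<lambda>x \<omega>. exp (- (pi * a n * (\<omega> \<bullet> \<omega>))) * (cmod (?V (x, \<omega>)))\<^sup>2"
    have VM: "(cmod (?V z))\<^sup>2 \<le> ?M" for z
      using power_mono[OF l2_cauchy_schwarz[OF f tf_shift_L2[OF \<gamma>, of z]] norm_ge_zero, of 2]
      by (simp add: l2_norm_tf_shift power_mult_distrib)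
    have jint: "integrable lborel (?j x)" for x
    proof (rule Bochner_Integration.integrable_bound)
      show "integrable lborel (\<lambda>\<omega>::real ^ 'd. exp (- (pi * a n * (\<omega> \<bullet> \<omega>))) * ?M)"
        by (intro integrable_mult_left integrable_gaussian a)
      show "AE \<omega> in lborel. norm (?j x \<omega>) \<le> norm (exp (- (pi * a n * (\<omega> \<bullet> \<omega>))) * ?M)"
        using VM by (intro AE_I2) (simp add: abs_mult)
    qed measurable
    note R = moyal_regularised[OF f f \<gamma> \<gamma> a[of n], unfolded J integral_complex_of_real]
    have int: "integrable lborel (\<lambda>x. LINT \<omega>|lborel. ?j x \<omega>)"
      using R(1) by (simp only: complex_of_real_integrable_eq)
    have "(LINT x|lborel. LINT \<omega>|lborel. ?j x \<omega>) = cmod (complex_of_real (LINT x|lborel. LINT \<omega>|lborel. ?j x \<omega>))"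
      by (simp add: integral_nonneg_AE)
    also have "\<dots> \<le> (LINT y|lborel. cmod (complex_of_real (heat (a n) y) *
        (l2_inner f (tf_shift (y, 0) f) * l2_inner (tf_shift (y, 0) \<gamma>) \<gamma>)))"
      unfolding R(2) by (rule integral_norm_bound)
    also have "\<dots> \<le> (LINT y|lborel. heat (a n) (y :: real ^ 'd) * ?M)"
    proof (rule integral_mono')
      show "integrable lborel (\<lambda>y. heat (a n) (y :: real ^ 'd) * ?M)"
        by (intro integrable_mult_left integrable_heat a)
      fix y :: "real ^ 'd"
      have "cmod (l2_inner f (tf_shift (y, 0) f)) * cmod (l2_inner (tf_shift (y, 0) \<gamma>) \<gamma>) \<le>
          (l2_norm f * l2_norm f) * (l2_norm \<gamma> * l2_norm \<gamma>)"
        using l2_cauchy_schwarz[OF f tf_shift_L2[OF f]] l2_cauchy_schwarz[OF tf_shift_L2[OF \<gamma>] \<gamma>]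
        by (intro mult_mono) (auto simp: l2_norm_tf_shift)
      then show "cmod (complex_of_real (heat (a n) y) * (l2_inner f (tf_shift (y, 0) f) * l2_inner (tf_shift (y, 0) \<gamma>) \<gamma>))
          \<le> heat (a n) y * ?M"
        using a[of n] by (simp add: norm_mult power2_eq_square mult_left_mono)
    qed (use a[of n] in simp)
    also have "\<dots> = ?M" using integral_heat[OF a[of n], where 'a="real ^ 'd"] by simp
    finally have le: "(LINT x|lborel. LINT \<omega>|lborel. ?j x \<omega>) \<le> ?M" .
    have "(\<integral>\<^sup>+z. E n z \<partial>lborel) = (\<integral>\<^sup>+x. \<integral>\<^sup>+\<omega>. E n (x, \<omega>) \<partial>lborel \<partial>lborel)"
      by (subst lborel.nn_integral_fst) (simp_all add: lborel_prod)
    also have "\<dots> = (\<integral>\<^sup>+x. ennreal (LINT \<omega>|lborel. ?j x \<omega>) \<partial>lborel)"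
      by (intro nn_integral_cong) (simp add: E_def nn_integral_eq_integral jint)
    also have "\<dots> = ennreal (LINT x|lborel. LINT \<omega>|lborel. ?j x \<omega>)"
      by (intro nn_integral_eq_integral int AE_I2 integral_nonneg_AE) auto
    also have "\<dots> \<le> ennreal ?M" using le by (rule ennreal_leI)
    finally show ?thesis .
  qed
  have lim: "(\<lambda>n. E n z) \<longlonglongrightarrow> ennreal ((cmod (?V z))\<^sup>2)" for z
  proof -
    have "(\<lambda>n. exp (- (pi * a n * (snd z \<bullet> snd z))) * (cmod (?V z))\<^sup>2) \<longlonglongrightarrow> exp (- (pi * 0 * (snd z \<bullet> snd z))) * (cmod (?V z))\<^sup>2"
      by (intro tendsto_intros alim)
    then show ?thesis unfolding E_def by (intro tendsto_ennrealI) simp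
  qed
  have "(\<integral>\<^sup>+z. ennreal ((cmod (?V z))\<^sup>2) \<partial>lborel) = (\<integral>\<^sup>+z. liminf (\<lambda>n. E n z) \<partial>lborel)"
    using lim_imp_Liminf[OF _ lim] by (intro nn_integral_cong) simp
  also have "\<dots> \<le> liminf (\<lambda>n. \<integral>\<^sup>+z. E n z \<partial>lborel)"
    by (rule nn_integral_liminf) simp
  also have "\<dots> \<le> liminf (\<lambda>n. ennreal ?M)"
    by (intro Liminf_mono always_eventually allI bound)
  also have "\<dots> < \<infinity>" by (simp add: Liminf_const)
  finally show ?thesis by (intro integrableI_bounded) auto
qed

text \<open>Both sides of \<open>moyal_regularised\<close> converge as the damping disappears: the left one by dominated
  convergence, since a product of two square-integrable transforms is integrable, and the right one
  because the heat kernel is an approximate identity.\<close>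

theorem moyal:
  fixes f h g \<gamma> :: "real ^ 'd \<Rightarrow> complex"
  assumes f: "f \<in> L2" and h: "h \<in> L2" and \<gamma>: "\<gamma> \<in> L2" and g: "g \<in> L2"
  shows moyal_integrable: "integrable lborel (\<lambda>z. l2_inner f (tf_shift z \<gamma>) * l2_inner (tf_shift z g) h)"
    and moyal_identity: "(LINT z|lborel. l2_inner f (tf_shift z \<gamma>) * l2_inner (tf_shift z g) h)
      = l2_inner f h * l2_inner g \<gamma>"
proof -
  let ?W = "\<lambda>z. l2_inner f (tf_shift z \<gamma>) * l2_inner (tf_shift z g) h"
  have Vm: "(\<lambda>z. l2_inner u (tf_shift z v)) \<in> borel_measurable borel" if "u \<in> L2" "v \<in> L2" for u v :: "real ^ 'd \<Rightarrow> complex"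
    using that by (rule measurable_l2_inner_tf_shift)
  have gh: "l2_inner (tf_shift z g) h = cnj (l2_inner h (tf_shift z g))" for z
    by (simp add: l2_inner_cnj)
  have Wm [measurable]: "?W \<in> borel_measurable borel"
    unfolding gh using Vm[OF f \<gamma>] measurable_compose[OF Vm[OF h g] measurable_cnj] by measurable
  show W: "integrable lborel ?W"
    unfolding gh
    by (rule integrable_mult_of_square_integrable)
       (use Vm[OF f \<gamma>] measurable_compose[OF Vm[OF h g] measurable_cnj]
          integrable_square_stft[OF f \<gamma>] integrable_square_stft[OF h g] in auto)
  define a where "a n = 1 / real (Suc n)" for n
  have a: "0 < a n" for n by (simp add: a_def)
  have alim: "a \<longlonglongrightarrow> 0" unfolding a_def by (rule LIMSEQ_Suc[OF lim_1_over_n])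
  let ?J = "\<lambda>n z. complex_of_real (exp (- (pi * a n * (snd z \<bullet> snd z)))) * ?W z"
  have Jint: "integrable lborel (?J n)" for n
  proof (rule Bochner_Integration.integrable_bound[OF W])
    show "AE z in lborel. norm (?J n z) \<le> norm (?W z)"
      using a[of n] by (intro AE_I2) (simp add: norm_mult mult_left_le_one_le)
  qed measurable
  have eq: "(LINT z|lborel. ?J n z) = (LINT y|lborel. complex_of_real (heat (a n) y) *
      (l2_inner f (tf_shift (y, 0) h) * l2_inner (tf_shift (y, 0) g) \<gamma>))" for n
  proof -
    define K where "K = ?J n"
    have "integrable lborel (\<lambda>(x, \<omega>). K (x, \<omega>))"
      using Jint[of n] unfolding K_def[symmetric] case_prod_eta .
    from lborel_integral_fst[OF this]
    have "(LINT z|lborel. K z) = (LINT x|lborel. LINT \<omega>|lborel. K (x, \<omega>))"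
      by (simp only: case_prod_eta)
    then show ?thesis
      unfolding moyal_regularised(2)[OF f h \<gamma> g a[of n], symmetric] K_def by simp
  qed
  have "(\<lambda>n. LINT z|lborel. ?J n z) \<longlonglongrightarrow> (LINT z|lborel. ?W z)"
  proof (rule integral_dominated_convergence[where w = "\<lambda>z. cmod (?W z)"])
    show "AE z in lborel. (\<lambda>n. ?J n z) \<longlonglongrightarrow> ?W z"
    proof (rule AE_I2)
      fix z :: "(real ^ 'd) \<times> (real ^ 'd)"
      have "(\<lambda>n. complex_of_real (exp (- (pi * a n * (snd z \<bullet> snd z)))) * ?W z) \<longlonglongrightarrow>
          complex_of_real (exp (- (pi * 0 * (snd z \<bullet> snd z)))) * ?W z"
        by (intro tendsto_mult_right tendsto_of_real tendsto_intros alim)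
      then show "(\<lambda>n. ?J n z) \<longlonglongrightarrow> ?W z" by simp
    qed
    show "AE z in lborel. norm (?J n z) \<le> cmod (?W z)" for n
      using a[of n] by (intro AE_I2) (simp add: norm_mult mult_left_le_one_le)
  qed (use W in \<open>auto intro: borel_measurable_integrable[OF Jint]\<close>)
  moreover have "(\<lambda>n. LINT z|lborel. ?J n z) \<longlonglongrightarrow>
      l2_inner f (tf_shift (0, 0) h) * l2_inner (tf_shift (0, 0) g) \<gamma>"
    unfolding eq
  proof (rule heat_approximates_identity[OF _ _ alim a])
    have c: "continuous_on UNIV (\<lambda>y. l2_inner u (tf_shift (y, 0) v))" if "u \<in> L2" "v \<in> L2" for u v :: "real ^ 'd \<Rightarrow> complex"
      by (rule continuous_on_compose2[OF continuous_on_l2_inner_tf_shift[OF that]]) (auto intro!: continuous_intros)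
    have "continuous_on UNIV (\<lambda>y. cnj (l2_inner \<gamma> (tf_shift (y, 0) g)))"
      by (intro continuous_intros c \<gamma> g)
    then show "continuous_on UNIV (\<lambda>y. l2_inner f (tf_shift (y, 0) h) * l2_inner (tf_shift (y, 0) g) \<gamma>)"
      unfolding l2_inner_cnj by (intro continuous_on_mult c f h)
    fix y :: "real ^ 'd"
    show "cmod (l2_inner f (tf_shift (y, 0) h) * l2_inner (tf_shift (y, 0) g) \<gamma>)
        \<le> (l2_norm f * l2_norm h) * (l2_norm g * l2_norm \<gamma>)"
      using l2_cauchy_schwarz[OF f tf_shift_L2[OF h]] l2_cauchy_schwarz[OF tf_shift_L2[OF g] \<gamma>]
      unfolding norm_mult by (intro mult_mono) (auto simp: l2_norm_tf_shift)
  qed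
  ultimately show "(LINT z|lborel. ?W z) = l2_inner f h * l2_inner g \<gamma>"
    using LIMSEQ_unique by (fastforce simp flip: zero_prod_def)
qed

section \<open>Lattices in Euclidean space\<close>

text \<open>In a subgroup it suffices that the origin is isolated, because translations are isometries.\<close>

definition discrete_subgroup :: "'a::euclidean_space set \<Rightarrow> bool" where
  "discrete_subgroup G \<longleftrightarrow> 0 \<in> G \<and> (\<forall>x\<in>G. \<forall>y\<in>G. x + y \<in> G) \<and> (\<forall>x\<in>G. - x \<in> G) \<and> 0 isolated_in G"

lemma discrete_subgroup_scale_int:
  assumes "discrete_subgroup G" "x \<in> G"
  shows "of_int n *\<^sub>R x \<in> G"
proof -
  have nat: "of_nat k *\<^sub>R x \<in> G" for k
    using assms by (induction k) (auto simp: discrete_subgroup_def scaleR_add_left)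
  show ?thesis
  proof (cases "n \<ge> 0")
    case True
    then show ?thesis using nat[of "nat n"] by simp
  next
    case False
    then have "of_int n *\<^sub>R x = - (of_nat (nat (- n)) *\<^sub>R x)" by simp
    then show ?thesis using nat[of "nat (- n)"] assms by (simp add: discrete_subgroup_def)
  qed
qed

lemma discrete_subgroup_sum:
  assumes "discrete_subgroup G" "\<And>i. i \<in> I \<Longrightarrow> f i \<in> G"
  shows "(\<Sum>i\<in>I. f i) \<in> G"
  using assms(2) by (induction I rule: infinite_finite_induct) (use assms(1) in \<open>auto simp: discrete_subgroup_def\<close>)

lemma discrete_subgroup_diff: "discrete_subgroup G \<Longrightarrow> x \<in> G \<Longrightarrow> y \<in> G \<Longrightarrow> x - y \<in> G"
  unfolding discrete_subgroup_def by (metis add_uminus_conv_diff)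

lemma finite_discrete_subgroup_Int_bounded:
  assumes G: "discrete_subgroup G" and S: "bounded S"
  shows "finite (G \<inter> S)"
proof -
  from G have "0 isolated_in G" by (simp add: discrete_subgroup_def)
  then obtain d where d: "d > 0" "\<And>y. y \<in> G \<Longrightarrow> dist 0 y < d \<Longrightarrow> y = 0"
    by (rule isolated_inE_dist) auto
  have "uniform_discrete G"
  proof (rule uniformI1[OF d(1)])
    fix x y assume xy: "x \<in> G" "y \<in> G" "dist x y < d"
    then show "x = y"
      using d(2)[OF discrete_subgroup_diff[OF G xy(1,2)]] by (auto simp: dist_norm norm_minus_commute)
  qed
  then have "uniform_discrete (G \<inter> S)" by (rule uniform_discrete_subset) auto
  moreover have "bounded (G \<inter> S)" using S by (rule bounded_subset) auto
  ultimately show ?thesis by (simp flip: uniform_discrete_finite_iff)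
qed

text \<open>
  The new basis vector \<open>v\<close> has the smallest positive height \<open>\<phi> v\<close> above \<open>span B\<close> among the group elements
  in the span of \<open>B\<close> and \<open>p\<close>.  A minimum exists because reduction modulo \<open>B\<close> confines the candidates to a
  bounded set, which meets the group in finitely many points.  Division with remainder by \<open>\<phi> v\<close> then
  brings every other element down to height zero, into \<open>span B\<close>.\<close>

lemma lattice_basis_step:
  fixes G B :: "'a::euclidean_space set"
  assumes G: "discrete_subgroup G" and B: "B \<subseteq> G" "independent B"
    and gen: "\<And>x. x \<in> G \<Longrightarrow> x \<in> span B \<Longrightarrow> \<exists>c. x = (\<Sum>b\<in>B. of_int (c b) *\<^sub>R b)"
    and p: "p \<in> G" "p \<notin> span B"
  obtains v where "v \<in> G" "v \<notin> span B"
    "\<And>x. x \<in> G \<Longrightarrow> x \<in> span (insert v B) \<Longrightarrow> \<exists>c. x = (\<Sum>b\<in>insert v B. of_int (c b) *\<^sub>R b)"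
proof -
  have finB: "finite B" using B(2) independent_bound by blast
  have "independent (insert p B)" using B(2) p(2) by (rule independent_insertI[rotated])
  then obtain \<phi> :: "'a \<Rightarrow> real" where \<phi>: "linear \<phi>" "\<forall>x\<in>insert p B. \<phi> x = (if x = p then 1 else 0)"
    using linear_independent_extend[of "insert p B" "\<lambda>x. if x = p then 1 else 0"] by blast
  have pB: "p \<notin> B" using p(2) span_base by blast
  have \<phi>p: "\<phi> p = 1" and \<phi>b: "\<And>b. b \<in> B \<Longrightarrow> \<phi> b = 0" using \<phi>(2) pB by auto
  have \<phi>span: "\<phi> x = 0" if "x \<in> span B" for x
    using linear_eq_0_on_span[OF \<phi>(1) \<phi>b that] .
  \<comment> \<open>The candidates, reduced modulo \<open>B\<close> and no higher than \<open>p\<close>; \<open>p\<close> itself is one of them.\<close>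
  define P where "P = {x \<in> G. 0 < \<phi> x \<and> \<phi> x \<le> 1 \<and>
     (\<exists>c. (\<forall>b\<in>B. 0 \<le> c b \<and> c b \<le> 1) \<and> x - \<phi> x *\<^sub>R p = (\<Sum>b\<in>B. c b *\<^sub>R b))}"
  have "P \<subseteq> G \<inter> cball 0 (norm p + (\<Sum>b\<in>B. norm b))"
  proof
    fix x assume "x \<in> P"
    then obtain c where x: "x \<in> G" "0 < \<phi> x" "\<phi> x \<le> 1" and c: "\<forall>b\<in>B. 0 \<le> c b \<and> c b \<le> 1"
      and eq: "x - \<phi> x *\<^sub>R p = (\<Sum>b\<in>B. c b *\<^sub>R b)"
      by (auto simp: P_def)
    have "norm x = norm (\<phi> x *\<^sub>R p + (\<Sum>b\<in>B. c b *\<^sub>R b))" by (simp flip: eq)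
    also have "\<dots> \<le> norm (\<phi> x *\<^sub>R p) + (\<Sum>b\<in>B. norm (c b *\<^sub>R b))"
      by (rule order_trans[OF norm_triangle_ineq add_left_mono[OF norm_sum]])
    also have "\<dots> \<le> norm p + (\<Sum>b\<in>B. norm b)"
      using x c by (intro add_mono sum_mono) (auto intro!: mult_left_le_one_le)
    finally show "x \<in> G \<inter> cball 0 (norm p + (\<Sum>b\<in>B. norm b))" using x by simp
  qed
  then have finP: "finite P"
    using finite_discrete_subgroup_Int_bounded[OF G bounded_cball] finite_subset by blast
  have "p \<in> P" using p(1) \<phi>p by (auto simp: P_def intro!: exI[of _ "\<lambda>_. 0"])
  then obtain v where v: "v \<in> P" and vmin: "\<And>x. x \<in> P \<Longrightarrow> \<phi> v \<le> \<phi> x"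
    using finP by (metis arg_min_if_finite(1) arg_min_least empty_iff)
  have vG: "v \<in> G" and v0: "0 < \<phi> v" "\<phi> v \<le> 1" using v by (auto simp: P_def)
  have vspan: "v \<in> span (insert p B)"
    using v unfolding P_def span_breakdown_eq
    by (auto intro!: exI[of _ "\<phi> v"] span_sum span_scale intro: span_base)
  show thesis
  proof (rule that[OF vG])
    show vB: "v \<notin> span B" using \<phi>span v0 by force
    fix x assume x: "x \<in> G" "x \<in> span (insert v B)"
    define n where "n = \<lfloor>\<phi> x / \<phi> v\<rfloor>"
    define y where "y = x - of_int n *\<^sub>R v"
    have yG: "y \<in> G" unfolding y_def
      by (intro discrete_subgroup_diff[OF G] discrete_subgroup_scale_int[OF G] x vG)
    have \<phi>y: "\<phi> y = \<phi> x - of_int n * \<phi> v"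
      using \<phi>(1) by (simp add: y_def linear_diff linear_scale)
    have "of_int n \<le> \<phi> x / \<phi> v" "\<phi> x / \<phi> v < of_int n + 1" unfolding n_def by linarith+
    then have y0: "0 \<le> \<phi> y" "\<phi> y < \<phi> v"
      using v0 by (simp_all add: \<phi>y field_simps)
    have "insert v B \<subseteq> span (insert p B)"
      using vspan span_superset[of "insert p B"] by auto
    then have "x \<in> span (insert p B)"
      using x(2) by (metis span_minimal subsetD subspace_span)
    then have "y \<in> span (insert p B)"
      unfolding y_def by (intro span_diff span_scale vspan)
    then obtain k where k: "y - k *\<^sub>R p \<in> span B" by (auto simp: span_breakdown_eq)
    have "\<phi> (y - k *\<^sub>R p) = 0" using \<phi>span[OF k] .
    then have "k = \<phi> y" using \<phi>(1) \<phi>p by (simp add: linear_diff linear_scale)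
    with k obtain u where u: "y - \<phi> y *\<^sub>R p = (\<Sum>b\<in>B. u b *\<^sub>R b)"
      by (auto simp: span_finite[OF finB])
    have "\<phi> y = 0"
    proof (rule ccontr)
      assume ne: "\<phi> y \<noteq> 0"
      \<comment> \<open>Reducing \<open>y\<close> modulo \<open>B\<close> would give a candidate lower than \<open>v\<close>.\<close>
      define y' where "y' = y - (\<Sum>b\<in>B. of_int \<lfloor>u b\<rfloor> *\<^sub>R b)"
      have "y' \<in> G" unfolding y'_def
        using B(1) by (intro discrete_subgroup_diff[OF G] yG discrete_subgroup_sum[OF G]
            discrete_subgroup_scale_int[OF G]) auto
      moreover have \<phi>y': "\<phi> y' = \<phi> y"
        using \<phi>(1) \<phi>b by (simp add: y'_def linear_diff linear_sum linear_scale)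
      moreover have "y' - \<phi> y *\<^sub>R p = (\<Sum>b\<in>B. frac (u b) *\<^sub>R b)"
      proof -
        have "y' - \<phi> y *\<^sub>R p = (y - \<phi> y *\<^sub>R p) - (\<Sum>b\<in>B. of_int \<lfloor>u b\<rfloor> *\<^sub>R b)"
          by (simp add: y'_def)
        then show ?thesis
          by (simp add: u frac_def scaleR_diff_left sum_subtractf)
      qed
      moreover have "\<forall>b\<in>B. 0 \<le> frac (u b) \<and> frac (u b) \<le> 1"
        by (simp add: frac_lt_1 less_imp_le)
      ultimately have "y' \<in> P"
        using y0 v0 ne unfolding P_def by (auto intro!: exI[of _ "\<lambda>b. frac (u b)"])
      then show False using vmin[of y'] y0 \<phi>y' by simp
    qed
    then have "y \<in> span B" using k \<open>k = \<phi> y\<close> by simp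
    then obtain c where c: "y = (\<Sum>b\<in>B. of_int (c b) *\<^sub>R b)" using gen[OF yG] by blast
    have vnB: "v \<notin> B" using vB span_base by blast
    have "x = of_int n *\<^sub>R v + y" by (simp add: y_def)
    also have "\<dots> = (\<Sum>b\<in>insert v B. of_int ((c(v := n)) b) *\<^sub>R b)"
      using finB vnB unfolding c by (simp, intro sum.cong) auto
    finally show "\<exists>c. x = (\<Sum>b\<in>insert v B. of_int (c b) *\<^sub>R b)" by blast
  qed
qed

lemma lattice_basis_exists:
  fixes G :: "'a::euclidean_space set"
  assumes G: "discrete_subgroup G" and span: "span G = UNIV"
  obtains B where "B \<subseteq> G" "independent B" "span B = UNIV"
    "\<And>x. x \<in> G \<Longrightarrow> \<exists>c. x = (\<Sum>b\<in>B. of_int (c b) *\<^sub>R b)"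
proof -
  have "\<exists>B. B \<subseteq> G \<and> independent B \<and> card B = k \<and>
      (\<forall>x\<in>G \<inter> span B. \<exists>c. x = (\<Sum>b\<in>B. of_int (c b) *\<^sub>R b))" if "k \<le> DIM('a)" for k
    using that
  proof (induction k)
    case 0
    show ?case by (rule exI[of _ "{}"]) (auto simp: independent_empty)
  next
    case (Suc k)
    then obtain B where B: "B \<subseteq> G" "independent B" "card B = k"
      and gen: "\<And>x. x \<in> G \<Longrightarrow> x \<in> span B \<Longrightarrow> \<exists>c. x = (\<Sum>b\<in>B. of_int (c b) *\<^sub>R b)"
      by (metis IntI Suc_leD)
    have "dim B < DIM('a)" using B Suc.prems by (simp add: dim_eq_card_independent)
    then have "\<not> G \<subseteq> span B"
      using span dim_subset[of G "span B"] by (metis dim_UNIV dim_span not_le)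
    then obtain p where "p \<in> G" "p \<notin> span B" by blast
    from lattice_basis_step[OF G B(1,2) gen this] obtain v where v: "v \<in> G" "v \<notin> span B"
      "\<And>x. x \<in> G \<Longrightarrow> x \<in> span (insert v B) \<Longrightarrow> \<exists>c. x = (\<Sum>b\<in>insert v B. of_int (c b) *\<^sub>R b)"
      by blast
    have "v \<notin> B" "finite B" using v(2) span_base B(2) independent_bound by blast+
    then show ?case
      using v B by (intro exI[of _ "insert v B"]) (auto simp: independent_insertI)
  qed
  from this[OF order_refl] obtain B where B: "B \<subseteq> G" "independent B" "card B = DIM('a)"
    "\<forall>x\<in>G \<inter> span B. \<exists>c. x = (\<Sum>b\<in>B. of_int (c b) *\<^sub>R b)" by blast
  have "span B = UNIV" using B by (metis dim_eq_card_independent dim_eq_full)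
  then show ?thesis using B that by auto
qed

text \<open>The vectors \<open>v b\<close> are a basis of the lattice, enumerated by the standard basis, and the \<open>w b\<close> are the
  dual basis: \<open>z \<bullet> w b\<close> is the coordinate of \<open>z\<close> along \<open>v b\<close>.\<close>

lemma lattice_coordinates_exist:
  fixes G :: "'a::euclidean_space set"
  assumes G: "discrete_subgroup G" and span: "span G = UNIV"
  obtains v w :: "'a \<Rightarrow> 'a" where
    "\<And>b c. b \<in> Basis \<Longrightarrow> c \<in> Basis \<Longrightarrow> v b \<bullet> w c = (if b = c then 1 else 0)"
    "\<And>z. z = (\<Sum>b\<in>Basis. (z \<bullet> w b) *\<^sub>R v b)"
    "G = {z. \<forall>b\<in>Basis. z \<bullet> w b \<in> \<int>}"
proof -
  obtain B where B: "B \<subseteq> G" "independent B" "span B = UNIV"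
    and gen: "\<And>x. x \<in> G \<Longrightarrow> \<exists>c. x = (\<Sum>b\<in>B. of_int (c b) *\<^sub>R b)"
    using lattice_basis_exists[OF G span] by blast
  have finB: "finite B" using B(2) independent_bound by blast
  have "card B = DIM('a)" using B(2,3) by (metis dim_eq_card_independent dim_span dim_UNIV)
  then obtain v where v: "bij_betw v (Basis :: 'a set) B"
    using finite_same_card_bij[OF finite_Basis finB] by metis
  obtain L where L: "linear L" "\<forall>x\<in>B. L x = inv_into Basis v x"
    using linear_independent_extend[OF B(2)] by blast
  define w where "w b = adjoint L b" for b
  have zw: "z \<bullet> w b = L z \<bullet> b" for z b
    unfolding w_def by (rule adjoint_works[OF L(1)])
  have Lv: "L (v b) = b" if "b \<in> Basis" for b
    using that L(2) v by (metis bij_betw_apply bij_betw_inv_into_left)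
  have dual: "v b \<bullet> w c = (if b = c then 1 else 0)" if "b \<in> Basis" "c \<in> Basis" for b c
    using that by (simp add: zw Lv inner_Basis)
  have expand: "z = (\<Sum>b\<in>Basis. (z \<bullet> w b) *\<^sub>R v b)" for z
  proof -
    have lin: "linear (\<lambda>z. \<Sum>b\<in>Basis. (z \<bullet> w b) *\<^sub>R v b)"
      by (intro linear_compose_sum ballI bounded_linear.linear bounded_linear_intros)
    have "id z = (\<Sum>b\<in>Basis. (z \<bullet> w b) *\<^sub>R v b)"
    proof (rule linear_eq_on_span[OF linear_id lin])
      fix x assume "x \<in> B"
      then obtain c where c: "c \<in> Basis" "x = v c" using v by (auto simp: bij_betw_def)
      then have "(\<Sum>b\<in>Basis. (x \<bullet> w b) *\<^sub>R v b) = (\<Sum>b\<in>Basis. if b = c then v c else 0)"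
        by (intro sum.cong) (auto simp: dual)
      then show "id x = (\<Sum>b\<in>Basis. (x \<bullet> w b) *\<^sub>R v b)" using c by simp
    qed (use B in simp)
    then show ?thesis by simp
  qed
  have "G = {z. \<forall>b\<in>Basis. z \<bullet> w b \<in> \<int>}"
  proof (intro equalityI subsetI)
    fix z assume "z \<in> G"
    then obtain c where c: "z = (\<Sum>x\<in>B. of_int (c x) *\<^sub>R x)" using gen by blast
    have "x \<bullet> w b \<in> \<int>" if "x \<in> B" "b \<in> Basis" for x b
      using that v dual by (auto simp: bij_betw_def)
    then show "z \<in> {z. \<forall>b\<in>Basis. z \<bullet> w b \<in> \<int>}"
      by (auto simp: c inner_sum_left intro!: Ints_sum Ints_mult)
  next
    fix z assume "z \<in> {z. \<forall>b\<in>Basis. z \<bullet> w b \<in> \<int>}"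
    then have "\<forall>b\<in>Basis. \<exists>n::int. z \<bullet> w b = of_int n" by (auto elim!: Ints_cases)
    then obtain n :: "'a \<Rightarrow> int" where n: "\<And>b. b \<in> Basis \<Longrightarrow> z \<bullet> w b = of_int (n b)" by metis
    have "z = (\<Sum>b\<in>Basis. of_int (n b) *\<^sub>R v b)"
      by (subst expand) (simp add: n)
    also have "\<dots> \<in> G"
      using v B(1) by (intro discrete_subgroup_sum[OF G] discrete_subgroup_scale_int[OF G])
        (auto simp: bij_betw_def)
    finally show "z \<in> G" .
  qed
  then show ?thesis using that dual expand by blast
qed

text \<open>A vector \<open>a\<close> orthogonal to the group would induce a continuous function \<open>z \<mapsto> a \<bullet> z\<close> on the compact
  quotient, yet this function is unbounded.\<close>

lemma cocompact_span_UNIV: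
  fixes G :: "'a::euclidean_space set"
  assumes "quotient_map euclidean T (\<lambda>z. (+) z ` G)" "compact_space T" "0 \<in> G"
  shows "span G = UNIV"
proof (rule ccontr)
  let ?q = "\<lambda>z. (+) z ` G"
  assume "span G \<noteq> UNIV"
  then obtain a where a: "a \<noteq> 0" "span G \<subseteq> {x. a \<bullet> x = 0}"
    using span_not_univ_subset_hyperplane by blast
  define h where "h C = a \<bullet> (SOME z. z \<in> C)" for C
  have h: "h (?q z) = a \<bullet> z" for z
  proof -
    have "z \<in> ?q z" using assms(3) by (metis add.right_neutral image_eqI)
    then have "(SOME x. x \<in> ?q z) \<in> ?q z" by (rule someI)
    then obtain l where "l \<in> G" "(SOME x. x \<in> ?q z) = z + l" by blast
    then show ?thesis using a(2) span_base[of l G] by (auto simp: h_def inner_add_right)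
  qed
  have "continuous_map euclidean euclidean (h \<circ> ?q)"
    unfolding comp_def h by (simp add: continuous_intros)
  then have "continuous_map T euclidean h"
    by (rule continuous_compose_quotient_map[OF assms(1)])
  then have "compactin euclidean (h ` topspace T)"
    using assms(2) image_compactin unfolding compact_space_def by blast
  then have "bounded (h ` topspace T)"
    by (simp add: compact_imp_bounded)
  moreover have "h ` topspace T = UNIV"
  proof -
    have "topspace T = range ?q" using assms(1) by (auto simp: quotient_map_def)
    then have "h ` topspace T = range (\<lambda>z. a \<bullet> z)" by (simp add: image_image h)
    moreover have "r = a \<bullet> ((r / (a \<bullet> a)) *\<^sub>R a)" for r using a(1) by simp
    ultimately show ?thesis by blast
  qed
  ultimately show False
    using not_bounded_UNIV by metis
qed

section \<open>Fundamental domains and periodisation\<close>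

lemma borel_measurable_ennreal_cmod: "(\<lambda>z. ennreal (cmod z)) \<in> borel_measurable borel"
  by measurable

locale lattice_domain =
  fixes G D :: "'a::euclidean_space set"
  assumes subgroup: "discrete_subgroup G"
    and D [measurable]: "D \<in> sets borel"
    and unique: "\<exists>!l. l \<in> G \<and> z - l \<in> D"
begin

lemma countable_G: "countable G"
proof -
  have "countable (\<Union>n. G \<inter> cball 0 (real n))"
    using finite_discrete_subgroup_Int_bounded[OF subgroup bounded_cball]
    by (intro countable_UN[OF _ countable_finite]) auto
  moreover have "G \<subseteq> (\<Union>n. G \<inter> cball 0 (real n))"
    using real_arch_simple by fastforce
  ultimately show ?thesis by (rule countable_subset[rotated])
qed

lemma uminus_G: "l \<in> G \<Longrightarrow> - l \<in> G"
  using subgroup by (simp add: discrete_subgroup_def)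

lemma nn_sum_translates: "(\<integral>\<^sup>+l. indicator D (z - l) \<partial>count_space G) = 1"
proof -
  obtain l0 where l0: "l0 \<in> G" "z - l0 \<in> D" "\<And>l. l \<in> G \<Longrightarrow> z - l \<in> D \<Longrightarrow> l = l0"
    using unique[of z] by blast
  have "(\<integral>\<^sup>+l. indicator D (z - l) \<partial>count_space G) = (\<integral>\<^sup>+l. indicator {l0} l \<partial>count_space G)"
  proof (rule nn_integral_cong)
    fix l assume "l \<in> space (count_space G)"
    then have "z - l \<in> D \<longleftrightarrow> l \<in> {l0}"
      using l0 unfolding space_count_space by blast
    then show "indicator D (z - l) = (indicator {l0} l :: ennreal)"
      by (simp only: indicator_def)
  qed
  also have "\<dots> = 1" using l0(1) by (simp add: emeasure_count_space)
  finally show ?thesis .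
qed

lemma sum_translates: "(LINT l|count_space G. indicator D (z - l) *\<^sub>R c) = (c :: complex)"
proof -
  obtain l0 where l0: "l0 \<in> G" "z - l0 \<in> D" "\<And>l. l \<in> G \<Longrightarrow> z - l \<in> D \<Longrightarrow> l = l0"
    using unique[of z] by blast
  have iff: "z - l \<in> D \<longleftrightarrow> l = l0" if "l \<in> G" for l
    using l0 that by blast
  have "(LINT l|count_space G. indicator D (z - l) *\<^sub>R c) = (LINT l|count_space G. (if l = l0 then c else 0))"
    by (rule Bochner_Integration.integral_cong[OF refl]) (simp add: indicator_def iff)
  also have "\<dots> = (\<Sum>l | l \<in> G \<and> (if l = l0 then c else 0) \<noteq> 0. (if l = l0 then c else 0))"
    by (rule lebesgue_integral_count_space_finite_support) (rule finite_subset[of _ "{l0}"], auto)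
  also have "\<dots> = (\<Sum>l\<in>{l0}. (if l = l0 then c else 0))"
    using l0(1) by (intro sum.mono_neutral_left) auto
  finally show ?thesis by simp
qed

text \<open>Exchange sum and integral, translate each summand, and exchange back: what remains is the number of
  translates of the domain that contain a given point, which is one.\<close>

lemma nn_integral_periodisation:
  assumes [measurable]: "F \<in> borel_measurable borel"
  shows "(\<integral>\<^sup>+z. (\<integral>\<^sup>+l. F (z + l) * indicator D z \<partial>count_space G) \<partial>lborel) = (\<integral>\<^sup>+z. F z \<partial>lborel)"
proof -
  have "(\<integral>\<^sup>+z. (\<integral>\<^sup>+l. F (z + l) * indicator D z \<partial>count_space G) \<partial>lborel) =
      (\<integral>\<^sup>+l. (\<integral>\<^sup>+z. F (z + l) * indicator D z \<partial>lborel) \<partial>count_space G)"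
    by (rule nn_integral_count_space_nn_integral[OF countable_G]) measurable
  also have "\<dots> = (\<integral>\<^sup>+l. (\<integral>\<^sup>+z. F z * indicator D (z - l) \<partial>lborel) \<partial>count_space G)"
  proof (rule nn_integral_cong)
    fix l
    show "(\<integral>\<^sup>+z. F (z + l) * indicator D z \<partial>lborel) = (\<integral>\<^sup>+z. F z * indicator D (z - l) \<partial>lborel)"
      using nn_integral_lborel_translate[of "\<lambda>z. F z * indicator D (z - l)" l] by simp
  qed
  also have "\<dots> = (\<integral>\<^sup>+z. (\<integral>\<^sup>+l. F z * indicator D (z - l) \<partial>count_space G) \<partial>lborel)"
    by (rule nn_integral_count_space_nn_integral[OF countable_G, symmetric]) measurable
  also have "\<dots> = (\<integral>\<^sup>+z. F z \<partial>lborel)"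
    by (simp add: nn_integral_cmult nn_sum_translates)
  finally show ?thesis .
qed

lemma integral_periodisation:
  fixes F :: "'a \<Rightarrow> complex"
  assumes F: "integrable lborel F"
  shows "(LINT z|lborel. LINT l|count_space G. indicator D z *\<^sub>R F (z + l)) = (LINT z|lborel. F z)"
proof -
  interpret G: sigma_finite_measure "count_space G"
    by (rule sigma_finite_measure_count_space_countable[OF countable_G])
  interpret P: pair_sigma_finite lborel "count_space G" ..
  have Fm [measurable]: "F \<in> borel_measurable borel"
    using borel_measurable_integrable[OF F] by simp
  have meas: "H \<in> borel_measurable (lborel \<Otimes>\<^sub>M count_space G)"
    if "\<And>l. (\<lambda>z. H (z, l)) \<in> borel_measurable borel" for H :: "'a \<times> 'a \<Rightarrow> complex"
  proof -
    have "(\<lambda>(l, z). H (z, l)) \<in> borel_measurable (count_space G \<Otimes>\<^sub>M lborel)"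
      by (rule measurable_pair_measure_countable1[OF countable_G]) (use that in simp)
    from measurable_pair_swap[OF this] show ?thesis by (simp add: case_prod_eta split_def)
  qed
  define H where "H = (\<lambda>(z, l). indicator D z *\<^sub>R F (z + l))"
  define K where "K = (\<lambda>(z, l). indicator D (z - l) *\<^sub>R F z)"
  have Hm: "H \<in> borel_measurable (lborel \<Otimes>\<^sub>M count_space G)"
    by (rule meas) (simp add: H_def)
  have Km: "K \<in> borel_measurable (lborel \<Otimes>\<^sub>M count_space G)"
    by (rule meas) (simp add: K_def)
  have fin: "(\<integral>\<^sup>+z. ennreal (cmod (F z)) \<partial>lborel) < \<infinity>"
    using F by (simp add: integrable_iff_bounded)
  have Hint: "integrable (lborel \<Otimes>\<^sub>M count_space G) H"
  proof (rule integrableI_bounded[OF Hm])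
    have "(\<integral>\<^sup>+x. ennreal (cmod (H x)) \<partial>(lborel \<Otimes>\<^sub>M count_space G)) =
        (\<integral>\<^sup>+z. \<integral>\<^sup>+l. ennreal (cmod (H (z, l))) \<partial>count_space G \<partial>lborel)"
      by (rule G.nn_integral_fst[symmetric]) (intro measurable_compose[OF Hm] borel_measurable_ennreal_cmod)
    also have "\<dots> = (\<integral>\<^sup>+z. \<integral>\<^sup>+l. ennreal (cmod (F (z + l))) * indicator D z \<partial>count_space G \<partial>lborel)"
      by (intro nn_integral_cong) (auto simp: H_def indicator_def)
    also have "\<dots> = (\<integral>\<^sup>+z. ennreal (cmod (F z)) \<partial>lborel)"
      by (rule nn_integral_periodisation) measurable
    finally show "(\<integral>\<^sup>+x. ennreal (cmod (H x)) \<partial>(lborel \<Otimes>\<^sub>M count_space G)) < \<infinity>"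
      using fin by simp
  qed
  have Kint: "integrable (lborel \<Otimes>\<^sub>M count_space G) K"
  proof (rule integrableI_bounded[OF Km])
    have "(\<integral>\<^sup>+x. ennreal (cmod (K x)) \<partial>(lborel \<Otimes>\<^sub>M count_space G)) =
        (\<integral>\<^sup>+z. \<integral>\<^sup>+l. ennreal (cmod (K (z, l))) \<partial>count_space G \<partial>lborel)"
      by (rule G.nn_integral_fst[symmetric]) (intro measurable_compose[OF Km] borel_measurable_ennreal_cmod)
    also have "\<dots> = (\<integral>\<^sup>+z. \<integral>\<^sup>+l. ennreal (cmod (F z)) * indicator D (z - l) \<partial>count_space G \<partial>lborel)"
      by (intro nn_integral_cong) (auto simp: K_def indicator_def)
    also have "\<dots> = (\<integral>\<^sup>+z. ennreal (cmod (F z)) \<partial>lborel)"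
      by (simp add: nn_integral_cmult nn_sum_translates)
    finally show "(\<integral>\<^sup>+x. ennreal (cmod (K x)) \<partial>(lborel \<Otimes>\<^sub>M count_space G)) < \<infinity>"
      using fin by simp
  qed
  have Hc: "integrable (lborel \<Otimes>\<^sub>M count_space G) (\<lambda>(z, l). H (z, l))"
    and Kc: "integrable (lborel \<Otimes>\<^sub>M count_space G) (\<lambda>(z, l). K (z, l))"
    using Hint Kint by (simp_all only: case_prod_eta)
  have "(LINT z|lborel. LINT l|count_space G. H (z, l)) = (LINT l|count_space G. LINT z|lborel. H (z, l))"
    using P.integral_fst[OF Hc] P.integral_snd[OF Hc] by simp
  also have "\<dots> = (LINT l|count_space G. LINT z|lborel. K (z, l))"
  proof (rule Bochner_Integration.integral_cong[OF refl])
    fix l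
    show "(LINT z|lborel. H (z, l)) = (LINT z|lborel. K (z, l))"
      using lborel_integral_translate[of "\<lambda>z. K (z, l)" l] by (simp add: H_def K_def)
  qed
  also have "\<dots> = (LINT z|lborel. LINT l|count_space G. K (z, l))"
    using P.integral_fst[OF Kc] P.integral_snd[OF Kc] by simp
  also have "\<dots> = (LINT z|lborel. F z)"
    by (simp add: K_def sum_translates)
  finally show "(LINT z|lborel. LINT l|count_space G. indicator D z *\<^sub>R F (z + l)) = (LINT z|lborel. F z)"
    by (simp add: H_def)
qed

end

text \<open>Periodising the indicator function of one domain over the other gives the constant one.\<close>

lemma fundamental_domains_same_measure:
  assumes "lattice_domain G D" "lattice_domain G D'"
  shows "emeasure lborel D = emeasure lborel D'"
proof -
  interpret D: lattice_domain G D by fact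
  interpret D': lattice_domain G D' by fact
  have inner: "(\<integral>\<^sup>+l. indicator D' (z + l) * indicator D z \<partial>count_space G) = indicator D z" for z
  proof -
    have bij: "bij_betw uminus G G"
      by (rule bij_betwI[of _ _ _ uminus]) (auto intro: D.uminus_G)
    have "(\<integral>\<^sup>+l. indicator D' (z + l) \<partial>count_space G) = (\<integral>\<^sup>+l. indicator D' (z - l) \<partial>count_space G)"
      using nn_integral_bij_count_space[OF bij, of "\<lambda>l. indicator D' (z + l)"] by simp
    then show ?thesis by (simp add: nn_integral_multc D'.nn_sum_translates)
  qed
  have "emeasure lborel D' = (\<integral>\<^sup>+z. indicator D' z \<partial>lborel)" by simp
  also have "\<dots> = (\<integral>\<^sup>+z. indicator D z \<partial>lborel)"
    by (subst D.nn_integral_periodisation[symmetric]) (simp_all add: inner)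
  also have "\<dots> = emeasure lborel D" by simp
  finally show ?thesis by simp
qed

text \<open>The half-open parallelepiped of a lattice basis; it has positive measure because its interior
  contains the point with all coordinates \<open>1/2\<close>.\<close>

lemma lattice_domain_exists:
  fixes G :: "'a::euclidean_space set"
  assumes G: "discrete_subgroup G" and span: "span G = UNIV"
  obtains D where "lattice_domain G D" "bounded D" "0 < measure lborel D" "emeasure lborel D < \<infinity>"
proof -
  obtain v w :: "'a \<Rightarrow> 'a" where
    dual: "\<And>b c. b \<in> Basis \<Longrightarrow> c \<in> Basis \<Longrightarrow> v b \<bullet> w c = (if b = c then 1 else 0)" and
    expand: "\<And>z. z = (\<Sum>b\<in>Basis. (z \<bullet> w b) *\<^sub>R v b)" and
    Geq: "G = {z. \<forall>b\<in>Basis. z \<bullet> w b \<in> \<int>}"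
    using lattice_coordinates_exist[OF G span] by blast
  have coord: "(\<Sum>b\<in>Basis. r b *\<^sub>R v b) \<bullet> w c = r c" if "c \<in> Basis" for r c
    using that by (simp add: inner_sum_left dual if_distrib cong: if_cong)
  define D where "D = {z. \<forall>b\<in>Basis. 0 \<le> z \<bullet> w b \<and> z \<bullet> w b < 1}"
  have Dm: "D \<in> sets borel"
    unfolding D_def by measurable
  have dom: "lattice_domain G D"
  proof
    fix z
    define l where "l = (\<Sum>b\<in>Basis. of_int \<lfloor>z \<bullet> w b\<rfloor> *\<^sub>R v b)"
    have l: "l \<bullet> w b = of_int \<lfloor>z \<bullet> w b\<rfloor>" if "b \<in> Basis" for b
      unfolding l_def using coord[OF that] .
    show "\<exists>!l. l \<in> G \<and> z - l \<in> D"
    proof (rule ex1I)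
      have "0 \<le> (z - l) \<bullet> w b \<and> (z - l) \<bullet> w b < 1" if "b \<in> Basis" for b
        unfolding inner_diff_left l[OF that] by linarith
      then show "l \<in> G \<and> z - l \<in> D" using l by (simp add: Geq D_def)
      fix m assume m: "m \<in> G \<and> z - m \<in> D"
      have "m \<bullet> w b = of_int \<lfloor>z \<bullet> w b\<rfloor>" if "b \<in> Basis" for b
      proof -
        from m that obtain n :: int where n: "m \<bullet> w b = of_int n" by (auto simp: Geq elim!: Ints_cases)
        have "0 \<le> z \<bullet> w b - of_int n" "z \<bullet> w b - of_int n < 1"
          using m that by (auto simp: D_def inner_diff_left n)
        then have "\<lfloor>z \<bullet> w b\<rfloor> = n" by linarith
        then show ?thesis using n by simp
      qed
      then show "m = l" by (subst expand[of m]) (simp add: l_def)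
    qed
  qed (use G Dm in auto)
  have bnd: "D \<subseteq> cball 0 (\<Sum>b\<in>Basis. norm (v b))"
  proof
    fix z assume z: "z \<in> D"
    have "norm z = norm (\<Sum>b\<in>Basis. (z \<bullet> w b) *\<^sub>R v b)" by (subst expand) simp
    also have "\<dots> \<le> (\<Sum>b\<in>Basis. norm ((z \<bullet> w b) *\<^sub>R v b))" by (rule norm_sum)
    also have "\<dots> \<le> (\<Sum>b\<in>Basis. norm (v b))"
      using z by (intro sum_mono) (auto simp: D_def intro!: mult_left_le_one_le)
    finally show "z \<in> cball 0 (\<Sum>b\<in>Basis. norm (v b))" by simp
  qed
  have fin: "emeasure lborel D < \<infinity>"
    using emeasure_mono[OF bnd, of lborel] emeasure_lborel_cball_finite order_le_less_trans by fastforce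
  have pos: "0 < measure lborel D"
  proof -
    define U where "U = (\<Inter>b\<in>Basis. {z. 0 < z \<bullet> w b} \<inter> {z. z \<bullet> w b < 1})"
    have "open U" unfolding U_def
      by (intro open_INT finite_Basis ballI open_Int open_Collect_less continuous_intros)
    moreover
    define h where "h = (\<Sum>b\<in>Basis. (1/2) *\<^sub>R v b)"
    have "h \<bullet> w b = 1/2" if "b \<in> Basis" for b
      unfolding h_def using coord[OF that, of "\<lambda>_. 1/2"] .
    then have "0 < h \<bullet> w b \<and> h \<bullet> w b < 1" if "b \<in> Basis" for b
      using that by fastforce
    then have "h \<in> U" unfolding U_def by auto
    ultimately obtain e where e: "e > 0" "ball h e \<subseteq> U"
      by (meson open_contains_ball)
    have "U \<subseteq> D" by (auto simp: U_def D_def less_imp_le)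
    then have "measure lborel (ball h e) \<le> measure lborel D"
      using e(2) Dm fin by (intro measure_mono_fmeasurable fmeasurableI) auto
    then show ?thesis using content_ball_pos[OF e(1)] by (meson less_le_trans)
  qed
  show ?thesis
    by (rule that[OF dom bounded_subset[OF bounded_cball bnd] pos fin])
qed

text \<open>On a bounded fundamental domain the Gaussian at \<open>l\<close> is dominated by a constant multiple of a wider
  Gaussian at \<open>z + l\<close>, and the periodisation of the latter is integrable.\<close>

lemma gaussian_sum_bounded:
  fixes G :: "'a::euclidean_space set"
  assumes G: "discrete_subgroup G" and span: "span G = UNIV" and c: "0 < c"
  obtains C where "\<And>S. finite S \<Longrightarrow> S \<subseteq> G \<Longrightarrow> (\<Sum>l\<in>S. exp (- (c * (l \<bullet> l)))) \<le> C"
proof -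
  obtain D where dom: "lattice_domain G D" "bounded D" "0 < measure lborel D" "emeasure lborel D < \<infinity>"
    using lattice_domain_exists[OF G span] by blast
  interpret lattice_domain G D by fact
  obtain R where R: "\<And>z. z \<in> D \<Longrightarrow> norm z \<le> R" using dom(2) by (auto simp: bounded_iff)
  define F where "F x = ennreal (exp (c * R\<^sup>2) * exp (- (pi * (c / (2 * pi)) * (x \<bullet> x))))" for x :: 'a
  have [measurable]: "F \<in> borel_measurable borel" unfolding F_def by measurable
  have le: "ennreal (exp (- (c * (l \<bullet> l)))) * indicator D z \<le> F (z + l) * indicator D z" for z l
  proof (cases "z \<in> D")
    case True
    have "(z + l) \<bullet> (z + l) \<le> 2 * (z \<bullet> z) + 2 * (l \<bullet> l)"
      using parallelogram_law[of z l] inner_ge_zero[of "z - l"] by linarith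
    moreover have "z \<bullet> z \<le> R\<^sup>2"
      using R[OF True] by (simp add: power2_norm_eq_inner[symmetric] power_mono)
    ultimately have "c * ((z + l) \<bullet> (z + l)) \<le> c * (2 * R\<^sup>2 + 2 * (l \<bullet> l))"
      using c by (intro mult_left_mono) auto
    then have "- (c * (l \<bullet> l)) \<le> c * R\<^sup>2 + - (pi * (c / (2 * pi)) * ((z + l) \<bullet> (z + l)))"
      by (simp add: field_simps)
    then have "exp (- (c * (l \<bullet> l))) \<le> exp (c * R\<^sup>2) * exp (- (pi * (c / (2 * pi)) * ((z + l) \<bullet> (z + l))))"
      by (simp flip: exp_add)
    then show ?thesis using True by (simp add: F_def)
  qed simp
  let ?S = "\<integral>\<^sup>+l. ennreal (exp (- (c * (l \<bullet> l)))) \<partial>count_space G"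
  have "?S * emeasure lborel D = (\<integral>\<^sup>+z. (\<integral>\<^sup>+l. ennreal (exp (- (c * (l \<bullet> l)))) * indicator D z \<partial>count_space G) \<partial>lborel)"
    by (simp add: nn_integral_multc nn_integral_cmult)
  also have "\<dots> \<le> (\<integral>\<^sup>+z. (\<integral>\<^sup>+l. F (z + l) * indicator D z \<partial>count_space G) \<partial>lborel)"
    by (intro nn_integral_mono le)
  also have "\<dots> = (\<integral>\<^sup>+z. F z \<partial>lborel)" by (rule nn_integral_periodisation) simp
  also have "\<dots> < \<infinity>"
    unfolding F_def using integrable_gaussian[of "c / (2 * pi)", where 'a='a] c
    by (subst nn_integral_eq_integral) auto
  finally have "?S * emeasure lborel D < \<infinity>" .
  moreover have "emeasure lborel D \<noteq> 0" using dom(3) by (auto simp: measure_def)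
  ultimately have "?S < \<infinity>" by (auto simp: ennreal_mult_less_top)
  then obtain C where C: "?S = ennreal C" "0 \<le> C" by (cases ?S) auto
  show ?thesis
  proof (rule that[of C])
    fix S assume S: "finite S" "S \<subseteq> G"
    have "ennreal (\<Sum>l\<in>S. exp (- (c * (l \<bullet> l)))) = (\<Sum>l\<in>S. ennreal (exp (- (c * (l \<bullet> l)))))"
      by simp
    also have "\<dots> = (\<integral>\<^sup>+l. ennreal (exp (- (c * (l \<bullet> l)))) \<partial>count_space S)"
      using S by (simp add: nn_integral_count_space_finite)
    also have "\<dots> = (\<integral>\<^sup>+l. ennreal (exp (- (c * (l \<bullet> l)))) * indicator S l \<partial>count_space UNIV)"
      by (rule nn_integral_count_space_indicator) simp
    also have "\<dots> \<le> (\<integral>\<^sup>+l. ennreal (exp (- (c * (l \<bullet> l)))) * indicator G l \<partial>count_space UNIV)"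
      using S(2) by (intro nn_integral_mono) (auto simp: indicator_def)
    also have "\<dots> = ?S"
      by (rule nn_integral_count_space_indicator[symmetric]) simp
    finally show "(\<Sum>l\<in>S. exp (- (c * (l \<bullet> l)))) \<le> C" using C by (simp add: ennreal_le_iff)
  qed
qed

section \<open>Bessel bounds\<close>

definition bessel :: "((real ^ 'd) \<times> (real ^ 'd)) set \<Rightarrow> (real ^ 'd \<Rightarrow> complex) \<Rightarrow> real \<Rightarrow> bool" where
  "bessel \<Lambda> \<gamma> C \<longleftrightarrow> 0 \<le> C \<and> (\<forall>f\<in>L2. \<forall>S. finite S \<longrightarrow> S \<subseteq> \<Lambda> \<longrightarrow>
     (\<Sum>l\<in>S. (cmod (l2_inner f (tf_shift l \<gamma>)))\<^sup>2) \<le> C * (l2_norm f)\<^sup>2)"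

lemma cmod_inner_tf_shift_diff:
  "cmod (l2_inner (tf_shift l f) (tf_shift m g)) = cmod (l2_inner f (tf_shift (m - l) g))"
proof -
  have "cmod (l2_inner f (tf_shift (m - l) g)) = cmod (l2_inner (tf_shift l f) (tf_shift l (tf_shift (m - l) g)))"
    by (simp add: l2_inner_tf_shift)
  then show ?thesis by (simp add: tf_shift_compose l2_inner_scale_right norm_mult)
qed

lemma cmod_inner_tf_shift_minus:
  "cmod (l2_inner (tf_shift (- l) f) g) = cmod (l2_inner f (tf_shift l g))"
  by (simp add: l2_inner_tf_shift_adjoint norm_mult)

text \<open>
  Let \<open>A\<close> be the sum of the squared coefficients and \<open>u = \<Sum> c\<^sub>l \<pi> l \<phi>\<close>.  Then \<open>A = \<langle>f, u\<rangle>\<close>, while Schur's test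
  for the Gram matrix of the shifts, whose row sums are at most \<open>C\<close>, gives \<open>\<parallel>u\<parallel>\<^sup>2 \<le> C A\<close>.  The
  Cauchy-Schwarz inequality combines the two.\<close>

lemma bessel_of_summable_gram:
  fixes \<phi> :: "real ^ 'd \<Rightarrow> complex"
  assumes G: "discrete_subgroup \<Lambda>" and \<phi>: "\<phi> \<in> L2"
    and C: "\<And>S. finite S \<Longrightarrow> S \<subseteq> \<Lambda> \<Longrightarrow> (\<Sum>l\<in>S. cmod (l2_inner \<phi> (tf_shift l \<phi>))) \<le> C"
  shows "bessel \<Lambda> \<phi> C"
  unfolding bessel_def
proof (intro conjI ballI allI impI)
  show C0: "0 \<le> C" using C[of "{}"] by simp
  fix f :: "real ^ 'd \<Rightarrow> complex" and S
  assume f: "f \<in> L2" and S: "finite S" "S \<subseteq> \<Lambda>"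
  define c where "c l = l2_inner f (tf_shift l \<phi>)" for l
  define A where "A = (\<Sum>l\<in>S. (cmod (c l))\<^sup>2)"
  define K where "K l = cmod (l2_inner \<phi> (tf_shift l \<phi>))" for l
  define u where "u t = (\<Sum>l\<in>S. c l * tf_shift l \<phi> t)" for t
  have u: "u \<in> L2" unfolding u_def[abs_def] by (intro L2_sum L2_scale tf_shift_L2 \<phi>)
  have A0: "0 \<le> A" unfolding A_def by (intro sum_nonneg) simp
  have inner_u: "l2_inner h u = (\<Sum>l\<in>S. cnj (c l) * l2_inner h (tf_shift l \<phi>))" if "h \<in> L2" for h
    unfolding u_def[abs_def] using that
    by (subst l2_inner_sum_right) (auto intro: L2_scale tf_shift_L2 \<phi> simp: l2_inner_scale_right)
  have "l2_inner f u = complex_of_real A"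
    unfolding inner_u[OF f] A_def by (simp add: c_def[symmetric] complex_norm_square mult.commute del: of_real_power)
  then have Afu: "A \<le> l2_norm f * l2_norm u"
    using l2_cauchy_schwarz[OF f u] A0 by simp
  have sumK: "(\<Sum>l\<in>S. K (m - l)) \<le> C" "(\<Sum>l\<in>S. K (l - m)) \<le> C" if "m \<in> S" for m
  proof -
    have "(\<Sum>l\<in>S. K (m - l)) = (\<Sum>x\<in>(\<lambda>l. m - l) ` S. K x)"
      by (subst sum.reindex) (auto simp: inj_on_def)
    also have "\<dots> \<le> C" unfolding K_def
      using S that by (intro C) (auto intro!: discrete_subgroup_diff[OF G])
    finally show "(\<Sum>l\<in>S. K (m - l)) \<le> C" .
    have "(\<Sum>l\<in>S. K (l - m)) = (\<Sum>x\<in>(\<lambda>l. l - m) ` S. K x)"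
      by (subst sum.reindex) (auto simp: inj_on_def)
    also have "\<dots> \<le> C" unfolding K_def
      using S that by (intro C) (auto intro!: discrete_subgroup_diff[OF G])
    finally show "(\<Sum>l\<in>S. K (l - m)) \<le> C" .
  qed
  have "complex_of_real ((l2_norm u)\<^sup>2) = (\<Sum>m\<in>S. cnj (c m) * l2_inner u (tf_shift m \<phi>))"
    unfolding l2_inner_self[symmetric] by (rule inner_u[OF u])
  also have "\<dots> = (\<Sum>m\<in>S. \<Sum>l\<in>S. cnj (c m) * (c l * l2_inner (tf_shift l \<phi>) (tf_shift m \<phi>)))"
    unfolding u_def[abs_def]
    by (subst l2_inner_sum_left) (auto intro: L2_scale tf_shift_L2 \<phi> simp: l2_inner_scale_left sum_distrib_left)
  finally have "(l2_norm u)\<^sup>2 = cmod (\<Sum>m\<in>S. \<Sum>l\<in>S. cnj (c m) * (c l * l2_inner (tf_shift l \<phi>) (tf_shift m \<phi>)))"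
    by (metis abs_of_nonneg norm_of_real zero_le_power2)
  also have "\<dots> \<le> (\<Sum>m\<in>S. \<Sum>l\<in>S. cmod (cnj (c m) * (c l * l2_inner (tf_shift l \<phi>) (tf_shift m \<phi>))))"
    by (intro order_trans[OF norm_sum] sum_mono norm_sum)
  also have "\<dots> \<le> (\<Sum>m\<in>S. \<Sum>l\<in>S. ((cmod (c m))\<^sup>2 * K (m - l) + (cmod (c l))\<^sup>2 * K (m - l)) / 2)"
  proof (intro sum_mono)
    fix m l
    have "cmod (c m) * cmod (c l) * K (m - l) \<le> ((cmod (c m))\<^sup>2 + (cmod (c l))\<^sup>2) / 2 * K (m - l)"
      using sum_squares_bound[of "cmod (c m)" "cmod (c l)"]
      by (intro mult_right_mono) (simp_all add: K_def)
    then show "cmod (cnj (c m) * (c l * l2_inner (tf_shift l \<phi>) (tf_shift m \<phi>)))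
        \<le> ((cmod (c m))\<^sup>2 * K (m - l) + (cmod (c l))\<^sup>2 * K (m - l)) / 2"
      by (simp add: norm_mult cmod_inner_tf_shift_diff K_def[symmetric] field_simps)
  qed
  also have "\<dots> = ((\<Sum>m\<in>S. (cmod (c m))\<^sup>2 * (\<Sum>l\<in>S. K (m - l))) + (\<Sum>l\<in>S. (cmod (c l))\<^sup>2 * (\<Sum>m\<in>S. K (m - l)))) / 2"
  proof -
    have "(\<Sum>m\<in>S. \<Sum>l\<in>S. (cmod (c l))\<^sup>2 * K (m - l)) = (\<Sum>l\<in>S. \<Sum>m\<in>S. (cmod (c l))\<^sup>2 * K (m - l))"
      by (rule sum.swap)
    then show ?thesis
      by (simp add: sum_divide_distrib[symmetric] sum.distrib sum_distrib_left)
  qed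
  also have "\<dots> \<le> ((\<Sum>m\<in>S. (cmod (c m))\<^sup>2 * C) + (\<Sum>l\<in>S. (cmod (c l))\<^sup>2 * C)) / 2"
    using sumK by (intro divide_right_mono add_mono sum_mono mult_left_mono) auto
  also have "\<dots> = C * A" by (simp add: A_def sum_distrib_left mult.commute)
  finally have uA: "(l2_norm u)\<^sup>2 \<le> C * A" .
  have "A\<^sup>2 \<le> (l2_norm f * l2_norm u)\<^sup>2" using Afu A0 by (rule power_mono)
  also have "\<dots> \<le> (l2_norm f)\<^sup>2 * (C * A)"
    unfolding power_mult_distrib using uA by (intro mult_left_mono) auto
  finally have "A * A \<le> (C * (l2_norm f)\<^sup>2) * A" by (simp add: power2_eq_square mult_ac)
  then have "A \<le> C * (l2_norm f)\<^sup>2"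
    using A0 C0 by (cases "A = 0") (auto simp: mult_le_cancel_right)
  then show "(\<Sum>l\<in>S. (cmod (l2_inner f (tf_shift l \<phi>)))\<^sup>2) \<le> C * (l2_norm f)\<^sup>2"
    by (simp add: A_def c_def)
qed

lemma bessel_gauss:
  fixes \<Lambda> :: "((real ^ 'd) \<times> (real ^ 'd)) set"
  assumes G: "discrete_subgroup \<Lambda>" and span: "span \<Lambda> = UNIV"
  obtains C where "bessel \<Lambda> gauss C"
proof -
  obtain c where c: "0 < c"
    "\<And>z :: (real ^ 'd) \<times> (real ^ 'd). cmod (l2_inner gauss (tf_shift z gauss)) = c * exp (- (pi / 2 * (z \<bullet> z)))"
    using cmod_inner_gauss_tf_shift[where 'd='d] by blast
  obtain C where C: "\<And>S. finite S \<Longrightarrow> S \<subseteq> \<Lambda> \<Longrightarrow> (\<Sum>l\<in>S. exp (- (pi / 2 * (l \<bullet> l)))) \<le> C"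
    using gaussian_sum_bounded[OF G span, of "pi / 2"] by auto
  have "bessel \<Lambda> gauss (c * C)"
  proof (rule bessel_of_summable_gram[OF G gauss_L2])
    fix S assume "finite S" "S \<subseteq> \<Lambda>"
    then show "(\<Sum>l\<in>S. cmod (l2_inner gauss (tf_shift l gauss))) \<le> c * C"
      unfolding c(2) sum_distrib_left[symmetric] using C c(1) by (intro mult_left_mono) auto
  qed
  then show ?thesis by (rule that)
qed

lemma S0_L2: "\<gamma> \<in> S0 \<Longrightarrow> \<gamma> \<in> L2"
  by (simp add: S0_def)

lemma S0_integrable_stft:
  fixes \<gamma> :: "real ^ 'd \<Rightarrow> complex"
  assumes "\<gamma> \<in> S0"
  shows "integrable lborel (\<lambda>z. l2_inner \<gamma> (tf_shift z gauss))"
proof (rule integrableI_bounded)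
  have Vm [measurable]: "(\<lambda>z. l2_inner \<gamma> (tf_shift z gauss)) \<in> borel_measurable borel"
    by (rule measurable_l2_inner_tf_shift[OF S0_L2[OF assms] gauss_L2])
  then show "(\<lambda>z. l2_inner \<gamma> (tf_shift z gauss)) \<in> borel_measurable lborel" by simp
  have "(\<lambda>z. ennreal (cmod (l2_inner \<gamma> (tf_shift z gauss)))) \<in> borel_measurable (borel \<Otimes>\<^sub>M borel)"
    unfolding borel_prod by measurable
  then have "(\<lambda>z. ennreal (cmod (l2_inner \<gamma> (tf_shift z gauss)))) \<in> borel_measurable (lborel \<Otimes>\<^sub>M lborel)"
    by (simp cong: measurable_cong_sets)
  from lborel_pair.nn_integral_snd[of "\<lambda>z. ennreal (cmod (l2_inner \<gamma> (tf_shift z gauss)))"] this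
  have "(\<integral>\<^sup>+z. ennreal (cmod (l2_inner \<gamma> (tf_shift z gauss))) \<partial>lborel) =
      (\<integral>\<^sup>+\<omega>. \<integral>\<^sup>+x. ennreal (cmod (l2_inner \<gamma> (tf_shift (x, \<omega>) gauss))) \<partial>lborel \<partial>lborel)"
    by (simp add: lborel_prod case_prod_eta split_def)
  also have "\<dots> < \<infinity>" using assms by (simp add: S0_def)
  finally show "(\<integral>\<^sup>+z. ennreal (cmod (l2_inner \<gamma> (tf_shift z gauss))) \<partial>lborel) < \<infinity>" .
qed

text \<open>Up to a phase and a constant factor, the orthogonality relations write \<open>\<langle>f, \<pi> l \<gamma>\<rangle>\<close> as an integral over \<open>z\<close> of the integrable function
  \<open>\<langle>\<pi> z \<phi>, \<gamma>\<rangle>\<close> against \<open>\<langle>\<pi> (- l) f, \<pi> z \<phi>\<rangle>\<close>, with \<open>\<phi>\<close> the Gaussian.  For each \<open>z\<close> the second factor is, up to a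
  phase, \<open>\<langle>\<pi> (- z) f, \<pi> l \<phi>\<rangle>\<close>, so the Bessel bound of the Gaussian applies uniformly in \<open>z\<close>.  Pairing
  with the coefficients themselves replaces Minkowski's integral inequality.\<close>

lemma bessel_S0:
  fixes \<gamma> :: "real ^ 'd \<Rightarrow> complex"
  assumes G: "discrete_subgroup \<Lambda>" and span: "span \<Lambda> = UNIV" and \<gamma>S0: "\<gamma> \<in> S0"
  obtains C where "bessel \<Lambda> \<gamma> C"
proof -
  obtain C where C: "bessel \<Lambda> gauss C" using bessel_gauss[OF G span] by blast
  have C0: "0 \<le> C" using C by (simp add: bessel_def)
  note \<gamma> = S0_L2[OF \<gamma>S0]
  define N where "N = (l2_norm (gauss :: real ^ 'd \<Rightarrow> complex))\<^sup>2"
  have N: "0 < N" unfolding N_def by (rule zero_less_power[OF l2_norm_gauss_pos])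
  define a where "a z = cmod (l2_inner \<gamma> (tf_shift z gauss))" for z
  have a: "integrable lborel a"
    unfolding a_def[abs_def] by (intro integrable_norm S0_integrable_stft \<gamma>S0)
  define I where "I = (LINT z|lborel. a z)"
  have I0: "0 \<le> I" unfolding I_def a_def by (intro integral_nonneg_AE) simp
  have "bessel \<Lambda> \<gamma> (C * I\<^sup>2 / N\<^sup>2)"
    unfolding bessel_def
  proof (intro conjI ballI allI impI)
    show "0 \<le> C * I\<^sup>2 / N\<^sup>2" using C0 by simp
    fix f :: "real ^ 'd \<Rightarrow> complex" and S
    assume f: "f \<in> L2" and S: "finite S" "S \<subseteq> \<Lambda>"
    define c where "c l = cmod (l2_inner f (tf_shift l \<gamma>))" for l
    define q where "q l z = cmod (l2_inner (tf_shift (- l) f) (tf_shift z gauss))" for l z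
    define A where "A = (\<Sum>l\<in>S. (c l)\<^sup>2)"
    have A0: "0 \<le> A" unfolding A_def by (intro sum_nonneg) simp
    have M: "integrable lborel (\<lambda>z. q l z * a z)" "N * c l \<le> (LINT z|lborel. q l z * a z)" for l
    proof -
      note m = moyal[OF tf_shift_L2[OF f, of "- l"] \<gamma> gauss_L2 gauss_L2]
      have qa: "q l z * a z = cmod (l2_inner (tf_shift (- l) f) (tf_shift z gauss) * l2_inner (tf_shift z gauss) \<gamma>)" for z
        unfolding l2_inner_cnj[of \<gamma> "tf_shift z gauss", symmetric] q_def a_def by (simp add: norm_mult)
      show "integrable lborel (\<lambda>z. q l z * a z)"
        unfolding qa by (intro integrable_norm m)
      have "N * c l = cmod (l2_inner (tf_shift (- l) f) \<gamma> * l2_inner gauss (gauss :: real ^ 'd \<Rightarrow> complex))"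
        unfolding l2_inner_self norm_mult cmod_inner_tf_shift_minus c_def N_def
        by (simp del: of_real_power)
      also have "\<dots> \<le> (LINT z|lborel. q l z * a z)"
        unfolding m(2)[symmetric] qa by (rule integral_norm_bound)
      finally show "N * c l \<le> (LINT z|lborel. q l z * a z)" .
    qed
    have q: "(\<Sum>l\<in>S. (q l z)\<^sup>2) \<le> C * (l2_norm f)\<^sup>2" for z
    proof -
      have qz: "q l z = cmod (l2_inner (tf_shift (- z) f) (tf_shift l gauss))" for l
        unfolding q_def using cmod_inner_tf_shift_diff[of "- l" f z gauss] cmod_inner_tf_shift_diff[of "- z" f l gauss]
        by (simp add: add.commute)
      have "(\<Sum>l\<in>S. (cmod (l2_inner (tf_shift (- z) f) (tf_shift l gauss)))\<^sup>2) \<le> C * (l2_norm (tf_shift (- z) f))\<^sup>2"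
        using C S tf_shift_L2[OF f, of "- z"] unfolding bessel_def by blast
      then show ?thesis by (simp only: qz l2_norm_tf_shift)
    qed
    have "N * A = (\<Sum>l\<in>S. c l * (N * c l))"
      by (simp add: A_def sum_distrib_left power2_eq_square mult_ac)
    also have "\<dots> \<le> (\<Sum>l\<in>S. c l * (LINT z|lborel. q l z * a z))"
      by (intro sum_mono mult_left_mono M) (simp add: c_def)
    also have "\<dots> = (LINT z|lborel. (\<Sum>l\<in>S. c l * (q l z * a z)))"
      using M(1) by (simp add: Bochner_Integration.integral_sum)
    also have "\<dots> \<le> (LINT z|lborel. sqrt A * sqrt (C * (l2_norm f)\<^sup>2) * a z)"
    proof (rule integral_mono)
      show "integrable lborel (\<lambda>z. \<Sum>l\<in>S. c l * (q l z * a z))" using M(1) by simp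
      show "integrable lborel (\<lambda>z. sqrt A * sqrt (C * (l2_norm f)\<^sup>2) * a z)" using a by simp
      fix z
      have "(\<Sum>l\<in>S. c l * q l z) = (\<Sum>l\<in>S. \<bar>c l\<bar> * \<bar>q l z\<bar>)"
        by (simp add: c_def q_def)
      also have "\<dots> \<le> L2_set c S * L2_set (\<lambda>l. q l z) S" by (rule L2_set_mult_ineq)
      also have "\<dots> \<le> sqrt A * sqrt (C * (l2_norm f)\<^sup>2)"
        unfolding L2_set_def A_def by (intro mult_left_mono real_sqrt_le_mono q) (simp add: sum_nonneg)
      finally have "(\<Sum>l\<in>S. c l * q l z) * a z \<le> sqrt A * sqrt (C * (l2_norm f)\<^sup>2) * a z"
        by (rule mult_right_mono) (simp add: a_def)
      then show "(\<Sum>l\<in>S. c l * (q l z * a z)) \<le> sqrt A * sqrt (C * (l2_norm f)\<^sup>2) * a z"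
        by (simp add: sum_distrib_right mult.assoc)
    qed
    also have "\<dots> = sqrt A * (sqrt C * l2_norm f * I)"
      by (simp add: I_def real_sqrt_mult mult_ac)
    finally have "N * A \<le> sqrt A * (sqrt C * l2_norm f * I)" .
    then have "sqrt A * (N * sqrt A) \<le> sqrt A * (sqrt C * l2_norm f * I)"
      using A0 by (simp add: mult_ac)
    then have "N * sqrt A \<le> sqrt C * l2_norm f * I"
      using A0 C0 I0 by (cases "A = 0") (auto simp: mult_le_cancel_left)
    then have "(N * sqrt A)\<^sup>2 \<le> (sqrt C * l2_norm f * I)\<^sup>2"
      using A0 N by (intro power_mono) auto
    then have "N\<^sup>2 * A \<le> C * (l2_norm f)\<^sup>2 * I\<^sup>2"
      using A0 C0 by (simp add: power_mult_distrib)
    then have "A \<le> C * I\<^sup>2 / N\<^sup>2 * (l2_norm f)\<^sup>2"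
      using N by (simp add: field_simps)
    then show "(\<Sum>l\<in>S. (cmod (l2_inner f (tf_shift l \<gamma>)))\<^sup>2) \<le> C * I\<^sup>2 / N\<^sup>2 * (l2_norm f)\<^sup>2"
      by (simp add: A_def c_def)
  qed
  then show ?thesis by (rule that)
qed

section \<open>Uniqueness of Fourier series on the torus\<close>

text \<open>
  Trigonometric polynomials on the torus of \<open>G\<close>; the admissible frequencies \<open>y\<close> form the dual lattice.\<close>

inductive trig :: "'a::euclidean_space set \<Rightarrow> ('a \<Rightarrow> complex) \<Rightarrow> bool" for G where
  char: "(\<And>l. l \<in> G \<Longrightarrow> y \<bullet> l \<in> \<int>) \<Longrightarrow> trig G (\<lambda>z. c * ephase (y \<bullet> z))"
| add: "trig G p \<Longrightarrow> trig G q \<Longrightarrow> trig G (\<lambda>z. p z + q z)"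

lemma trig_const: "trig G (\<lambda>z. c)"
  using trig.char[of G 0 c] by simp

lemma trig_sum: "(\<And>i. i \<in> I \<Longrightarrow> trig G (p i)) \<Longrightarrow> trig G (\<lambda>z. \<Sum>i\<in>I. p i z)"
  by (induction I rule: infinite_finite_induct) (auto intro: trig_const trig.add)

lemma trig_mult:
  assumes "trig G p" "trig G q"
  shows "trig G (\<lambda>z. p z * q z)"
  using assms
proof (induction rule: trig.induct)
  case (char y c)
  from char(2) show ?case
  proof (induction rule: trig.induct)
    case (char y' c')
    have "trig G (\<lambda>z. (c * c') * ephase ((y + y') \<bullet> z))"
      using char \<open>\<And>l. l \<in> G \<Longrightarrow> y \<bullet> l \<in> \<int>\<close> by (intro trig.char) (auto simp: inner_add_left)
    then show ?case by (simp add: inner_add_left ephase_add mult_ac)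
  next
    case (add p q)
    from trig.add[OF add.IH] show ?case by (simp add: distrib_left)
  qed
next
  case (add p p')
  from trig.add[OF add.IH(1)[OF add.prems] add.IH(2)[OF add.prems]] show ?case by (simp add: distrib_right)
qed

lemma trig_continuous_bounded:
  assumes "trig G p"
  shows "continuous_on UNIV p \<and> (\<exists>B. \<forall>z. cmod (p z) \<le> B)"
  using assms
proof (induction rule: trig.induct)
  case (char y c)
  then show ?case by (auto intro!: continuous_intros exI[of _ "cmod c"] simp: norm_mult)
next
  case (add p q)
  then obtain B B' where "\<forall>z. cmod (p z) \<le> B" "\<forall>z. cmod (q z) \<le> B'" by blast
  then have "\<forall>z. cmod (p z + q z) \<le> B + B'"
    by (auto intro: order_trans[OF norm_triangle_ineq] add_mono)
  with add show ?case by (auto intro: continuous_on_add)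
qed

lemma trig_cos_sin:
  assumes "\<And>l. l \<in> G \<Longrightarrow> y \<bullet> l \<in> \<int>"
  shows "trig G (\<lambda>z. complex_of_real (cos (2 * pi * (y \<bullet> z))))"
    and "trig G (\<lambda>z. complex_of_real (sin (2 * pi * (y \<bullet> z))))"
proof -
  have y: "trig G (\<lambda>z. c * ephase (y \<bullet> z))" "trig G (\<lambda>z. c * ephase ((- y) \<bullet> z))" for c
    by (rule trig.char; simp add: assms)+
  have "complex_of_real (cos (2 * pi * r)) = 1 / 2 * ephase r + 1 / 2 * ephase (- r)"
    and "complex_of_real (sin (2 * pi * r)) = - \<i> / 2 * ephase r + \<i> / 2 * ephase (- r)" for r
    by (auto simp: ephase_cis complex_eq_iff)
  then show "trig G (\<lambda>z. complex_of_real (cos (2 * pi * (y \<bullet> z))))"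
    and "trig G (\<lambda>z. complex_of_real (sin (2 * pi * (y \<bullet> z))))"
    using trig.add[OF y(1)[of "1/2"] y(2)[of "1/2"]] trig.add[OF y(1)[of "- \<i> / 2"] y(2)[of "\<i> / 2"]]
    by simp_all
qed

text \<open>
  An embedding of the torus into a Euclidean space, where the Stone-Weierstrass theorem for polynomials
  is available: for \<open>w\<close> a dual basis, two points have the same image if and only if they differ by a
  lattice vector, and polynomials in the image are trigonometric polynomials.\<close>

definition torus_map :: "('a \<Rightarrow> 'a) \<Rightarrow> 'a::euclidean_space \<Rightarrow> 'a \<times> 'a" where
  "torus_map w z = (\<Sum>b\<in>Basis. cos (2 * pi * (w b \<bullet> z)) *\<^sub>R b, \<Sum>b\<in>Basis. sin (2 * pi * (w b \<bullet> z)) *\<^sub>R b)"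

lemma continuous_on_torus_map: "continuous_on S (torus_map w)"
  unfolding torus_map_def by (intro continuous_intros)

lemma torus_map_eq_iff:
  "torus_map w z = torus_map w z' \<longleftrightarrow> (\<forall>b\<in>Basis. w b \<bullet> (z - z') \<in> \<int>)"
proof -
  have "torus_map w z = torus_map w z' \<longleftrightarrow> (\<forall>b\<in>Basis. ephase (w b \<bullet> z) = ephase (w b \<bullet> z'))"
    by (auto simp: torus_map_def euclidean_eq_iff[of "sum _ _"] inner_sum_Basis ephase_cis complex_eq_iff)
  also have "\<dots> \<longleftrightarrow> (\<forall>b\<in>Basis. ephase (w b \<bullet> (z - z')) = 1)"
  proof (intro ball_cong refl)
    fix b
    have "ephase (w b \<bullet> z) = ephase (w b \<bullet> (z - z')) * ephase (w b \<bullet> z')"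
      unfolding ephase_add[symmetric] by (simp add: inner_diff_right)
    then show "ephase (w b \<bullet> z) = ephase (w b \<bullet> z') \<longleftrightarrow> ephase (w b \<bullet> (z - z')) = 1" by simp
  qed
  finally show ?thesis by (simp add: ephase_eq_1_iff)
qed

lemma trig_polynomial_torus_map:
  fixes p :: "'a::euclidean_space \<times> 'a \<Rightarrow> real"
  assumes w: "\<And>b l. b \<in> Basis \<Longrightarrow> l \<in> G \<Longrightarrow> w b \<bullet> l \<in> \<int>" and p: "real_polynomial_function p"
  shows "trig G (\<lambda>z. complex_of_real (p (torus_map w z)))"
  using p
proof (induction rule: real_polynomial_function.induct)
  case (linear f)
  interpret bounded_linear f by fact
  have "f (torus_map w z) = (\<Sum>b\<in>Basis. cos (2 * pi * (w b \<bullet> z)) * f (b, 0) + sin (2 * pi * (w b \<bullet> z)) * f (0, b))" for z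
  proof -
    have "torus_map w z = (\<Sum>b\<in>Basis. cos (2 * pi * (w b \<bullet> z)) *\<^sub>R (b, 0) + sin (2 * pi * (w b \<bullet> z)) *\<^sub>R (0, b))"
      by (simp add: torus_map_def sum_prod)
    then show ?thesis by (simp only: sum add scaleR real_scaleR_def)
  qed
  then show ?case
    using w by (auto intro!: trig_sum trig.add trig_mult trig_const trig_cos_sin)
next
  case (add f g)
  then show ?case by (auto intro: trig.add)
next
  case (mult f g)
  then show ?case by (auto intro: trig_mult)
qed (auto intro: trig_const)

lemma continuous_AE_zero:
  fixes h :: "'a::euclidean_space \<Rightarrow> complex"
  assumes h: "continuous_on UNIV h" and ae: "AE z in lborel. h z = 0"
  shows "h z = 0"
proof (rule ccontr)
  assume nz: "h z \<noteq> 0"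
  let ?U = "{z. h z \<noteq> 0}"
  have "open ?U" by (intro open_Collect_neq h continuous_intros)
  moreover have "negligible ?U"
  proof -
    have "?U \<in> null_sets lborel"
      using ae \<open>open ?U\<close> by (subst AE_iff_null_sets) auto
    then show ?thesis
      unfolding negligible_iff_null_sets by (rule null_sets_completionI)
  qed
  ultimately show False using open_not_negligible nz by blast
qed

lemma integrable_indicator_continuous:
  fixes h :: "'a::euclidean_space \<Rightarrow> complex"
  assumes D: "D \<in> sets borel" "emeasure lborel D < \<infinity>" and h: "continuous_on UNIV h" "\<And>z. cmod (h z) \<le> B"
  shows "integrable lborel (\<lambda>z. indicator D z *\<^sub>R h z)"
proof (rule Bochner_Integration.integrable_bound)
  show "integrable lborel (\<lambda>z. B * indicator D z :: real)"
    using D by (intro integrable_mult_right integrable_real_indicator) auto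
  have [measurable]: "h \<in> borel_measurable borel" using h(1) by (rule borel_measurable_continuous_onI)
  show "(\<lambda>z. indicator D z *\<^sub>R h z) \<in> borel_measurable lborel"
    using D(1) by simp
  show "AE z in lborel. norm (indicator D z *\<^sub>R h z) \<le> norm (B * indicator D z :: real)"
    using h(2) by (intro AE_I2) (auto simp: indicator_def intro: order_trans[OF _ abs_ge_self])
qed

text \<open>\<open>\<Phi>\<close> factors through a continuous function on the compact image of \<open>torus_map\<close>, so its conjugate is a
  uniform limit of trigonometric polynomials \<open>q\<close>.  All the integrals of \<open>\<Phi> q\<close> over \<open>D\<close> vanish, hence so
  does that of \<open>\<bar>\<Phi>\<bar>\<^sup>2\<close>.\<close>

theorem fourier_uniqueness:
  fixes G D :: "'a::euclidean_space set" and \<Phi> :: "'a \<Rightarrow> complex"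
  assumes dom: "lattice_domain G D" and span: "span G = UNIV" and finD: "emeasure lborel D < \<infinity>"
    and cont: "continuous_on UNIV \<Phi>" and periodic: "\<And>z l. l \<in> G \<Longrightarrow> \<Phi> (z + l) = \<Phi> z"
    and coeff: "\<And>y. (\<And>l. l \<in> G \<Longrightarrow> y \<bullet> l \<in> \<int>) \<Longrightarrow>
      (LINT z|lborel. indicator D z *\<^sub>R (\<Phi> z * ephase (y \<bullet> z))) = 0"
  shows "\<Phi> z = 0"
proof -
  interpret lattice_domain G D by fact
  obtain w :: "'a \<Rightarrow> 'a" where Geq: "G = {z. \<forall>b\<in>Basis. z \<bullet> w b \<in> \<int>}"
  proof (rule lattice_coordinates_exist[OF subgroup span])
    fix v w :: "'a \<Rightarrow> 'a"
    assume "G = {z. \<forall>b\<in>Basis. z \<bullet> w b \<in> \<int>}"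
    then show thesis by (rule that)
  qed
  let ?P = "torus_map w"
  have fibre: "?P z = ?P z' \<longleftrightarrow> z - z' \<in> G" for z z'
    by (simp add: torus_map_eq_iff Geq inner_commute)
  obtain D0 where D0: "lattice_domain G D0" "bounded D0"
    by (rule lattice_domain_exists[OF subgroup span])
  from D0(2) obtain R where "\<forall>z\<in>D0. norm z \<le> R" by (auto simp: bounded_iff)
  then have R: "D0 \<subseteq> cball 0 R" by auto
  let ?C = "cball (0::'a) R"
  have reduce: "\<exists>z0\<in>?C. z - z0 \<in> G" for z
  proof -
    obtain l where "l \<in> G" "z - l \<in> D0" using lattice_domain.unique[OF D0(1), of z] by blast
    then show ?thesis using R by (intro bexI[of _ "z - l"]) auto
  qed
  have per: "\<Phi> z = \<Phi> z'" if "z - z' \<in> G" for z z'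
    using periodic[OF that, of z'] by simp
  define \<phi> where "\<phi> k = \<Phi> (SOME z. ?P z = k)" for k
  have \<phi>P: "\<phi> (?P z) = \<Phi> z" for z
  proof -
    have "?P (SOME x. ?P x = ?P z) = ?P z" by (rule someI[of _ z]) simp
    then show ?thesis unfolding \<phi>_def fibre by (rule per)
  qed
  have range: "?P z \<in> ?P ` ?C" for z
    using reduce[of z] by (auto simp: fibre[symmetric])
  have K: "compact (?P ` ?C)"
    by (intro compact_continuous_image continuous_on_torus_map compact_cball)
  \<comment> \<open>A quotient map argument: the preimage of a closed set is the image of a compact set.\<close>
  have \<phi>cont: "continuous_on (?P ` ?C) \<phi>"
    unfolding continuous_on_closed_invariant
  proof (intro allI impI)
    fix B :: "complex set" assume "closed B"
    then have "compact (?C \<inter> \<Phi> -` B)"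
      using continuous_closed_vimage[of B \<Phi>] cont
      by (intro compact_Int_closed compact_cball) (auto simp: continuous_on_eq_continuous_at)
    then have "compact (?P ` (?C \<inter> \<Phi> -` B))"
      by (intro compact_continuous_image continuous_on_torus_map)
    then show "\<exists>A. closed A \<and> A \<inter> ?P ` ?C = \<phi> -` B \<inter> ?P ` ?C"
      by (intro exI[of _ "?P ` (?C \<inter> \<Phi> -` B)"]) (auto simp: compact_imp_closed \<phi>P)
  qed
  obtain M where M: "\<And>z. cmod (\<Phi> z) \<le> M"
  proof -
    have "bounded (\<Phi> ` ?C)"
      by (intro compact_imp_bounded compact_continuous_image compact_cball continuous_on_subset[OF cont]) auto
    then obtain M where "\<forall>z\<in>?C. cmod (\<Phi> z) \<le> M" by (auto simp: bounded_iff)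
    then show ?thesis using reduce per that by metis
  qed
  have M0: "0 \<le> M" using M[of 0] norm_ge_zero order_trans by blast
  have trig_int: "integrable lborel (\<lambda>z. indicator D z *\<^sub>R (\<Phi> z * q z))" if "trig G q" for q
  proof -
    from trig_continuous_bounded[OF that] obtain B where q: "continuous_on UNIV q" "\<And>z. cmod (q z) \<le> B" by blast
    have B0: "0 \<le> B" using q(2)[of 0] norm_ge_zero order_trans by blast
    have "cmod (\<Phi> z * q z) \<le> M * B" for z
      unfolding norm_mult by (intro mult_mono M q M0) simp
    then show ?thesis
      by (intro integrable_indicator_continuous[OF D finD] continuous_on_mult cont q)
  qed
  have trig_zero: "(LINT z|lborel. indicator D z *\<^sub>R (\<Phi> z * q z)) = 0" if "trig G q" for q
    using that
  proof (induction rule: trig.induct)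
    case (char y c)
    have "(LINT z|lborel. indicator D z *\<^sub>R (\<Phi> z * (c * ephase (y \<bullet> z)))) =
        (LINT z|lborel. c * (indicator D z *\<^sub>R (\<Phi> z * ephase (y \<bullet> z))))"
      by (simp add: mult_ac scaleR_conv_of_real)
    also have "\<dots> = c * (LINT z|lborel. indicator D z *\<^sub>R (\<Phi> z * ephase (y \<bullet> z)))"
      by (rule integral_mult_right_zero)
    finally show ?case using coeff[OF char] by simp
  next
    case (add p q)
    then show ?case using trig_int by (simp add: distrib_left scaleR_add_right)
  qed
  define N where "N = (LINT z|lborel. indicator D z *\<^sub>R (\<Phi> z * cnj (\<Phi> z)))"
  have Nint: "integrable lborel (\<lambda>z. indicator D z *\<^sub>R (\<Phi> z * cnj (\<Phi> z)))"
    by (rule integrable_indicator_continuous[OF D finD, of _ "M * M"])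
       (auto intro!: continuous_intros cont mult_mono M M0 simp: norm_mult)
  have small: "cmod N \<le> e * (M * measure lborel D)" if e: "0 < e" for e
  proof -
    have "continuous_on (?P ` ?C) (\<lambda>k. cnj (\<phi> k))"
      using \<phi>cont by (rule continuous_on_cnj)
    from Stone_Weierstrass_polynomial_function[OF K this e] obtain g
      where g: "polynomial_function g" "\<forall>k\<in>?P ` ?C. norm (cnj (\<phi> k) - g k) < e" by blast
    have "real_polynomial_function (Re \<circ> g)" "real_polynomial_function (Im \<circ> g)"
      using g(1) bounded_linear_Re bounded_linear_Im by (auto simp: polynomial_function_def)
    then have "trig G (\<lambda>z. complex_of_real ((Re \<circ> g) (?P z)))" "trig G (\<lambda>z. complex_of_real ((Im \<circ> g) (?P z)))"
      by (auto intro!: trig_polynomial_torus_map simp del: o_apply simp: Geq inner_commute)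
    from trig.add[OF this(1) trig_mult[OF trig_const[of G \<i>] this(2)]]
    have q: "trig G (\<lambda>z. g (?P z))"
      by (simp add: complex_eq_iff[of "_ + _"] flip: complex_eq)
    have close: "cmod (cnj (\<Phi> z) - g (?P z)) \<le> e" for z
      using g(2) range[of z] \<phi>P[of z] by (metis less_imp_le)
    have "N = N - (LINT z|lborel. indicator D z *\<^sub>R (\<Phi> z * g (?P z)))"
      using trig_zero[OF q] by simp
    also have "\<dots> = (LINT z|lborel. indicator D z *\<^sub>R (\<Phi> z * cnj (\<Phi> z)) - indicator D z *\<^sub>R (\<Phi> z * g (?P z)))"
      unfolding N_def by (rule Bochner_Integration.integral_diff[OF Nint trig_int[OF q], symmetric])
    finally have Neq: "N = (LINT z|lborel. indicator D z *\<^sub>R (\<Phi> z * cnj (\<Phi> z)) - indicator D z *\<^sub>R (\<Phi> z * g (?P z)))" .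
    have "cmod N \<le> (LINT z|lborel. cmod (indicator D z *\<^sub>R (\<Phi> z * cnj (\<Phi> z)) - indicator D z *\<^sub>R (\<Phi> z * g (?P z))))"
      by (subst Neq) (rule integral_norm_bound)
    also have "\<dots> \<le> (LINT z|lborel. (M * e) * indicator D z)"
    proof (rule integral_mono')
      show "integrable lborel (\<lambda>z. (M * e) * indicator D z :: real)"
        using D finD by (intro integrable_mult_right integrable_real_indicator) auto
      fix z
      have "cmod (\<Phi> z * cnj (\<Phi> z) - \<Phi> z * g (?P z)) \<le> M * e"
        unfolding right_diff_distrib[symmetric] norm_mult by (intro mult_mono M close M0) simp
      then show "cmod (indicator D z *\<^sub>R (\<Phi> z * cnj (\<Phi> z)) - indicator D z *\<^sub>R (\<Phi> z * g (?P z))) \<le> (M * e) * indicator D z"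
        by (simp add: indicator_def)
    qed (use M0 e in \<open>auto simp: indicator_def\<close>)
    also have "\<dots> = e * (M * measure lborel D)" using D by (simp add: mult_ac)
    finally show ?thesis .
  qed
  have "cmod N \<le> 0"
  proof (rule field_le_epsilon)
    fix d :: real assume d: "0 < d"
    \<comment> \<open>The summand \<open>1\<close> in \<open>X + 1\<close> guards against \<open>X = 0\<close>.\<close>
    define X where "X = M * measure lborel D"
    have X: "0 \<le> X" unfolding X_def using M0 by simp
    have "cmod N \<le> d / (X + 1) * X"
      using small[of "d / (X + 1)"] d X by (simp add: X_def)
    also have "\<dots> \<le> d" using d X by (simp add: field_simps)
    finally show "cmod N \<le> 0 + d" by simp
  qed
  then have N0: "N = 0" by simp
  have Nr: "indicator D z *\<^sub>R (\<Phi> z * cnj (\<Phi> z)) = complex_of_real (indicator D z * (cmod (\<Phi> z))\<^sup>2)" for z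
    by (simp add: complex_norm_square scaleR_conv_of_real del: of_real_power)
  have "integrable lborel (\<lambda>z. indicator D z * (cmod (\<Phi> z))\<^sup>2)"
    using Nint unfolding Nr complex_of_real_integrable_eq .
  moreover have "(LINT z|lborel. indicator D z * (cmod (\<Phi> z))\<^sup>2) = 0"
    using N0 unfolding N_def Nr integral_complex_of_real by (simp only: of_real_eq_0_iff)
  ultimately have ae: "AE z in lborel. indicator D z * (cmod (\<Phi> z))\<^sup>2 = 0"
    by (subst (asm) integral_nonneg_eq_0_iff_AE) auto
  have [measurable]: "\<Phi> \<in> borel_measurable borel" using cont by (rule borel_measurable_continuous_onI)
  have "(\<integral>\<^sup>+z. ennreal ((cmod (\<Phi> z))\<^sup>2) \<partial>lborel) =
      (\<integral>\<^sup>+z. (\<integral>\<^sup>+l. ennreal ((cmod (\<Phi> (z + l)))\<^sup>2) * indicator D z \<partial>count_space G) \<partial>lborel)"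
    by (rule nn_integral_periodisation[symmetric]) measurable
  also have "\<dots> = (\<integral>\<^sup>+(z::'a). 0 \<partial>lborel)"
    using ae
  proof (intro nn_integral_cong_AE, eventually_elim)
    case (elim z)
    have "(\<integral>\<^sup>+l. ennreal ((cmod (\<Phi> (z + l)))\<^sup>2) * indicator D z \<partial>count_space G) = (\<integral>\<^sup>+l. 0 \<partial>count_space G)"
      using elim by (intro nn_integral_cong) (auto simp: periodic indicator_def split: if_splits)
    then show ?case by simp
  qed
  finally have "(\<integral>\<^sup>+z. ennreal ((cmod (\<Phi> z))\<^sup>2) \<partial>lborel) = 0" by simp
  then have "AE z in lborel. ennreal ((cmod (\<Phi> z))\<^sup>2) = 0"
    by (subst (asm) nn_integral_0_iff_AE) auto
  then have "AE z in lborel. \<Phi> z = 0" by simp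
  then show ?thesis by (rule continuous_AE_zero[OF cont])
qed

text \<open>
  Translation by half a period \<open>a\<close> changes the sign of the character, but not its integral over the
  torus.  The translated domain is brought back to \<open>D\<close> by periodising the function \<open>F\<close>.\<close>

lemma integral_character_zero:
  fixes G D :: "'a::euclidean_space set"
  assumes dom: "lattice_domain G D" and y: "\<And>l. l \<in> G \<Longrightarrow> y \<bullet> l \<in> \<int>" and y0: "y \<noteq> 0"
    and finD: "emeasure lborel D < \<infinity>"
  shows "(LINT z|lborel. indicator D z *\<^sub>R ephase (y \<bullet> z)) = 0"
proof -
  interpret lattice_domain G D by fact
  have per: "ephase (y \<bullet> (z + l)) = ephase (y \<bullet> z)" if "l \<in> G" for z l
  proof -
    have "ephase (y \<bullet> l) = 1" using y[OF that] by (simp add: ephase_eq_1_iff)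
    then show ?thesis by (simp add: inner_add_right ephase_add)
  qed
  let ?I = "LINT z|lborel. indicator D z *\<^sub>R ephase (y \<bullet> z)"
  \<comment> \<open>Chosen so that \<open>y \<bullet> a = 1/2\<close>.\<close>
  define a where "a = (1 / (2 * (y \<bullet> y))) *\<^sub>R y"
  have ya: "ephase (y \<bullet> a) = -1" using y0 by (simp add: a_def ephase_cis)
  define F where "F z = indicator D (z + a) *\<^sub>R ephase (y \<bullet> z)" for z
  have Dint: "integrable lborel (\<lambda>z. indicator D z *\<^sub>R ephase (y \<bullet> z))"
    by (rule integrable_indicator_continuous[OF D finD, of _ 1]) (auto intro!: continuous_intros)
  have Feq: "F z = - (indicator D (z + a) *\<^sub>R ephase (y \<bullet> (z + a)))" for z
    by (simp add: F_def inner_add_right ephase_add ya)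
  have Fint: "integrable lborel F"
    unfolding Feq[abs_def]
    using lborel_integrable_translate[of "\<lambda>z. indicator D z *\<^sub>R ephase (y \<bullet> z)" a] Dint by simp
  have FI: "(LINT z|lborel. F z) = - ?I"
    unfolding Feq using lborel_integral_translate[of "\<lambda>z. indicator D z *\<^sub>R ephase (y \<bullet> z)" a] by simp
  have inner: "(LINT l|count_space G. indicator D z *\<^sub>R F (z + l)) = indicator D z *\<^sub>R ephase (y \<bullet> z)" for z
  proof -
    have bij: "bij_betw uminus G G"
      by (rule bij_betwI[of _ _ _ uminus]) (auto intro: uminus_G)
    have "(LINT l|count_space G. indicator D z *\<^sub>R F (z + l)) =
        (LINT l|count_space G. indicator D ((z + a) + l) *\<^sub>R (indicator D z *\<^sub>R ephase (y \<bullet> z)))"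
    proof (rule Bochner_Integration.integral_cong[OF refl])
      fix l assume "l \<in> space (count_space G)"
      then have l: "l \<in> G" by simp
      have "z + l + a = z + a + l" by simp
      then show "indicator D z *\<^sub>R F (z + l) = indicator D ((z + a) + l) *\<^sub>R (indicator D z *\<^sub>R ephase (y \<bullet> z))"
        unfolding F_def per[OF l] \<open>z + l + a = z + a + l\<close> by (simp only: scaleR_scaleR mult_ac)
    qed
    also have "\<dots> = (LINT l|count_space G. indicator D ((z + a) - l) *\<^sub>R (indicator D z *\<^sub>R ephase (y \<bullet> z)))"
      using integral_bij_count_space[OF bij, of "\<lambda>l. indicator D ((z + a) + l) *\<^sub>R (indicator D z *\<^sub>R ephase (y \<bullet> z))"] by simp
    finally show ?thesis by (simp only: sum_translates)
  qed
  have "?I = - ?I"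
    using integral_periodisation[OF Fint] by (simp only: inner FI)
  then show ?thesis by (simp add: eq_neg_iff_add_eq_0 flip: mult_2)
qed

section \<open>Absolutely summable families\<close>

lemma countable_exhaustion:
  assumes "countable A"
  obtains E :: "nat \<Rightarrow> 'a set" where "\<And>n. finite (E n)" "\<And>n. E n \<subseteq> A"
    "\<And>x n. x \<in> A \<Longrightarrow> \<forall>\<^sub>F n in sequentially. x \<in> E n"
proof
  let ?E = "\<lambda>n. {x \<in> A. to_nat_on A x \<le> n}"
  show "finite (?E n)" for n
  proof (rule finite_imageD)
    show "finite (to_nat_on A ` ?E n)" by (rule finite_subset[of _ "{..n}"]) auto
    show "inj_on (to_nat_on A) (?E n)"
      using inj_on_to_nat_on[OF assms] by (rule inj_on_subset) auto
  qed
  show "\<forall>\<^sub>F n in sequentially. x \<in> ?E n" if "x \<in> A" for x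
    using eventually_ge_at_top[of "to_nat_on A x"] that by (auto elim: eventually_mono)
qed auto

text \<open>Integrals over counting measure allow Fubini's theorem for sums over the lattice; unconditional
  convergence of series is expressed by \<open>has_sum\<close>.  Boundedness of the finite absolute sums gives both.\<close>

lemma integrable_count_space_of_bounded_sums:
  fixes a :: "'i \<Rightarrow> complex"
  assumes A: "countable A" and B: "\<And>S. finite S \<Longrightarrow> S \<subseteq> A \<Longrightarrow> (\<Sum>l\<in>S. cmod (a l)) \<le> B"
  shows "integrable (count_space A) a"
proof (rule integrableI_bounded)
  obtain E :: "nat \<Rightarrow> 'i set" where E: "\<And>n. finite (E n)" "\<And>n. E n \<subseteq> A"
    and ev: "\<And>x. x \<in> A \<Longrightarrow> \<forall>\<^sub>F n in sequentially. x \<in> E n"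
    using countable_exhaustion[OF A] by metis
  have "(\<integral>\<^sup>+l. ennreal (cmod (a l)) \<partial>count_space A) =
      (\<integral>\<^sup>+l. liminf (\<lambda>n. ennreal (cmod (a l)) * indicator (E n) l) \<partial>count_space A)"
  proof (rule nn_integral_cong)
    fix l assume "l \<in> space (count_space A)"
    then have "(\<lambda>n. ennreal (cmod (a l)) * indicator (E n) l) \<longlonglongrightarrow> ennreal (cmod (a l))"
      using ev[of l] by (intro tendsto_eventually) (auto elim!: eventually_mono)
    then show "ennreal (cmod (a l)) = liminf (\<lambda>n. ennreal (cmod (a l)) * indicator (E n) l)"
      by (intro lim_imp_Liminf[symmetric]) simp_all
  qed
  also have "\<dots> \<le> liminf (\<lambda>n. \<integral>\<^sup>+l. ennreal (cmod (a l)) * indicator (E n) l \<partial>count_space A)"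
    by (rule nn_integral_liminf) simp
  also have "\<dots> \<le> liminf (\<lambda>n. ennreal B)"
  proof (intro Liminf_mono always_eventually allI)
    fix n
    have "(\<integral>\<^sup>+l. ennreal (cmod (a l)) * indicator (E n) l \<partial>count_space A) =
        (\<integral>\<^sup>+l. ennreal (cmod (a l)) * indicator (E n) l \<partial>count_space UNIV)"
      using E(2)[of n] by (subst nn_integral_count_space_indicator) (auto intro!: nn_integral_cong simp: indicator_def)
    also have "\<dots> = (\<integral>\<^sup>+l. ennreal (cmod (a l)) \<partial>count_space (E n))"
      by (rule nn_integral_count_space_indicator[symmetric]) simp
    also have "\<dots> = ennreal (\<Sum>l\<in>E n. cmod (a l))"
      using E(1) by (simp add: nn_integral_count_space_finite)
    also have "\<dots> \<le> ennreal B" by (intro ennreal_leI B E)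
    finally show "(\<integral>\<^sup>+l. ennreal (cmod (a l)) * indicator (E n) l \<partial>count_space A) \<le> ennreal B" .
  qed
  also have "\<dots> < \<infinity>" by (simp add: Liminf_const)
  finally show "(\<integral>\<^sup>+l. ennreal (cmod (a l)) \<partial>count_space A) < \<infinity>" .
qed simp

lemma integrable_count_space_has_sum:
  fixes a :: "'i \<Rightarrow> complex"
  assumes A: "countable A" and a: "integrable (count_space A) a"
  shows "(a has_sum (LINT l|count_space A. a l)) A"
proof -
  have fin: "(LINT l|count_space A. indicator S l *\<^sub>R b l) = (\<Sum>l\<in>S. b l)"
    if "finite S" "S \<subseteq> A" for S and b :: "'i \<Rightarrow> 'z::{banach, second_countable_topology}"
  proof -
    have "{l \<in> A. indicator S l *\<^sub>R b l \<noteq> 0} \<subseteq> S" by (auto simp: indicator_def)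
    then have "finite {l \<in> A. indicator S l *\<^sub>R b l \<noteq> 0}" using that(1) finite_subset by blast
    from lebesgue_integral_count_space_finite_support[OF this] show ?thesis
      using that by (simp only:) (intro sum.mono_neutral_cong_left, auto simp: indicator_def)
  qed
  have "(\<lambda>l. norm (a l)) summable_on A"
  proof (rule nonneg_bdd_above_summable_on)
    show "bdd_above (sum (\<lambda>l. norm (a l)) ` {F. F \<subseteq> A \<and> finite F})"
    proof (rule bdd_aboveI2)
      fix S assume S: "S \<in> {F. F \<subseteq> A \<and> finite F}"
      have "(\<Sum>l\<in>S. norm (a l)) = (LINT l|count_space A. indicator S l *\<^sub>R norm (a l))"
        using S fin[of S "\<lambda>l. norm (a l)"] by simp
      also have "\<dots> \<le> (LINT l|count_space A. norm (a l))"
        using a by (intro integral_mono integrable_norm Bochner_Integration.integrable_bound[OF integrable_norm[OF a]])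
          (auto simp: indicator_def AE_count_space)
      finally show "(\<Sum>l\<in>S. norm (a l)) \<le> (LINT l|count_space A. norm (a l))" .
    qed
  qed simp
  then have "a summable_on A" by (rule abs_summable_summable)
  then have s: "(a has_sum infsum a A) A" by simp
  obtain E :: "nat \<Rightarrow> 'i set" where E: "\<And>n. finite (E n)" "\<And>n. E n \<subseteq> A"
    and ev: "\<And>x. x \<in> A \<Longrightarrow> \<forall>\<^sub>F n in sequentially. x \<in> E n"
    using countable_exhaustion[OF A] by metis
  have "filterlim E (finite_subsets_at_top A) sequentially"
    unfolding filterlim_finite_subsets_at_top
  proof (intro allI impI)
    fix X assume X: "finite X \<and> X \<subseteq> A"
    then have "\<forall>\<^sub>F n in sequentially. \<forall>x\<in>X. x \<in> E n"
      using ev by (intro eventually_ball_finite) auto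
    then show "\<forall>\<^sub>F n in sequentially. finite (E n) \<and> X \<subseteq> E n \<and> E n \<subseteq> A"
      using E by (auto elim!: eventually_mono)
  qed
  from filterlim_compose[OF s[unfolded has_sum_def] this]
  have 1: "(\<lambda>n. \<Sum>l\<in>E n. a l) \<longlonglongrightarrow> infsum a A" .
  have "(\<lambda>n. LINT l|count_space A. indicator (E n) l *\<^sub>R a l) \<longlonglongrightarrow> (LINT l|count_space A. a l)"
  proof (rule integral_dominated_convergence[where w = "\<lambda>l. norm (a l)"])
    show "AE l in count_space A. (\<lambda>n. indicator (E n) l *\<^sub>R a l) \<longlonglongrightarrow> a l"
      unfolding AE_count_space
    proof
      fix l assume "l \<in> A"
      then show "(\<lambda>n. indicator (E n) l *\<^sub>R a l) \<longlonglongrightarrow> a l"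
        using ev[of l] by (intro tendsto_eventually) (auto elim!: eventually_mono)
    qed
  qed (use a in \<open>auto simp: AE_count_space indicator_def\<close>)
  then have 2: "(\<lambda>n. \<Sum>l\<in>E n. a l) \<longlonglongrightarrow> (LINT l|count_space A. a l)"
    using E by (simp add: fin)
  show ?thesis using s LIMSEQ_unique[OF 1 2] by simp
qed

lemma has_sum_norm_le:
  fixes a :: "'i \<Rightarrow> complex"
  assumes "(a has_sum s) A" "\<And>S. finite S \<Longrightarrow> S \<subseteq> A \<Longrightarrow> cmod (\<Sum>l\<in>S. a l) \<le> B"
  shows "cmod s \<le> B"
proof (rule tendsto_upperbound)
  show "((\<lambda>S. cmod (\<Sum>l\<in>S. a l)) \<longlongrightarrow> cmod s) (finite_subsets_at_top A)"
    using assms(1) unfolding has_sum_def by (rule tendsto_norm)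
  show "\<forall>\<^sub>F S in finite_subsets_at_top A. cmod (\<Sum>l\<in>S. a l) \<le> B"
    using assms(2) by (rule eventually_finite_subsets_at_top_weakI)
qed (rule finite_subsets_at_top_neq_bot)

section \<open>The adjoint lattice\<close>

text \<open>
  The symplectic form of \<open>Y\<close> and \<open>z\<close> is \<open>symplectic Y \<bullet> z\<close>; it measures the failure of the shifts to commute
  and identifies the adjoint lattice with the dual lattice.\<close>

definition symplectic :: "(real ^ 'd) \<times> (real ^ 'd) \<Rightarrow> (real ^ 'd) \<times> (real ^ 'd)" where
  "symplectic Y = (- snd Y, fst Y)"

lemma symplectic_0_iff [simp]: "symplectic Y = 0 \<longleftrightarrow> Y = 0"
  by (auto simp: symplectic_def prod_eq_iff)

lemma symplectic_surj: "\<exists>Y. symplectic Y = y"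
  by (rule exI[of _ "(snd y, - fst y)"]) (simp add: symplectic_def)

lemma tf_shift_commute:
  "tf_shift z (tf_shift Y f) = (\<lambda>t. ephase (symplectic Y \<bullet> z) * tf_shift Y (tf_shift z f) t)"
proof (rule ext)
  fix t
  have "symplectic Y \<bullet> z + - (snd z \<bullet> fst Y) = - (snd Y \<bullet> fst z)"
    by (simp add: symplectic_def inner_prod_def inner_commute)
  then have "ephase (- (snd Y \<bullet> fst z)) = ephase (symplectic Y \<bullet> z) * ephase (- (snd z \<bullet> fst Y))"
    by (simp only: ephase_add[symmetric])
  then show "tf_shift z (tf_shift Y f) t = ephase (symplectic Y \<bullet> z) * tf_shift Y (tf_shift z f) t"
    by (simp add: tf_shift_compose add.commute)
qed

text \<open>The Gaussian vanishes nowhere, so testing the commutation relation on it alone forces the phase to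
  be one.\<close>

lemma adjoint_lattice_eq:
  fixes \<Lambda> :: "((real ^ 'd) \<times> (real ^ 'd)) set"
  shows "adjoint_lattice \<Lambda> = {Y. \<forall>l\<in>\<Lambda>. symplectic Y \<bullet> l \<in> \<int>}"
proof (intro equalityI subsetI CollectI ballI)
  fix Y l assume Y: "Y \<in> adjoint_lattice \<Lambda>" and l: "l \<in> \<Lambda>"
  have "AE t in lborel. tf_shift l (tf_shift Y gauss) t = tf_shift Y (tf_shift l gauss) t"
    using Y l gauss_L2 by (auto simp: adjoint_lattice_def l2_eq_def)
  moreover have "tf_shift Y (tf_shift l gauss) t \<noteq> 0" for t
    by (simp add: tf_shift_eq gauss_def)
  ultimately have "AE t :: real ^ 'd in lborel. ephase (symplectic Y \<bullet> l) - 1 = 0"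
    by (simp add: tf_shift_commute[of l])
  then have "ephase (symplectic Y \<bullet> l) - 1 = 0"
    by (rule continuous_AE_zero[OF continuous_on_const])
  then show "symplectic Y \<bullet> l \<in> \<int>" by (simp add: ephase_eq_1_iff)
next
  fix Y assume Y: "Y \<in> {Y. \<forall>l\<in>\<Lambda>. symplectic Y \<bullet> l \<in> \<int>}"
  have "l2_eq (tf_shift l (tf_shift Y f)) (tf_shift Y (tf_shift l f))" if "l \<in> \<Lambda>" for l f
  proof -
    have "ephase (symplectic Y \<bullet> l) = 1" using Y that by (simp add: ephase_eq_1_iff)
    then show ?thesis by (simp add: l2_eq_def tf_shift_commute[of l])
  qed
  then show "Y \<in> adjoint_lattice \<Lambda>" by (simp add: adjoint_lattice_def)
qed

section \<open>The sesquilinear form of the frame operator\<close>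

definition gabor_term ::
    "(real ^ 'd \<Rightarrow> complex) \<Rightarrow> (real ^ 'd \<Rightarrow> complex) \<Rightarrow> (real ^ 'd \<Rightarrow> complex) \<Rightarrow> (real ^ 'd \<Rightarrow> complex) \<Rightarrow>
     (real ^ 'd) \<times> (real ^ 'd) \<Rightarrow> complex" where
  "gabor_term g \<gamma> f h z = l2_inner f (tf_shift z \<gamma>) * l2_inner (tf_shift z g) h"

text \<open>The phases from composing the shifts and from passing to the adjoint occur once with each sign,
  because the term is linear in one factor and conjugate-linear in the other.\<close>

lemma gabor_term_translate:
  "gabor_term g \<gamma> f h (z + l) = gabor_term g \<gamma> (tf_shift (- z) f) (tf_shift (- z) h) l"
proof -
  define c where "c = snd l \<bullet> fst z"
  define e where "e = fst z \<bullet> snd z"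
  have shift: "tf_shift (z + l) u = (\<lambda>t. ephase c * tf_shift z (tf_shift l u) t)" for u
    by (simp add: tf_shift_compose c_def flip: mult.assoc)
  have f: "l2_inner f (tf_shift (z + l) \<gamma>) = ephase (- c) * (ephase (- e) * l2_inner (tf_shift (- z) f) (tf_shift l \<gamma>))"
    unfolding shift l2_inner_scale_right cnj_ephase e_def by (simp add: l2_inner_tf_shift_adjoint[of f z])
  have "l2_inner (tf_shift (z + l) g) h = cnj (l2_inner h (tf_shift (z + l) g))"
    by (simp add: l2_inner_cnj)
  also have "\<dots> = cnj (ephase (- c) * (ephase (- e) * l2_inner (tf_shift (- z) h) (tf_shift l g)))"
    unfolding shift l2_inner_scale_right cnj_ephase e_def by (simp add: l2_inner_tf_shift_adjoint[of h z])
  also have "\<dots> = ephase c * (ephase e * l2_inner (tf_shift l g) (tf_shift (- z) h))"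
    by (simp add: cnj_ephase l2_inner_cnj)
  finally have h: "l2_inner (tf_shift (z + l) g) h = ephase c * (ephase e * l2_inner (tf_shift l g) (tf_shift (- z) h))" .
  have "gabor_term g \<gamma> f h (z + l) = (ephase c * ephase (- c)) * (ephase e * ephase (- e)) *
      gabor_term g \<gamma> (tf_shift (- z) f) (tf_shift (- z) h) l"
    unfolding gabor_term_def f h by (simp only: mult_ac)
  then show ?thesis by simp
qed

lemma gabor_term_character:
  "ephase (symplectic Y \<bullet> z) * gabor_term g \<gamma> f h z =
    l2_inner f (tf_shift z \<gamma>) * l2_inner (tf_shift z (tf_shift Y g)) (tf_shift Y h)"
  unfolding gabor_term_def tf_shift_commute[of z Y g] l2_inner_scale_left l2_inner_tf_shift
  by (simp only: mult_ac)

locale gabor_system =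
  fixes \<Lambda> D :: "((real ^ 'd) \<times> (real ^ 'd)) set" and g \<gamma> :: "real ^ 'd \<Rightarrow> complex" and Cg C\<gamma> :: real
  assumes dom: "lattice_domain \<Lambda> D" and spanning: "span \<Lambda> = UNIV" and finite_D: "emeasure lborel D < \<infinity>"
    and g: "g \<in> L2" and \<gamma>: "\<gamma> \<in> L2" and bessel_g: "bessel \<Lambda> g Cg" and bessel_\<gamma>: "bessel \<Lambda> \<gamma> C\<gamma>"
begin

sublocale lattice_domain \<Lambda> D by (rule dom)

lemma sum_gabor_term_le:
  assumes f: "f \<in> L2" and h: "h \<in> L2" and S: "finite S" "S \<subseteq> \<Lambda>"
  shows "(\<Sum>l\<in>S. cmod (gabor_term g \<gamma> f h l)) \<le>
    sqrt (\<Sum>l\<in>S. (cmod (l2_inner f (tf_shift l \<gamma>)))\<^sup>2) * (sqrt Cg * l2_norm h)"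
proof -
  have "(\<Sum>l\<in>S. cmod (gabor_term g \<gamma> f h l)) =
      (\<Sum>l\<in>S. \<bar>cmod (l2_inner f (tf_shift l \<gamma>))\<bar> * \<bar>cmod (l2_inner h (tf_shift l g))\<bar>)"
    by (simp add: gabor_term_def norm_mult l2_inner_cnj[of h, symmetric])
  also have "\<dots> \<le> L2_set (\<lambda>l. cmod (l2_inner f (tf_shift l \<gamma>))) S * L2_set (\<lambda>l. cmod (l2_inner h (tf_shift l g))) S"
    by (rule L2_set_mult_ineq)
  also have "\<dots> \<le> sqrt (\<Sum>l\<in>S. (cmod (l2_inner f (tf_shift l \<gamma>)))\<^sup>2) * sqrt (Cg * (l2_norm h)\<^sup>2)"
    unfolding L2_set_def using bessel_g h S
    by (intro mult_left_mono real_sqrt_le_mono) (auto simp: bessel_def sum_nonneg)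
  finally show ?thesis by (simp add: real_sqrt_mult)
qed

lemma sum_gabor_term_le':
  assumes f: "f \<in> L2" and h: "h \<in> L2" and S: "finite S" "S \<subseteq> \<Lambda>"
  shows "(\<Sum>l\<in>S. cmod (gabor_term g \<gamma> f h l)) \<le> sqrt C\<gamma> * sqrt Cg * l2_norm f * l2_norm h"
proof -
  have "sqrt (\<Sum>l\<in>S. (cmod (l2_inner f (tf_shift l \<gamma>)))\<^sup>2) \<le> sqrt (C\<gamma> * (l2_norm f)\<^sup>2)"
    using bessel_\<gamma> f S by (intro real_sqrt_le_mono) (auto simp: bessel_def)
  moreover have "0 \<le> sqrt Cg * l2_norm h" using bessel_g by (simp add: bessel_def)
  ultimately have "sqrt (\<Sum>l\<in>S. (cmod (l2_inner f (tf_shift l \<gamma>)))\<^sup>2) * (sqrt Cg * l2_norm h)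
      \<le> sqrt (C\<gamma> * (l2_norm f)\<^sup>2) * (sqrt Cg * l2_norm h)"
    by (rule mult_right_mono)
  with sum_gabor_term_le[OF assms] show ?thesis by (simp add: real_sqrt_mult mult_ac)
qed

lemma integrable_gabor_term:
  assumes "f \<in> L2" "h \<in> L2"
  shows "integrable (count_space \<Lambda>) (gabor_term g \<gamma> f h)"
  by (rule integrable_count_space_of_bounded_sums[OF countable_G sum_gabor_term_le'[OF assms]])

definition form :: "(real ^ 'd \<Rightarrow> complex) \<Rightarrow> (real ^ 'd \<Rightarrow> complex) \<Rightarrow> complex" where
  "form f h = (LINT l|count_space \<Lambda>. gabor_term g \<gamma> f h l)"

lemma form_has_sum:
  assumes "f \<in> L2" "h \<in> L2"
  shows "(gabor_term g \<gamma> f h has_sum form f h) \<Lambda>"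
  unfolding form_def by (rule integrable_count_space_has_sum[OF countable_G integrable_gabor_term[OF assms]])

lemma form_bound:
  assumes "f \<in> L2" "h \<in> L2"
  shows "cmod (form f h) \<le> sqrt C\<gamma> * sqrt Cg * l2_norm f * l2_norm h"
  by (rule has_sum_norm_le[OF form_has_sum[OF assms]])
     (rule order_trans[OF norm_sum sum_gabor_term_le'[OF assms]])

lemma form_diff_left:
  assumes "f \<in> L2" "f' \<in> L2" "h \<in> L2"
  shows "form (\<lambda>t. f t - f' t) h = form f h - form f' h"
proof -
  have "gabor_term g \<gamma> (\<lambda>t. f t - f' t) h l = gabor_term g \<gamma> f h l - gabor_term g \<gamma> f' h l" for l
    by (simp add: gabor_term_def l2_inner_diff_left assms tf_shift_L2 \<gamma> left_diff_distrib)
  then show ?thesis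
    by (simp add: form_def integrable_gabor_term assms)
qed

lemma form_diff_right:
  assumes "f \<in> L2" "h' \<in> L2" "h \<in> L2"
  shows "form f (\<lambda>t. h t - h' t) = form f h - form f h'"
proof -
  have "gabor_term g \<gamma> f (\<lambda>t. h t - h' t) l = gabor_term g \<gamma> f h l - gabor_term g \<gamma> f h' l" for l
    by (simp add: gabor_term_def l2_inner_diff_right assms tf_shift_L2 g right_diff_distrib)
  then show ?thesis
    by (simp add: form_def integrable_gabor_term assms)
qed

definition periodisation :: "(real ^ 'd \<Rightarrow> complex) \<Rightarrow> (real ^ 'd \<Rightarrow> complex) \<Rightarrow> (real ^ 'd) \<times> (real ^ 'd) \<Rightarrow> complex" where
  "periodisation f h z = form (tf_shift (- z) f) (tf_shift (- z) h)"

lemma periodisation_eq: "periodisation f h z = (LINT l|count_space \<Lambda>. gabor_term g \<gamma> f h (z + l))"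
  by (simp add: periodisation_def form_def gabor_term_translate)

lemma periodisation_periodic:
  assumes "m \<in> \<Lambda>"
  shows "periodisation f h (z + m) = periodisation f h z"
proof -
  have "bij_betw ((+) m) \<Lambda> \<Lambda>"
    by (rule bij_betwI[of _ _ _ "\<lambda>l. l - m"])
       (use assms subgroup discrete_subgroup_diff[OF subgroup] in \<open>auto simp: discrete_subgroup_def\<close>)
  from integral_bij_count_space[OF this, of "\<lambda>l. gabor_term g \<gamma> f h (z + l)"]
  show ?thesis by (simp add: periodisation_eq add.assoc)
qed

text \<open>The form is bounded and the shifts are strongly continuous.\<close>

lemma continuous_periodisation:
  assumes f: "f \<in> L2" and h: "h \<in> L2"
  shows "continuous_on UNIV (periodisation f h)"
proof -
  define K where "K = sqrt C\<gamma> * sqrt Cg"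
  have "(\<lambda>n. periodisation f h (Z n)) \<longlonglongrightarrow> periodisation f h z" if Z: "Z \<longlonglongrightarrow> z" for Z z
  proof -
    let ?u = "\<lambda>u z. tf_shift (- z) u"
    have "(\<lambda>n. - Z n) \<longlonglongrightarrow> - z" using Z by (rule tendsto_minus)
    note lim = tf_shift_strongly_continuous[OF _ this]
    have "(\<lambda>n. periodisation f h (Z n) - periodisation f h z) \<longlonglongrightarrow> 0"
    proof (rule Lim_null_comparison)
      have "periodisation f h (Z n) - periodisation f h z =
          form (\<lambda>t. ?u f (Z n) t - ?u f z t) (?u h (Z n)) + form (?u f z) (\<lambda>t. ?u h (Z n) t - ?u h z t)" for n
        by (simp add: periodisation_def form_diff_left form_diff_right f h tf_shift_L2)
      then show "\<forall>\<^sub>F n in sequentially. cmod (periodisation f h (Z n) - periodisation f h z) \<le>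
          K * l2_norm (\<lambda>t. ?u f (Z n) t - ?u f z t) * l2_norm h + K * l2_norm f * l2_norm (\<lambda>t. ?u h (Z n) t - ?u h z t)"
        using form_bound[OF L2_diff[OF tf_shift_L2[OF f] tf_shift_L2[OF f]] tf_shift_L2[OF h]]
          form_bound[OF tf_shift_L2[OF f] L2_diff[OF tf_shift_L2[OF h] tf_shift_L2[OF h]]]
        unfolding l2_norm_tf_shift K_def[symmetric]
        by (intro always_eventually allI) (simp only:, rule order_trans[OF norm_triangle_ineq add_mono], auto)
      have "(\<lambda>n. K * l2_norm (\<lambda>t. ?u f (Z n) t - ?u f z t) * l2_norm h + K * l2_norm f * l2_norm (\<lambda>t. ?u h (Z n) t - ?u h z t))
          \<longlonglongrightarrow> K * 0 * l2_norm h + K * l2_norm f * 0"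
        by (intro tendsto_intros lim f h)
      then show "(\<lambda>n. K * l2_norm (\<lambda>t. ?u f (Z n) t - ?u f z t) * l2_norm h + K * l2_norm f * l2_norm (\<lambda>t. ?u h (Z n) t - ?u h z t))
          \<longlonglongrightarrow> 0" by simp
    qed
    then show ?thesis by (rule LIM_zero_cancel)
  qed
  then show ?thesis by (auto simp: continuous_on_sequentially comp_def)
qed

text \<open>The character is periodic, so it can be moved inside the periodised sum; unfolding the sum leaves
  the integral in \<open>moyal\<close> with \<open>g\<close> and \<open>h\<close> shifted by \<open>Y\<close>.\<close>

lemma fourier_coefficient:
  assumes f: "f \<in> L2" and h: "h \<in> L2" and Y: "\<And>l. l \<in> \<Lambda> \<Longrightarrow> symplectic Y \<bullet> l \<in> \<int>"
  shows "(LINT z|lborel. indicator D z *\<^sub>R (periodisation f h z * ephase (symplectic Y \<bullet> z))) =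
    l2_inner f (tf_shift Y h) * l2_inner (tf_shift Y g) \<gamma>"
proof -
  let ?F = "\<lambda>z. ephase (symplectic Y \<bullet> z) * gabor_term g \<gamma> f h z"
  note m = moyal[OF f tf_shift_L2[OF h, of Y] \<gamma> tf_shift_L2[OF g, of Y], folded gabor_term_character]
  have per: "ephase (symplectic Y \<bullet> (z + l)) = ephase (symplectic Y \<bullet> z)" if "l \<in> \<Lambda>" for z l
  proof -
    have "ephase (symplectic Y \<bullet> l) = 1" using Y[OF that] by (simp add: ephase_eq_1_iff)
    then show ?thesis by (simp add: inner_add_right ephase_add)
  qed
  have inner: "(LINT l|count_space \<Lambda>. indicator D z *\<^sub>R ?F (z + l)) =
      indicator D z *\<^sub>R (periodisation f h z * ephase (symplectic Y \<bullet> z))" for z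
  proof -
    have "(LINT l|count_space \<Lambda>. indicator D z *\<^sub>R ?F (z + l)) =
        (LINT l|count_space \<Lambda>. (complex_of_real (indicator D z) * ephase (symplectic Y \<bullet> z)) * gabor_term g \<gamma> f h (z + l))"
      by (intro Bochner_Integration.integral_cong refl) (simp add: per scaleR_conv_of_real mult_ac)
    also have "\<dots> = (complex_of_real (indicator D z) * ephase (symplectic Y \<bullet> z)) * periodisation f h z"
      unfolding periodisation_eq by (rule integral_mult_right_zero)
    finally show ?thesis by (simp add: scaleR_conv_of_real mult_ac)
  qed
  show ?thesis
    using integral_periodisation[OF m(1)] m(2) by (simp only: inner)
qed

lemma integral_character:
  assumes Y: "\<And>l. l \<in> \<Lambda> \<Longrightarrow> symplectic Y \<bullet> l \<in> \<int>"
  shows "(LINT z|lborel. indicator D z *\<^sub>R ephase (symplectic Y \<bullet> z)) = (if Y = 0 then complex_of_real (measure lborel D) else 0)"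
proof (cases "Y = 0")
  case True
  then have "(LINT z|lborel. indicator D z *\<^sub>R ephase (symplectic Y \<bullet> z)) = (LINT z|lborel. complex_of_real (indicator D z))"
    by (simp add: symplectic_def scaleR_conv_of_real flip: zero_prod_def)
  then show ?thesis using True D by (simp add: integral_complex_of_real)
next
  case False
  then show ?thesis using integral_character_zero[OF dom Y _ finite_D] by simp
qed

lemma form_of_frame_op:
  assumes f: "f \<in> L2" and h: "h \<in> L2" and S: "gabor_frame_op g \<gamma> \<Lambda> f k"
  shows "form f h = l2_inner k h"
proof -
  let ?c = "\<lambda>l. l2_inner f (tf_shift l \<gamma>)"
  let ?s = "\<lambda>F t. \<Sum>l\<in>F. ?c l * tf_shift l g t"
  have k: "k \<in> L2" and lim: "((\<lambda>F. l2_norm (\<lambda>t. ?s F t - k t)) \<longlongrightarrow> 0) (finite_subsets_at_top \<Lambda>)"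
    using S by (auto simp: gabor_frame_op_def l2_has_sum_def)
  have s: "?s F \<in> L2" for F by (intro L2_sum L2_scale tf_shift_L2 g)
  have sum: "(\<Sum>l\<in>F. gabor_term g \<gamma> f h l) = l2_inner (?s F) h" for F
    by (subst l2_inner_sum_left) (auto intro: L2_scale tf_shift_L2 g h simp: l2_inner_scale_left gabor_term_def)
  have "((\<lambda>F. (\<Sum>l\<in>F. gabor_term g \<gamma> f h l) - l2_inner k h) \<longlongrightarrow> 0) (finite_subsets_at_top \<Lambda>)"
  proof (rule Lim_null_comparison)
    show "\<forall>\<^sub>F F in finite_subsets_at_top \<Lambda>. cmod ((\<Sum>l\<in>F. gabor_term g \<gamma> f h l) - l2_inner k h)
        \<le> l2_norm (\<lambda>t. ?s F t - k t) * l2_norm h"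
      unfolding sum l2_inner_diff_left[OF s k h, symmetric]
      by (intro always_eventually allI l2_cauchy_schwarz L2_diff s k h)
    show "((\<lambda>F. l2_norm (\<lambda>t. ?s F t - k t) * l2_norm h) \<longlongrightarrow> 0) (finite_subsets_at_top \<Lambda>)"
      using tendsto_mult_right[OF lim, of "l2_norm h"] by simp
  qed
  then have "(gabor_term g \<gamma> f h has_sum l2_inner k h) \<Lambda>"
    unfolding has_sum_def by (rule LIM_zero_cancel)
  then show ?thesis using form_has_sum[OF f h] has_sum_unique by blast
qed

text \<open>Norm convergence by duality: the residual \<open>r\<close> of a partial sum over \<open>F\<close> satisfies
  \<open>\<langle>r, r\<rangle> = \<Sum>l\<in>\<Lambda> - F. \<langle>f, \<pi> l \<gamma>\<rangle> \<langle>\<pi> l g, r\<rangle>\<close>, which the Bessel bound of \<open>g\<close> estimates by \<open>\<parallel>r\<parallel>\<close> times the tail of a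
  convergent sum of squares.\<close>

lemma frame_op_of_form:
  assumes f: "f \<in> L2" and form: "\<And>h. h \<in> L2 \<Longrightarrow> form f h = l2_inner f h"
  shows "gabor_frame_op g \<gamma> \<Lambda> f f"
proof -
  let ?c = "\<lambda>l. l2_inner f (tf_shift l \<gamma>)"
  let ?s = "\<lambda>F t. \<Sum>l\<in>F. ?c l * tf_shift l g t"
  let ?q = "\<lambda>l. (cmod (?c l))\<^sup>2"
  have s: "?s F \<in> L2" for F by (intro L2_sum L2_scale tf_shift_L2 g)
  have "?q summable_on \<Lambda>"
  proof (rule nonneg_bdd_above_summable_on)
    show "bdd_above (sum ?q ` {F. F \<subseteq> \<Lambda> \<and> finite F})"
      using bessel_\<gamma> f by (intro bdd_aboveI2[where M = "C\<gamma> * (l2_norm f)\<^sup>2"]) (auto simp: bessel_def)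
  qed simp
  then have Q: "(?q has_sum infsum ?q \<Lambda>) \<Lambda>" by simp
  define T where "T = infsum ?q \<Lambda>"
  have QT: "(\<Sum>l\<in>F. ?q l) \<le> T" if "finite F" "F \<subseteq> \<Lambda>" for F
    unfolding T_def using \<open>?q summable_on \<Lambda>\<close> that by (intro finite_sum_le_infsum) auto
  have Cg0: "0 \<le> Cg" using bessel_g by (simp add: bessel_def)
  have bound: "l2_norm (\<lambda>t. ?s F t - f t) \<le> sqrt (T - (\<Sum>l\<in>F. ?q l)) * sqrt Cg" if F: "finite F" "F \<subseteq> \<Lambda>" for F
  proof -
    let ?r = "\<lambda>t. f t - ?s F t"
    have r: "?r \<in> L2" by (intro L2_diff f s)
    have sum: "(\<Sum>l\<in>F. gabor_term g \<gamma> f ?r l) = l2_inner (?s F) ?r"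
      by (subst l2_inner_sum_left) (auto intro: L2_scale tf_shift_L2 g r simp: l2_inner_scale_left gabor_term_def)
    have "(gabor_term g \<gamma> f ?r has_sum (form f ?r - (\<Sum>l\<in>F. gabor_term g \<gamma> f ?r l))) (\<Lambda> - F)"
      by (rule has_sum_Diff[OF form_has_sum[OF f r] has_sum_finite[OF F(1)] F(2)])
    also have "form f ?r - (\<Sum>l\<in>F. gabor_term g \<gamma> f ?r l) = l2_inner ?r ?r"
      unfolding sum form[OF r] by (rule l2_inner_diff_left[OF f s r, symmetric])
    finally have hs: "(gabor_term g \<gamma> f ?r has_sum l2_inner ?r ?r) (\<Lambda> - F)" .
    have "cmod (l2_inner ?r ?r) \<le> sqrt (T - (\<Sum>l\<in>F. ?q l)) * (sqrt Cg * l2_norm ?r)"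
    proof (rule has_sum_norm_le[OF hs])
      fix S assume S: "finite S" "S \<subseteq> \<Lambda> - F"
      have "(\<Sum>l\<in>S. ?q l) + (\<Sum>l\<in>F. ?q l) = (\<Sum>l\<in>S \<union> F. ?q l)"
        using S F by (intro sum.union_disjoint[symmetric]) auto
      also have "\<dots> \<le> T" using S F by (intro QT) auto
      finally have le: "(\<Sum>l\<in>S. ?q l) \<le> T - (\<Sum>l\<in>F. ?q l)" by simp
      have "cmod (\<Sum>l\<in>S. gabor_term g \<gamma> f ?r l) \<le> sqrt (\<Sum>l\<in>S. ?q l) * (sqrt Cg * l2_norm ?r)"
        using S by (intro order_trans[OF norm_sum sum_gabor_term_le[OF f r]]) auto
      also have "\<dots> \<le> sqrt (T - (\<Sum>l\<in>F. ?q l)) * (sqrt Cg * l2_norm ?r)"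
        using le Cg0 by (intro mult_right_mono real_sqrt_le_mono) auto
      finally show "cmod (\<Sum>l\<in>S. gabor_term g \<gamma> f ?r l) \<le> sqrt (T - (\<Sum>l\<in>F. ?q l)) * (sqrt Cg * l2_norm ?r)" .
    qed
    moreover have "cmod (l2_inner ?r ?r) = l2_norm ?r * l2_norm ?r"
      unfolding l2_inner_self norm_of_real by (simp add: power2_eq_square)
    ultimately have "l2_norm ?r * l2_norm ?r \<le> (sqrt (T - (\<Sum>l\<in>F. ?q l)) * sqrt Cg) * l2_norm ?r"
      by (simp only: mult.assoc)
    moreover have "0 \<le> sqrt (T - (\<Sum>l\<in>F. ?q l)) * sqrt Cg"
      using QT[OF F] Cg0 by simp
    moreover have "x \<le> K" if "x * x \<le> K * x" "0 \<le> K" "0 \<le> x" for x K :: real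
      using that by (cases "x = 0") (auto simp: mult_le_cancel_right)
    ultimately have "l2_norm ?r \<le> sqrt (T - (\<Sum>l\<in>F. ?q l)) * sqrt Cg"
      using l2_norm_nonneg by blast
    then show ?thesis by (simp only: l2_norm_minus_commute[of "?s F" f])
  qed
  have "((\<lambda>F. l2_norm (\<lambda>t. ?s F t - f t)) \<longlongrightarrow> 0) (finite_subsets_at_top \<Lambda>)"
  proof (rule tendsto_sandwich[where f = "\<lambda>_. 0"])
    show "\<forall>\<^sub>F F in finite_subsets_at_top \<Lambda>. l2_norm (\<lambda>t. ?s F t - f t) \<le> sqrt (T - (\<Sum>l\<in>F. ?q l)) * sqrt Cg"
      using bound by (rule eventually_finite_subsets_at_top_weakI)
    have "((\<lambda>F. sqrt (T - (\<Sum>l\<in>F. ?q l)) * sqrt Cg) \<longlongrightarrow> sqrt (T - T) * sqrt Cg) (finite_subsets_at_top \<Lambda>)"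
      using Q unfolding has_sum_def T_def by (intro tendsto_mult tendsto_real_sqrt tendsto_diff tendsto_const)
    then show "((\<lambda>F. sqrt (T - (\<Sum>l\<in>F. ?q l)) * sqrt Cg) \<longlongrightarrow> 0) (finite_subsets_at_top \<Lambda>)" by simp
    show "((\<lambda>_. 0) \<longlongrightarrow> (0::real)) (finite_subsets_at_top \<Lambda>)" by simp
  qed auto
  then show ?thesis
    using f g by (auto simp: gabor_frame_op_def l2_has_sum_def intro: L2_scale tf_shift_L2)
qed

text \<open>The biorthogonality condition with the covolume on the right-hand side.  One direction takes \<open>h\<close> to
  be the Gaussian and \<open>f = \<pi> Y h\<close>, so that the factor \<open>\<langle>f, \<pi> Y h\<rangle>\<close> cancels; the other applies
  \<open>fourier_uniqueness\<close> to the periodised form minus the constant \<open>\<langle>f, h\<rangle>\<close> and evaluates at the origin.\<close>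

lemma wexler_raz:
  "(\<forall>f\<in>L2. gabor_frame_op g \<gamma> \<Lambda> f f) \<longleftrightarrow>
   (\<forall>Y. (\<forall>l\<in>\<Lambda>. symplectic Y \<bullet> l \<in> \<int>) \<longrightarrow>
      l2_inner (tf_shift Y g) \<gamma> = (if Y = 0 then complex_of_real (measure lborel D) else 0))"
proof (intro iffI allI impI ballI)
  fix Y assume id: "\<forall>f\<in>L2. gabor_frame_op g \<gamma> \<Lambda> f f" and Y: "\<forall>l\<in>\<Lambda>. symplectic Y \<bullet> l \<in> \<int>"
  let ?h = "gauss :: real ^ 'd \<Rightarrow> complex"
  let ?f = "tf_shift Y ?h"
  have h: "?h \<in> L2" and f: "?f \<in> L2" by (auto intro: gauss_L2 tf_shift_L2)
  have "periodisation ?f ?h z = l2_inner ?f ?h" for z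
  proof -
    have "gabor_frame_op g \<gamma> \<Lambda> (tf_shift (- z) ?f) (tf_shift (- z) ?f)"
      using id tf_shift_L2[OF f] by blast
    from form_of_frame_op[OF tf_shift_L2[OF f] tf_shift_L2[OF h] this]
    show ?thesis by (simp only: periodisation_def l2_inner_tf_shift)
  qed
  then have "(LINT z|lborel. indicator D z *\<^sub>R (l2_inner ?f ?h * ephase (symplectic Y \<bullet> z))) =
      l2_inner ?f (tf_shift Y ?h) * l2_inner (tf_shift Y g) \<gamma>"
    using fourier_coefficient[OF f h, of Y] Y by simp
  also have "(LINT z|lborel. indicator D z *\<^sub>R (l2_inner ?f ?h * ephase (symplectic Y \<bullet> z))) =
      (LINT z|lborel. l2_inner ?f ?h * (indicator D z *\<^sub>R ephase (symplectic Y \<bullet> z)))"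
    by (simp add: scaleR_conv_of_real mult_ac)
  also have "\<dots> = l2_inner ?f ?h * (LINT z|lborel. indicator D z *\<^sub>R ephase (symplectic Y \<bullet> z))"
    by (rule integral_mult_right_zero)
  finally have eq: "l2_inner ?f ?h * (if Y = 0 then complex_of_real (measure lborel D) else 0) =
      l2_inner ?h ?h * l2_inner (tf_shift Y g) \<gamma>"
    using integral_character[of Y] Y by (simp add: l2_inner_tf_shift)
  have "l2_inner ?h ?h \<noteq> 0"
    using l2_norm_gauss_pos[where 'd='d] by (simp add: l2_inner_self)
  then show "l2_inner (tf_shift Y g) \<gamma> = (if Y = 0 then complex_of_real (measure lborel D) else 0)"
    using eq by (cases "Y = 0") auto
next
  fix f :: "real ^ 'd \<Rightarrow> complex"
  assume bi: "\<forall>Y. (\<forall>l\<in>\<Lambda>. symplectic Y \<bullet> l \<in> \<int>) \<longrightarrow>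
      l2_inner (tf_shift Y g) \<gamma> = (if Y = 0 then complex_of_real (measure lborel D) else 0)"
    and f: "f \<in> L2"
  show "gabor_frame_op g \<gamma> \<Lambda> f f"
  proof (rule frame_op_of_form[OF f])
    fix h :: "real ^ 'd \<Rightarrow> complex" assume h: "h \<in> L2"
    have "periodisation f h 0 - l2_inner f h = 0"
    proof (rule fourier_uniqueness[OF dom spanning finite_D, where \<Phi> = "\<lambda>z. periodisation f h z - l2_inner f h"])
      show "continuous_on UNIV (\<lambda>z. periodisation f h z - l2_inner f h)"
        by (intro continuous_on_diff continuous_periodisation f h continuous_on_const)
      show "periodisation f h (z + l) - l2_inner f h = periodisation f h z - l2_inner f h" if "l \<in> \<Lambda>" for z l
        using that by (simp add: periodisation_periodic)
      fix y assume y: "\<And>l. l \<in> \<Lambda> \<Longrightarrow> y \<bullet> l \<in> \<int>"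
      obtain Y where Y: "y = symplectic Y" using symplectic_surj by metis
      have yl: "\<And>l. l \<in> \<Lambda> \<Longrightarrow> symplectic Y \<bullet> l \<in> \<int>" using y Y by simp
      let ?E = "\<lambda>z. ephase (symplectic Y \<bullet> z)"
      have M: "cmod (periodisation f h z * ?E z) \<le> sqrt C\<gamma> * sqrt Cg * l2_norm f * l2_norm h" for z
        using form_bound[OF tf_shift_L2[OF f] tf_shift_L2[OF h]]
        by (simp add: periodisation_def norm_mult l2_norm_tf_shift)
      have i1: "integrable lborel (\<lambda>z. indicator D z *\<^sub>R (periodisation f h z * ?E z))"
        by (rule integrable_indicator_continuous[OF D finite_D _ M])
           (intro continuous_on_mult continuous_periodisation f h continuous_intros)
      have i2: "integrable lborel (\<lambda>z. l2_inner f h * (indicator D z *\<^sub>R ?E z))"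
        by (intro integrable_mult_right integrable_indicator_continuous[OF D finite_D, of _ 1])
           (auto intro!: continuous_intros)
      have "(LINT z|lborel. indicator D z *\<^sub>R ((periodisation f h z - l2_inner f h) * ?E z)) =
          (LINT z|lborel. indicator D z *\<^sub>R (periodisation f h z * ?E z) - l2_inner f h * (indicator D z *\<^sub>R ?E z))"
        by (simp add: scaleR_conv_of_real algebra_simps)
      also have "\<dots> = (LINT z|lborel. indicator D z *\<^sub>R (periodisation f h z * ?E z)) -
          l2_inner f h * (LINT z|lborel. indicator D z *\<^sub>R ?E z)"
        unfolding Bochner_Integration.integral_diff[OF i1 i2] integral_mult_right_zero ..
      also have "(LINT z|lborel. indicator D z *\<^sub>R (periodisation f h z * ?E z)) =
          l2_inner f (tf_shift Y h) * l2_inner (tf_shift Y g) \<gamma>"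
        by (rule fourier_coefficient[OF f h]) (rule yl)
      also have "(LINT z|lborel. indicator D z *\<^sub>R ?E z) = (if Y = 0 then complex_of_real (measure lborel D) else 0)"
        by (rule integral_character) (rule yl)
      also have "l2_inner (tf_shift Y g) \<gamma> = (if Y = 0 then complex_of_real (measure lborel D) else 0)"
        using bi yl by blast
      also have "l2_inner f (tf_shift Y h) * (if Y = 0 then complex_of_real (measure lborel D) else 0) -
          l2_inner f h * (if Y = 0 then complex_of_real (measure lborel D) else 0) = 0"
        by simp
      finally show "(LINT z|lborel. indicator D z *\<^sub>R ((periodisation f h z - l2_inner f h) * ephase (y \<bullet> z))) = 0"
        by (simp only: Y)
    qed
    then show "form f h = l2_inner f h" by (simp add: periodisation_def)
  qed
qed

end

theorem theorem6p2:
  fixes \<Lambda> :: "((real ^ 'd) \<times> (real ^ 'd)) set"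
    and g \<gamma> :: "real ^ 'd \<Rightarrow> complex"
  assumes "lattice_subgroup \<Lambda>"
    and "g \<in> S0"
    and "\<gamma> \<in> S0"
  shows "(\<forall>f\<in>L2. gabor_frame_op g \<gamma> \<Lambda> f f) \<longleftrightarrow>
         (\<forall>l\<in>adjoint_lattice \<Lambda>.
            complex_of_real (inverse (covolume \<Lambda>)) * l2_inner \<gamma> (tf_shift l g) =
              (if l = 0 then 1 else 0))"
proof -
  have G: "discrete_subgroup \<Lambda>"
    using assms(1) discreteD unfolding lattice_subgroup_def discrete_subgroup_def by blast
  have span: "span \<Lambda> = UNIV"
    using assms(1) cocompact_span_UNIV[of _ \<Lambda>] unfolding lattice_subgroup_def by blast
  obtain D where fund: "lattice_domain \<Lambda> D" and D_pos: "0 < measure lborel D"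
    and D_fin: "emeasure lborel D < \<infinity>"
    by (rule lattice_domain_exists[OF G span])
  obtain Cg where Cg: "bessel \<Lambda> g Cg" by (rule bessel_S0[OF G span assms(2)])
  obtain C\<gamma> where C\<gamma>: "bessel \<Lambda> \<gamma> C\<gamma>" by (rule bessel_S0[OF G span assms(3)])
  interpret gabor_system \<Lambda> D g \<gamma> Cg C\<gamma>
    by (intro gabor_system.intro fund D_fin span S0_L2 assms Cg C\<gamma>)
  have fd: "fundamental_domain \<Lambda> X \<longleftrightarrow> lattice_domain \<Lambda> X" for X
    using G by (auto simp: fundamental_domain_def lattice_domain_def)
  have "fundamental_domain \<Lambda> (SOME X. fundamental_domain \<Lambda> X)"
    by (rule someI[of _ D]) (simp add: fd fund)
  then have "lattice_domain \<Lambda> (SOME X. fundamental_domain \<Lambda> X)"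
    by (rule fd[THEN iffD1])
  from fundamental_domains_same_measure[OF this fund] have vol: "covolume \<Lambda> = measure lborel D"
    by (simp add: covolume_def measure_def)
  have "complex_of_real (inverse (covolume \<Lambda>)) * l2_inner \<gamma> (tf_shift Y g) = (if Y = 0 then 1 else 0)
      \<longleftrightarrow> l2_inner (tf_shift Y g) \<gamma> = (if Y = 0 then complex_of_real (measure lborel D) else 0)" for Y
  proof -
    have "l2_inner \<gamma> (tf_shift Y g) = cnj (l2_inner (tf_shift Y g) \<gamma>)" by (simp add: l2_inner_cnj)
    moreover have "cnj x = complex_of_real r \<longleftrightarrow> x = complex_of_real r" for x r
      by (metis complex_cnj_cnj complex_cnj_complex_of_real)
    ultimately show ?thesis
      using D_pos by (auto simp: vol field_simps)
  qed
  then show ?thesis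
    unfolding wexler_raz adjoint_lattice_eq by auto
qed

end
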